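(* Let $f\in C^2$, $\varepsilon>0$, and let $u^0\in C^2([a,b],\mathbb{R}^N)$ be an extremal satisfying the natural boundary conditions $f^0_{p_j}(a)=0$ for $j\in I^{N}_a$, $f^0_{p_j}(b)=0$ for $j\in I^{N}_b$. (i) Suppose there is a field of extremals $\mathcal{P}$ for $u^0$, with slope $\psi$, such that (S) $\frac{\partial}{\partial v_j}f_{p_i}(a,v,\psi(a,v))=\frac{\partial}{\partial v_i}f_{p_j}(a,v,\psi(a,v))$ for all $i,j\in I$ and all $v$ with $v-u^0(a)\in B_\varepsilon$; (Fa) $f_p(a,v,\psi(a,v))\cdot(v-u^0(a))\le0$ whenever $v-u^0(a)\in\mathbb{R}^N_{D,a}\cap B_\varepsilon$; (Fb) $f_p(b,v,\psi(b,v))\cdot(v-u^0(b))\ge0$ whenever $v-u^0(b)\in\mathbb{R}^N_{D,b}\cap B_\varepsilon$; and suppose (E) $E(x,v,\psi(x,v),q)\ge0$ for all $(x,v)\in\mathcal{P}$ and $q\in\mathbb{R}^N$. Then $u^0$ is a strong minimizer of $\Phi$ in $u^0+C^1_D$. If (E) holds only for all $(x,v)\in\mathcal{P}$ and all $q$ with $|q-\psi(x,v)|\le\eta$ for some $\eta>0$, then $u^0$ is a weak minimizer. If moreover (with (E) for all $q$) the field is global, i.e. $\mathcal{P}=[a,b]\times\mathbb{R}^N$, and (S), (Fa), (Fb) hold with $B_\varepsilon$ replaced by $\mathbb{R}^N$, then $u^0$ is a global minimizer of $\Phi$ in $u^0+C^1_D$. (ii) Assume $I^{D}_a=\emptyset$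 and that there is a field of extremals for $u^0$ satisfying (S). If the reversed inequality $f_p(a,v,\psi(a,v))\cdot(v-u^0(a))\ge0$ holds in (Fa), and the reversed strict inequality $f_p(b,v,\psi(b,v))\cdot(v-u^0(b))<0$ holds for $v=u^0(b)+tw^0$, $t\in(0,1)$, where $w^0\in\mathbb{R}^N_{D,b}$ is fixed, then $u^0$ is not a weak minimizer. (iii) Assume in addition that $f\in C^3$ and there is $c^0>0$ with $\sum_{i,j}f^0_{p_ip_j}(x)\xi_i\xi_j\ge c^0|\xi|^2$ for all $\xi\in\mathbb{R}^N$, $x\in[a,b]$, and that for some (equivalently any) linearly independent solutions $h^{(1)},\dots,h^{(N)}$ of the Jacobi equation $\mathcal{A}h=0$ with $h(a)\in\mathbb{R}^N_{D,a}$, $\mathcal{B}h(a)\in\mathbb{R}^N_{N,a}$, the determinant $D(x)=\det(h^{(1)}(x),\dots,h^{(N)}(x))$ is nonzero on $(a,b]$ and either $I^{N}_b=\emptyset$ or $\mathcal{B}h(b)\cdot h(b)>0$ for all $h\in\mathrm{span}(h^{(1)},\dots,h^{(N)})\setminus\{0\}$ with $h(b)\in\mathbb{R}^N_{D,b}$. If $I^{D}_a=\emptyset$, or $I^{N}_a=\emptyset$, or [$f_{p_i}(a,u,p)$ for $i\in I^{D}_a$ does not depend on $u_j,p_j$ with $j\notin I^{D}_a$, and $f_{p_iu_j}=f_{p_ju_i}$ for $i,j\in I^{D}_a$], then a field of extremals for $u^0$ satisfying (S), (Fa), (Fb) exists.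
   Context: Let $-\infty<a<b<\infty$, $N\ge1$, $I=\{1,\dots,N\}$, $f:[a,b]\times\mathbb{R}^N\times\mathbb{R}^N\to\mathbb{R}$, $(x,u,p)\mapsto f(x,u,p)$, $\Phi(u)=\int_a^bf(x,u(x),u'(x))dx$ on $C^1([a,b],\mathbb{R}^N)$; $I^{D}_a,I^{D}_b\subset I$, $I^{N}_x=I\setminus I^{D}_x$, $\mathbb{R}^N_{D,x}=\{\xi:\xi_i=0\ (i\in I^{D}_x)\}$, $\mathbb{R}^N_{N,x}=\{\xi:\xi_i=0\ (i\in I^{N}_x)\}$, $C^1_D=\{v\in C^1: v_i(a)=0\ (i\in I^{D}_a),\ v_i(b)=0\ (i\in I^{D}_b)\}$, $B_\varepsilon=\{\xi\in\mathbb{R}^N:|\xi|<\varepsilon\}$, $\mathfrak f^0(x)=\mathfrak f(x,u^0(x),(u^0)'(x))$. An extremal satisfies $\frac{d}{dx}f_{p_i}=f_{u_i}$ along it. Weak/strong minimizer in $u^0+C^1_D$: $\Phi(v)\ge\Phi(u^0)$ for $v\in u^0+C^1_D$ with $\|v-u^0\|_{C^1}<\varepsilon'$ resp. $\|v-u^0\|_C<\varepsilon'$ for some $\varepsilon'>0$; global minimizer: for all $v\in u^0+C^1_D$. Field of extremals for an extremal $u^0\in C^2$ (with $f\in C^2$): for some $\tilde\varepsilon>0$, the image $\mathcal{P}$ of a $C^1$-diffeomorphism $P:[a,b]\times B_{\tilde\varepsilon}\to[a,b]\times\mathbb{R}^N$, $(x,\alpha)\mapsto(x,\varphi(x,\alpha))$,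 with $\varphi_x\in C^1$, each $\varphi(\cdot,\alpha)$ an extremal and $\varphi(\cdot,0)=u^0$; its slope is $\psi:\mathcal{P}\to\mathbb{R}^N$, $\psi(x,v)=\varphi_x(x,\alpha(x,v))$ where $\varphi(x,\alpha(x,v))=v$. Excess function: $E(x,u,p,q)=f(x,u,q)-f(x,u,p)-(q-p)\cdot f_p(x,u,p)$. Jacobi operators: $\mathcal{B}_ih=\sum_j(f^0_{p_ip_j}h_j'+f^0_{p_iu_j}h_j)$, $\mathcal{C}_ih=\sum_j(f^0_{u_ip_j}h_j'+f^0_{u_iu_j}h_j)$, $\mathcal{A}_ih=-\frac{d}{dx}\mathcal{B}_ih+\mathcal{C}_ih$. *)

theory Defs
  imports "HOL-Analysis.Analysis"
begin

definition pdir :: "('a::real_normed_vector \<Rightarrow> real) \<Rightarrow> 'a \<Rightarrow> 'a \<Rightarrow> real" where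
  "pdir g e z = deriv (\<lambda>t. g (z + t *\<^sub>R e)) 0"

fun iter_pd :: "'a::real_normed_vector list \<Rightarrow> ('a \<Rightarrow> real) \<Rightarrow> 'a \<Rightarrow> real" where
  "iter_pd [] g = g"
| "iter_pd (e # es) g = pdir (iter_pd es g) e"

definition Ck_open :: "nat \<Rightarrow> 'a::euclidean_space set \<Rightarrow> ('a \<Rightarrow> real) \<Rightarrow> bool" where
  "Ck_open k U g \<longleftrightarrow> open U
     \<and> (\<forall>es. set es \<subseteq> Basis \<and> length es \<le> k \<longrightarrow> continuous_on U (iter_pd es g))
     \<and> (\<forall>es e z. set es \<subseteq> Basis \<and> length es < k \<and> e \<in> Basis \<and> z \<in> U \<longrightarrow>
            (\<lambda>t. iter_pd es g (z + t *\<^sub>R e)) differentiable (at 0))"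

definition Ck_on :: "nat \<Rightarrow> 'a::euclidean_space set \<Rightarrow> ('a \<Rightarrow> real) \<Rightarrow> bool" where
  "Ck_on k S g \<longleftrightarrow> (\<exists>U h. S \<subseteq> U \<and> Ck_open k U h \<and> (\<forall>z\<in>S. h z = g z))"

definition Ck_vec :: "nat \<Rightarrow> 'a::euclidean_space set \<Rightarrow> ('a \<Rightarrow> real^'n) \<Rightarrow> bool" where
  "Ck_vec k S g \<longleftrightarrow> (\<forall>i. Ck_on k S (\<lambda>z. g z $ i))"

definition integrand_Ck :: "nat \<Rightarrow> real \<Rightarrow> real \<Rightarrow> (real \<Rightarrow> real^'n \<Rightarrow> real^'n \<Rightarrow> real) \<Rightarrow> bool" where
  "integrand_Ck k a b f \<longleftrightarrow> Ck_on k ({a..b} \<times> UNIV \<times> UNIV) (\<lambda>(x, u, p). f x u p)"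

definition vderiv :: "real \<Rightarrow> real \<Rightarrow> (real \<Rightarrow> real^'n) \<Rightarrow> real \<Rightarrow> real^'n" where
  "vderiv a b u x = vector_derivative u (at x within {a..b})"

definition fp :: "(real \<Rightarrow> real^'n \<Rightarrow> real^'n \<Rightarrow> real) \<Rightarrow> real \<Rightarrow> real^'n \<Rightarrow> real^'n \<Rightarrow> real^'n" where
  "fp f x u p = (\<chi> i. pdir (f x u) (axis i 1) p)"

definition fu :: "(real \<Rightarrow> real^'n \<Rightarrow> real^'n \<Rightarrow> real) \<Rightarrow> real \<Rightarrow> real^'n \<Rightarrow> real^'n \<Rightarrow> real^'n" where
  "fu f x u p = (\<chi> i. pdir (\<lambda>w. f x w p) (axis i 1) u)"

definition fpp :: "(real \<Rightarrow> real^'n \<Rightarrow> real^'n \<Rightarrow> real) \<Rightarrow> real \<Rightarrow> real^'n \<Rightarrow> real^'n \<Rightarrow> 'n \<Rightarrow> 'n \<Rightarrow> real" where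
  "fpp f x u p i j = pdir (\<lambda>q. fp f x u q $ i) (axis j 1) p"

definition fpu :: "(real \<Rightarrow> real^'n \<Rightarrow> real^'n \<Rightarrow> real) \<Rightarrow> real \<Rightarrow> real^'n \<Rightarrow> real^'n \<Rightarrow> 'n \<Rightarrow> 'n \<Rightarrow> real" where
  "fpu f x u p i j = pdir (\<lambda>w. fp f x w p $ i) (axis j 1) u"

definition fup :: "(real \<Rightarrow> real^'n \<Rightarrow> real^'n \<Rightarrow> real) \<Rightarrow> real \<Rightarrow> real^'n \<Rightarrow> real^'n \<Rightarrow> 'n \<Rightarrow> 'n \<Rightarrow> real" where
  "fup f x u p i j = pdir (\<lambda>q. fu f x u q $ i) (axis j 1) p"

definition fuu :: "(real \<Rightarrow> real^'n \<Rightarrow> real^'n \<Rightarrow> real) \<Rightarrow> real \<Rightarrow> real^'n \<Rightarrow> real^'n \<Rightarrow> 'n \<Rightarrow> 'n \<Rightarrow> real" where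
  "fuu f x u p i j = pdir (\<lambda>w. fu f x w p $ i) (axis j 1) u"

definition excess :: "(real \<Rightarrow> real^'n \<Rightarrow> real^'n \<Rightarrow> real) \<Rightarrow> real \<Rightarrow> real^'n \<Rightarrow> real^'n \<Rightarrow> real^'n \<Rightarrow> real" where
  "excess f x u p q = f x u q - f x u p - (q - p) \<bullet> fp f x u p"

definition Phi :: "(real \<Rightarrow> real^'n \<Rightarrow> real^'n \<Rightarrow> real) \<Rightarrow> real \<Rightarrow> real \<Rightarrow> (real \<Rightarrow> real^'n) \<Rightarrow> real" where
  "Phi f a b v = integral {a..b} (\<lambda>x. f x (v x) (vderiv a b v x))"

definition RD :: "'n set \<Rightarrow> (real^'n) set" where
  "RD ID = {\<xi>. \<forall>i\<in>ID. \<xi> $ i = 0}"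

definition RN :: "'n set \<Rightarrow> (real^'n) set" where
  "RN ID = {\<xi>. \<forall>i. i \<notin> ID \<longrightarrow> \<xi> $ i = 0}"

definition admissible :: "real \<Rightarrow> real \<Rightarrow> 'n set \<Rightarrow> 'n set \<Rightarrow> (real \<Rightarrow> real^'n) \<Rightarrow> (real \<Rightarrow> real^'n) \<Rightarrow> bool" where
  "admissible a b IDa IDb u0 v \<longleftrightarrow> Ck_vec 1 {a..b} v
     \<and> (\<forall>i\<in>IDa. v a $ i = u0 a $ i) \<and> (\<forall>i\<in>IDb. v b $ i = u0 b $ i)"

definition Cnorm :: "real \<Rightarrow> real \<Rightarrow> (real \<Rightarrow> real^'n) \<Rightarrow> real" where
  "Cnorm a b w = (SUP x\<in>{a..b}. norm (w x))"

definition C1dist :: "real \<Rightarrow> real \<Rightarrow> (real \<Rightarrow> real^'n) \<Rightarrow> (real \<Rightarrow> real^'n) \<Rightarrow> real" where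
  "C1dist a b v u = Cnorm a b (\<lambda>x. v x - u x) + Cnorm a b (\<lambda>x. vderiv a b v x - vderiv a b u x)"

definition weak_min where
  "weak_min f a b IDa IDb u0 \<longleftrightarrow> (\<exists>\<epsilon>'>0. \<forall>v. admissible a b IDa IDb u0 v \<and> C1dist a b v u0 < \<epsilon>'
      \<longrightarrow> Phi f a b v \<ge> Phi f a b u0)"

definition strong_min where
  "strong_min f a b IDa IDb u0 \<longleftrightarrow> (\<exists>\<epsilon>'>0. \<forall>v. admissible a b IDa IDb u0 v
      \<and> Cnorm a b (\<lambda>x. v x - u0 x) < \<epsilon>' \<longrightarrow> Phi f a b v \<ge> Phi f a b u0)"

definition global_min where
  "global_min f a b IDa IDb u0 \<longleftrightarrow> (\<forall>v. admissible a b IDa IDb u0 v \<longrightarrow> Phi f a b v \<ge> Phi f a b u0)"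

definition extremal :: "(real \<Rightarrow> real^'n \<Rightarrow> real^'n \<Rightarrow> real) \<Rightarrow> real \<Rightarrow> real \<Rightarrow> (real \<Rightarrow> real^'n) \<Rightarrow> bool" where
  "extremal f a b u \<longleftrightarrow> Ck_vec 1 {a..b} u \<and>
     (\<forall>x\<in>{a..b}. \<forall>i. ((\<lambda>y. fp f y (u y) (vderiv a b u y) $ i) has_real_derivative
         (fu f x (u x) (vderiv a b u x) $ i)) (at x within {a..b}))"

text \<open>The field is given by the parametrisation phi on [a,b] x B_et; P(x,al) = (x, phi x al).\<close>
definition field_set :: "real \<Rightarrow> real \<Rightarrow> real \<Rightarrow> (real \<Rightarrow> real^'n \<Rightarrow> real^'n) \<Rightarrow> (real \<times> (real^'n)) set" where
  "field_set a b et \<phi> = (\<lambda>(x, \<alpha>). (x, \<phi> x \<alpha>)) ` ({a..b} \<times> ball 0 et)"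

definition field_slope :: "real \<Rightarrow> real \<Rightarrow> real \<Rightarrow> (real \<Rightarrow> real^'n \<Rightarrow> real^'n) \<Rightarrow> real \<Rightarrow> real^'n \<Rightarrow> real^'n" where
  "field_slope a b et \<phi> x v = vderiv a b (\<lambda>y. \<phi> y (THE \<alpha>. \<alpha> \<in> ball 0 et \<and> \<phi> x \<alpha> = v)) x"

definition is_field :: "(real \<Rightarrow> real^'n \<Rightarrow> real^'n \<Rightarrow> real) \<Rightarrow> real \<Rightarrow> real \<Rightarrow> (real \<Rightarrow> real^'n)
    \<Rightarrow> real \<Rightarrow> (real \<Rightarrow> real^'n \<Rightarrow> real^'n) \<Rightarrow> bool" where
  "is_field f a b u0 et \<phi> \<longleftrightarrow> et > 0
     \<and> Ck_vec 1 ({a..b} \<times> ball 0 et) (\<lambda>(x, \<alpha>). \<phi> x \<alpha>)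
     \<and> inj_on (\<lambda>(x, \<alpha>). (x, \<phi> x \<alpha>)) ({a..b} \<times> ball 0 et)
     \<and> (\<exists>\<alpha>inv. (\<forall>x\<in>{a..b}. \<forall>\<beta>\<in>ball 0 et. \<alpha>inv x (\<phi> x \<beta>) = \<beta>)
              \<and> Ck_vec 1 (field_set a b et \<phi>) (\<lambda>(x, v). \<alpha>inv x v))
     \<and> Ck_vec 1 ({a..b} \<times> ball 0 et) (\<lambda>(x, \<alpha>). vderiv a b (\<lambda>y. \<phi> y \<alpha>) x)
     \<and> (\<forall>\<beta>\<in>ball 0 et. extremal f a b (\<lambda>x. \<phi> x \<beta>))
     \<and> (\<forall>x\<in>{a..b}. \<phi> x 0 = u0 x)"

text \<open>Condition (S) at x = a, for v with v - u0(a) in the set W (B_eps or R^N), v in the field.\<close>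
definition cond_S where
  "cond_S f a b u0 et \<phi> W \<longleftrightarrow> (\<forall>v i j. v - u0 a \<in> W \<and> (a, v) \<in> field_set a b et \<phi> \<longrightarrow>
      pdir (\<lambda>w. fp f a w (field_slope a b et \<phi> a w) $ i) (axis j 1) v
    = pdir (\<lambda>w. fp f a w (field_slope a b et \<phi> a w) $ j) (axis i 1) v)"

definition cond_Fa where
  "cond_Fa f a b IDa u0 et \<phi> W \<longleftrightarrow> (\<forall>v. v - u0 a \<in> RD IDa \<inter> W \<and> (a, v) \<in> field_set a b et \<phi> \<longrightarrow>
      fp f a v (field_slope a b et \<phi> a v) \<bullet> (v - u0 a) \<le> 0)"

definition cond_Fb where
  "cond_Fb f a b IDb u0 et \<phi> W \<longleftrightarrow> (\<forall>v. v - u0 b \<in> RD IDb \<inter> W \<and> (b, v) \<in> field_set a b et \<phi> \<longrightarrow>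
      fp f b v (field_slope a b et \<phi> b v) \<bullet> (v - u0 b) \<ge> 0)"

definition jacB :: "(real \<Rightarrow> real^'n \<Rightarrow> real^'n \<Rightarrow> real) \<Rightarrow> real \<Rightarrow> real \<Rightarrow> (real \<Rightarrow> real^'n)
    \<Rightarrow> (real \<Rightarrow> real^'n) \<Rightarrow> real \<Rightarrow> real^'n" where
  "jacB f a b u0 h x = (\<chi> i. \<Sum>j\<in>UNIV.
      fpp f x (u0 x) (vderiv a b u0 x) i j * (vderiv a b h x $ j)
    + fpu f x (u0 x) (vderiv a b u0 x) i j * (h x $ j))"

definition jacC :: "(real \<Rightarrow> real^'n \<Rightarrow> real^'n \<Rightarrow> real) \<Rightarrow> real \<Rightarrow> real \<Rightarrow> (real \<Rightarrow> real^'n)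
    \<Rightarrow> (real \<Rightarrow> real^'n) \<Rightarrow> real \<Rightarrow> real^'n" where
  "jacC f a b u0 h x = (\<chi> i. \<Sum>j\<in>UNIV.
      fup f x (u0 x) (vderiv a b u0 x) i j * (vderiv a b h x $ j)
    + fuu f x (u0 x) (vderiv a b u0 x) i j * (h x $ j))"

text \<open>h solves the Jacobi equation A h = -(B h)' + C h = 0 on [a,b].\<close>
definition jacobi_sol where
  "jacobi_sol f a b u0 h \<longleftrightarrow> Ck_vec 2 {a..b} h \<and>
     (\<forall>x\<in>{a..b}. \<forall>i. ((\<lambda>y. jacB f a b u0 h y $ i) has_real_derivative (jacC f a b u0 h x $ i))
        (at x within {a..b}))"

end

theory Submission
  imports Defs
begin

text \<open>
  Along a field with slope \<open>\<psi>\<close> put \<open>p(x,v) = f\<^sub>p(x,v,\<psi>)\<close> and \<open>A = f - \<psi> \<bullet> p\<close>. Since the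
  members of the field are extremals, the Lagrange brackets of its variations do not depend on
  \<open>x\<close>, so (S) makes the form \<open>A dx + p \<bullet> dv\<close> closed. Deforming an admissible curve linearly into
  \<open>u0\<close> therefore changes Hilbert's invariant integral only by boundary terms, whose signs are
  given by (Fa) and (Fb), while \<open>\<Phi>\<close> exceeds Hilbert's integral by the integrated excess. For (ii)
  one compares \<open>u0\<close> with the members of the field that end at \<open>u0 b + t w0\<close>.

  For (iii) the field consists of the solutions \<open>(\<phi>, \<pi>)\<close> of the Hamiltonian system near \<open>u0\<close> with
  \<open>\<phi>\<^sub>i(a) - u0\<^sub>i(a) = \<delta> \<alpha>\<^sub>i\<close>, \<open>\<pi>\<^sub>i(a) - \<pi>0\<^sub>i(a) = \<alpha>\<^sub>i\<close> for \<open>i\<close> in \<open>IDa\<close>, and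
  \<open>\<phi>\<^sub>i(a) - u0\<^sub>i(a) = \<alpha>\<^sub>i\<close>, \<open>\<pi>\<^sub>i(a) = 0\<close> for the other \<open>i\<close>. Then \<open>p(a,\<cdot>)\<close> is affine with
  a diagonal linear part, which gives (S) and (Fa). For \<open>\<delta> = 0\<close> the variations of this family
  are the given Jacobi fields; for small \<open>\<delta> > 0\<close> they remain nondegenerate on \<open>(a,b]\<close> and
  become so at \<open>a\<close>, and the positivity at \<open>b\<close>, which yields (Fb), persists.
\<close>

section \<open>Continuously differentiable maps\<close>

text \<open>Condition (S) is known only at \<open>a\<close>, and only for starting points near
  \<open>u0 a\<close>, whereas closedness is needed at every point of the deformation. It is
  therefore carried along the extremal through that point, and the argument is confined to those
  points of the field whose extremal starts where (S) holds. The mean value theorem in the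
  deformation parameter leaves the boundary terms of a single intermediate curve, so (Fa) and (Fb)
  are each used at one point. The obstacle in the existence part is the left end point. For
  \<open>\<delta> = 0\<close> the family is degenerate at \<open>a\<close> as soon as
  \<open>IDa\<close> is nonempty, so compactness alone does not carry nondegeneracy over to small
  \<open>\<delta>\<close>. What holds uniformly in \<open>\<delta> \<ge> 0\<close> is the sign
  \<open>h a \<bullet> k a \<ge> 0\<close> of the initial data; with the Legendre condition it
  excludes zeros on some \<open>(a, a + \<kappa>]\<close> whose length does not depend on
  \<open>\<delta>\<close>. Compactness settles \<open>[a + \<kappa>, b]\<close>, and at
  \<open>a\<close> itself \<open>\<delta> > 0\<close> suffices.\<close>

text \<open>The derivative is an explicit function of point and direction, continuous jointly in
  both. On finite-dimensional domains this is continuity in operator norm, expressed without a type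
  of bounded linear maps.\<close>

definition C1_on :: "'a::real_normed_vector set \<Rightarrow> ('a \<Rightarrow> 'b::real_normed_vector) \<Rightarrow> ('a \<Rightarrow> 'a \<Rightarrow> 'b) \<Rightarrow> bool" where
  "C1_on U g g' \<longleftrightarrow> open U \<and> (\<forall>z\<in>U. (g has_derivative g' z) (at z))
     \<and> continuous_on (U \<times> UNIV) (\<lambda>(z, h). g' z h)"

lemma C1_onI:
  assumes "open U" "\<And>z. z \<in> U \<Longrightarrow> (g has_derivative g' z) (at z)"
    "continuous_on (U \<times> UNIV) (\<lambda>(z, h). g' z h)"
  shows "C1_on U g g'"
  using assms by (auto simp: C1_on_def)

lemma C1_on_open: "C1_on U g g' \<Longrightarrow> open U"
  by (simp add: C1_on_def)

lemma C1_on_deriv: "C1_on U g g' \<Longrightarrow> z \<in> U \<Longrightarrow> (g has_derivative g' z) (at z)"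
  by (simp add: C1_on_def)

lemma C1_on_linear_deriv: "C1_on U g g' \<Longrightarrow> z \<in> U \<Longrightarrow> bounded_linear (g' z)"
  by (meson C1_on_deriv has_derivative_bounded_linear)

lemma C1_on_continuous_deriv: "C1_on U g g' \<Longrightarrow> continuous_on (U \<times> UNIV) (\<lambda>(z, h). g' z h)"
  by (simp add: C1_on_def)

lemma C1_on_continuous_deriv_compose:
  assumes "C1_on U g g'" "continuous_on T p" "continuous_on T q" "\<And>t. t \<in> T \<Longrightarrow> p t \<in> U"
  shows "continuous_on T (\<lambda>t. g' (p t) (q t))"
proof -
  have "continuous_on T (\<lambda>t. (\<lambda>(z, h). g' z h) (p t, q t))"
    by (rule continuous_on_compose2[OF C1_on_continuous_deriv[OF assms(1)]])
      (use assms in \<open>auto intro!: continuous_intros\<close>)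
  then show ?thesis by simp
qed

lemma C1_on_continuous: "C1_on U g g' \<Longrightarrow> continuous_on U g"
  by (meson C1_on_deriv has_derivative_at_withinI has_derivative_continuous_on)

lemma C1_on_subset: "C1_on U g g' \<Longrightarrow> open V \<Longrightarrow> V \<subseteq> U \<Longrightarrow> C1_on V g g'"
  unfolding C1_on_def by (auto elim!: continuous_on_subset)

lemma C1_on_compose:
  assumes f: "C1_on U f f'" and g: "C1_on V g g'" and sub: "\<And>z. z \<in> U \<Longrightarrow> f z \<in> V"
  shows "C1_on U (\<lambda>z. g (f z)) (\<lambda>z h. g' (f z) (f' z h))"
proof (rule C1_onI)
  show "open U" using f by (rule C1_on_open)
  show "((\<lambda>z. g (f z)) has_derivative (\<lambda>h. g' (f z) (f' z h))) (at z)" if "z \<in> U" for z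
    using diff_chain_at[OF C1_on_deriv[OF f that] C1_on_deriv[OF g sub[OF that]]] by (simp add: o_def)
  have 1: "continuous_on (U \<times> UNIV) (\<lambda>t. f (fst t))"
    by (rule continuous_on_compose2[OF C1_on_continuous[OF f]]) (auto intro!: continuous_intros)
  have 2: "continuous_on (U \<times> UNIV) (\<lambda>t. f' (fst t) (snd t))"
    by (rule C1_on_continuous_deriv_compose[OF f]) (auto intro!: continuous_intros)
  show "continuous_on (U \<times> UNIV) (\<lambda>(z, h). g' (f z) (f' z h))"
    using C1_on_continuous_deriv_compose[OF g 1 2] sub by (auto simp: case_prod_unfold)
qed

lemma open_vimage_C1_on:
  assumes "C1_on U f f'" "open V" shows "open {z \<in> U. f z \<in> V}"
proof -
  have "{z \<in> U. f z \<in> V} = U \<inter> f -` V" by auto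
  then show ?thesis
    using continuous_open_preimage[OF C1_on_continuous[OF assms(1)] C1_on_open[OF assms(1)] assms(2)] by simp
qed

lemma C1_on_compose_vimage:
  assumes f: "C1_on U f f'" and g: "C1_on V g g'"
  shows "C1_on {z \<in> U. f z \<in> V} (\<lambda>z. g (f z)) (\<lambda>z h. g' (f z) (f' z h))"
proof (rule C1_on_compose[OF _ g])
  show "C1_on {z \<in> U. f z \<in> V} f f'"
    using f open_vimage_C1_on[OF f C1_on_open[OF g]] by (rule C1_on_subset) auto
qed auto

lemma C1_on_bounded_linear:
  assumes "bounded_linear l" "open U" shows "C1_on U l (\<lambda>z. l)"
proof (rule C1_onI)
  show "(l has_derivative l) (at z)" for z by (rule bounded_linear_imp_has_derivative[OF assms(1)])
  show "continuous_on (U \<times> UNIV) (\<lambda>(z::'a, h). l h)"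
    unfolding case_prod_unfold
    by (rule bounded_linear.continuous_on[OF assms(1)]) (auto intro!: continuous_intros)
qed fact

lemma C1_on_const: "open U \<Longrightarrow> C1_on U (\<lambda>z. c) (\<lambda>z h. 0)"
  by (rule C1_onI) (auto intro!: derivative_eq_intros simp: case_prod_unfold)

lemma C1_on_Pair:
  assumes "C1_on U f f'" "C1_on U g g'"
  shows "C1_on U (\<lambda>z. (f z, g z)) (\<lambda>z h. (f' z h, g' z h))"
  using assms unfolding C1_on_def
  by (auto intro!: has_derivative_Pair continuous_on_Pair simp: case_prod_unfold)

lemma C1_on_bilinear:
  assumes b: "bounded_bilinear prd" and f: "C1_on U f f'" and g: "C1_on U g g'"
  shows "C1_on U (\<lambda>z. prd (f z) (g z)) (\<lambda>z h. prd (f z) (g' z h) + prd (f' z h) (g z))"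
proof (rule C1_onI)
  show "open U" using f by (rule C1_on_open)
  show "((\<lambda>z. prd (f z) (g z)) has_derivative (\<lambda>h. prd (f z) (g' z h) + prd (f' z h) (g z))) (at z)" if "z \<in> U" for z
    using bounded_bilinear.FDERIV[OF b C1_on_deriv[OF f that] C1_on_deriv[OF g that]] .
  have 1: "continuous_on (U \<times> UNIV) (\<lambda>t. f (fst t))" "continuous_on (U \<times> UNIV) (\<lambda>t. g (fst t))"
    by (rule continuous_on_compose2[OF C1_on_continuous[OF f]] continuous_on_compose2[OF C1_on_continuous[OF g]];
       auto intro!: continuous_intros)+
  have 2: "continuous_on (U \<times> UNIV) (\<lambda>t. f' (fst t) (snd t))" "continuous_on (U \<times> UNIV) (\<lambda>t. g' (fst t) (snd t))"
    by (rule C1_on_continuous_deriv_compose[OF f] C1_on_continuous_deriv_compose[OF g]; auto intro!: continuous_intros)+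
  show "continuous_on (U \<times> UNIV) (\<lambda>(z, h). prd (f z) (g' z h) + prd (f' z h) (g z))"
    unfolding case_prod_unfold
    by (intro continuous_on_add bounded_bilinear.continuous_on[OF b] 1 2)
qed

lemma C1_on_add:
  assumes "C1_on U f f'" "C1_on U g g'"
  shows "C1_on U (\<lambda>z. f z + g z) (\<lambda>z h. f' z h + g' z h)"
  using assms unfolding C1_on_def
  by (auto intro!: has_derivative_add continuous_on_add simp: case_prod_unfold)

lemma C1_on_diff:
  assumes "C1_on U f f'" "C1_on U g g'"
  shows "C1_on U (\<lambda>z. f z - g z) (\<lambda>z h. f' z h - g' z h)"
  using assms unfolding C1_on_def
  by (auto intro!: has_derivative_diff continuous_on_diff simp: case_prod_unfold)

lemma C1_on_vec:
  fixes f :: "'a::real_normed_vector \<Rightarrow> real^'n"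
  assumes "open U" "\<And>i. C1_on U (\<lambda>z. f z $ i) (\<lambda>z h. f' z h $ i)"
  shows "C1_on U f f'"
proof (rule C1_onI)
  show "(f has_derivative f' z) (at z)" if "z \<in> U" for z
    unfolding has_derivative_componentwise_within[of f]
    using C1_on_deriv[OF assms(2) that] by (auto simp: Basis_vec_def inner_axis)
  have "continuous_on (U \<times> UNIV) (\<lambda>t. f' (fst t) (snd t) $ i)" for i
    using C1_on_continuous_deriv[OF assms(2)[of i]] by (simp add: case_prod_unfold)
  then have "continuous_on (U \<times> UNIV) (\<lambda>t. \<chi> i. f' (fst t) (snd t) $ i)"
    by (intro continuous_on_vec_lambda)
  then show "continuous_on (U \<times> UNIV) (\<lambda>(z, h). f' z h)"
    by (simp add: case_prod_unfold)
qed fact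

lemma C1_on_nth:
  fixes f :: "'a::real_normed_vector \<Rightarrow> real^'n"
  assumes "C1_on U f f'" shows "C1_on U (\<lambda>z. f z $ i) (\<lambda>z h. f' z h $ i)"
  using C1_on_compose[OF assms C1_on_bounded_linear[OF bounded_linear_vec_nth[of i] open_UNIV]] by simp

text \<open>The curve may have a merely one-sided derivative, as at the end points of {a..b}; the
  outer map is differentiable on a full neighbourhood.\<close>

lemma C1_on_curve:
  assumes "C1_on U g g'" "(c has_vector_derivative c') (at x within S)" "c x \<in> U"
  shows "((\<lambda>t. g (c t)) has_vector_derivative g' (c x) c') (at x within S)"
proof -
  interpret bounded_linear "g' (c x)" using C1_on_linear_deriv[OF assms(1,3)] .
  show ?thesis
    using diff_chain_within[OF assms(2)[unfolded has_vector_derivative_def]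
        has_derivative_at_withinI[OF C1_on_deriv[OF assms(1,3)]]]
    by (simp add: has_vector_derivative_def o_def scaleR)
qed

lemma C1_on_pdir:
  fixes g :: "'a::real_normed_vector \<Rightarrow> real"
  assumes "C1_on U g g'" "z \<in> U"
  shows "((\<lambda>t. g (z + t *\<^sub>R e)) has_real_derivative g' z e) (at 0)" "pdir g e z = g' z e"
proof -
  have "((\<lambda>t. z + t *\<^sub>R e) has_vector_derivative e) (at 0)"
    by (auto intro!: derivative_eq_intros)
  from C1_on_curve[OF assms(1) this] assms(2)
  show "((\<lambda>t. g (z + t *\<^sub>R e)) has_real_derivative g' z e) (at 0)"
    by (simp add: has_real_derivative_iff_has_vector_derivative)
  then show "pdir g e z = g' z e" unfolding pdir_def by (rule DERIV_imp_deriv)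
qed

section \<open>Partial derivatives and total derivatives\<close>

text \<open>Leads back to the notion of smoothness in which fields are defined; it certifies the
  field constructed from the flow.\<close>

lemma Ck_open_1_of_C1_on:
  assumes C: "C1_on U g g'" shows "Ck_open 1 U g"
proof -
  have "continuous_on U (pdir g e)" for e
  proof -
    have "continuous_on U (\<lambda>z. g' z e)"
      by (rule C1_on_continuous_deriv_compose[OF C]) (auto intro!: continuous_intros)
    then show ?thesis by (rule continuous_on_eq) (simp add: C1_on_pdir(2)[OF C])
  qed
  moreover have "es = [] \<or> (\<exists>e. es = [e])" if "length es \<le> 1" for es :: "'a list"
    using that by (cases es) auto
  ultimately have "continuous_on U (iter_pd es g)" if "length es \<le> 1" for es
    using C1_on_continuous[OF C] that by fastforce
  moreover have "(\<lambda>t. g (z + t *\<^sub>R e)) differentiable (at 0)" if "z \<in> U" for z e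
    using C1_on_pdir(1)[OF C that] real_differentiable_def by blast
  ultimately show ?thesis unfolding Ck_open_def using C1_on_open[OF C] by auto
qed

text \<open>The increment is telescoped along the coordinate directions; the claim is uniform in
  the base point so that it can be reapplied after each coordinate step.\<close>
lemma partials_imp_has_derivative:
  fixes g :: "'a::euclidean_space \<Rightarrow> real"
  assumes U: "open U" and z: "z \<in> U"
    and pd: "\<And>w e. w \<in> U \<Longrightarrow> e \<in> Basis \<Longrightarrow> ((\<lambda>t. g (w + t *\<^sub>R e)) has_real_derivative g' e w) (at 0)"
    and cont: "\<And>e. e \<in> Basis \<Longrightarrow> continuous_on U (g' e)"
  shows "(g has_derivative (\<lambda>h. \<Sum>e\<in>Basis. (h \<bullet> e) * g' e z)) (at z)"
proof -
  have tele: "\<exists>d>0. \<forall>w c. dist w z < d \<and> (\<forall>e\<in>B. \<bar>c e\<bar> < d) \<longrightarrow>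
      \<bar>g (w + (\<Sum>e\<in>B. c e *\<^sub>R e)) - g w - (\<Sum>e\<in>B. c e * g' e z)\<bar> \<le> \<epsilon> * (\<Sum>e\<in>B. \<bar>c e\<bar>)"
    if "finite B" "B \<subseteq> Basis" "\<epsilon> > 0" for B and \<epsilon> :: real
    using that
  proof (induction B)
    case empty
    then show ?case by (auto intro!: exI[of _ 1])
  next
    case (insert e B)
    obtain d1 where d1: "d1 > 0"
      and d1': "\<And>w c. dist w z < d1 \<Longrightarrow> (\<forall>e\<in>B. \<bar>c e\<bar> < d1) \<Longrightarrow>
      \<bar>g (w + (\<Sum>e\<in>B. c e *\<^sub>R e)) - g w - (\<Sum>e\<in>B. c e * g' e z)\<bar> \<le> \<epsilon> * (\<Sum>e\<in>B. \<bar>c e\<bar>)"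
      using insert by auto
    have e: "e \<in> Basis" using insert by auto
    obtain r where r: "r > 0" "ball z r \<subseteq> U" using U z openE by blast
    have "continuous (at z) (g' e)" using cont[OF e] U z by (simp add: continuous_on_eq_continuous_at)
    then obtain s where s: "s > 0" "\<And>w. dist w z < s \<Longrightarrow> \<bar>g' e w - g' e z\<bar> < \<epsilon>"
      unfolding continuous_at_eps_delta using \<open>\<epsilon> > 0\<close> by (metis dist_norm real_norm_def)
    define q where "q = min r s"
    \<comment> \<open>A base point within \<open>d\<close> of \<open>z\<close>, moved by
      \<open>card B\<close> steps and one further step, each shorter than \<open>d\<close>, stays
      within \<open>(card B + 2) * d \<le> q\<close> of \<open>z\<close>.\<close>
    define d where "d = min d1 (q / (real (card B) + 2))"
    have q: "q > 0" using r s by (simp add: q_def)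
    have "d \<le> q / (real (card B) + 2)" by (simp add: d_def)
    then have d: "d > 0" "d \<le> d1" "d * (real (card B) + 2) \<le> q"
      using d1 q by (simp_all add: pos_le_divide_eq) (simp_all add: d_def)
    have step: "\<bar>g (w + (\<Sum>e\<in>insert e B. c e *\<^sub>R e)) - g w - (\<Sum>e\<in>insert e B. c e * g' e z)\<bar>
        \<le> \<epsilon> * (\<Sum>e\<in>insert e B. \<bar>c e\<bar>)"
      if w: "dist w z < d" and c: "\<forall>e\<in>insert e B. \<bar>c e\<bar> < d" for w c
    proof -
      define w1 where "w1 = w + (\<Sum>e\<in>B. c e *\<^sub>R e)"
      have "norm (\<Sum>e\<in>B. c e *\<^sub>R e) \<le> (\<Sum>e\<in>B. d)"
        using c insert.prems by (intro sum_norm_le) (auto simp: subset_iff)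
      then have nw1: "dist w1 z < d + real (card B) * d"
        using w norm_triangle_ineq[of "w - z" "\<Sum>e\<in>B. c e *\<^sub>R e"] unfolding w1_def dist_norm
        by (simp add: algebra_simps)
      have near: "dist (w1 + t *\<^sub>R e) z < q" if "\<bar>t\<bar> < d" for t
      proof -
        have "norm (t *\<^sub>R e) < d" using that e by simp
        then have "dist (w1 + t *\<^sub>R e) z < d + real (card B) * d + d"
          using nw1 norm_triangle_ineq[of "w1 - z" "t *\<^sub>R e"] unfolding dist_norm by (simp add: algebra_simps)
        then show ?thesis using d(3) by (simp add: algebra_simps)
      qed
      have der: "((\<lambda>t. g (w1 + t *\<^sub>R e) - t * g' e z) has_derivative (\<lambda>h. h * (g' e (w1 + t *\<^sub>R e) - g' e z))) (at t within ball 0 d)"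
        if t: "t \<in> ball 0 d" for t
      proof -
        have "w1 + t *\<^sub>R e \<in> U" using near[of t] t r by (auto simp: q_def dist_commute)
        from pd[OF this e] have "((\<lambda>s. g (w1 + s *\<^sub>R e)) has_real_derivative g' e (w1 + t *\<^sub>R e)) (at t)"
          using DERIV_shift[of "\<lambda>s. g (w1 + s *\<^sub>R e)" "g' e (w1 + t *\<^sub>R e)" 0 t]
          by (simp add: add_ac scaleR_add_left)
        then have "((\<lambda>t. g (w1 + t *\<^sub>R e) - t * g' e z) has_real_derivative (g' e (w1 + t *\<^sub>R e) - g' e z)) (at t)"
          by (auto intro!: derivative_eq_intros)
        moreover have "(\<lambda>h. h * (g' e (w1 + t *\<^sub>R e) - g' e z)) = (*) (g' e (w1 + t *\<^sub>R e) - g' e z)"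
          by (auto simp: mult.commute)
        ultimately show ?thesis
          by (simp only: has_field_derivative_def has_derivative_at_withinI)
      qed
      have "norm ((g (w1 + c e *\<^sub>R e) - c e * g' e z) - (g (w1 + 0 *\<^sub>R e) - 0 * g' e z)) \<le> \<epsilon> * norm (c e - 0)"
      proof (rule differentiable_bound[OF _ der])
        show "onorm (\<lambda>h. h * (g' e (w1 + t *\<^sub>R e) - g' e z)) \<le> \<epsilon>" if "t \<in> ball 0 d" for t
        proof -
          have "\<bar>g' e (w1 + t *\<^sub>R e) - g' e z\<bar> < \<epsilon>" using near[of t] that s by (auto simp: q_def)
          then show ?thesis
            by (intro onorm_bound) (auto simp: abs_mult mult.commute[of \<epsilon>] intro!: mult_left_mono \<open>\<epsilon> > 0\<close>[THEN less_imp_le])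
        qed
      qed (use c d in auto)
      then have A: "\<bar>g (w1 + c e *\<^sub>R e) - g w1 - c e * g' e z\<bar> \<le> \<epsilon> * \<bar>c e\<bar>" by (simp add: algebra_simps)
      have B: "\<bar>g w1 - g w - (\<Sum>e\<in>B. c e * g' e z)\<bar> \<le> \<epsilon> * (\<Sum>e\<in>B. \<bar>c e\<bar>)"
        unfolding w1_def using w c d by (intro d1') auto
      have eqs: "w + (\<Sum>e\<in>insert e B. c e *\<^sub>R e) = w1 + c e *\<^sub>R e"
        "(\<Sum>e\<in>insert e B. c e * g' e z) = c e * g' e z + (\<Sum>e\<in>B. c e * g' e z)"
        "(\<Sum>e\<in>insert e B. \<bar>c e\<bar>) = \<bar>c e\<bar> + (\<Sum>e\<in>B. \<bar>c e\<bar>)"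
        using insert.hyps by (simp_all add: w1_def)
      show ?thesis unfolding eqs distrib_left using A B by linarith
    qed
    show ?case using d(1) step by blast
  qed
  show ?thesis
    unfolding has_derivative_at_alt
  proof (intro conjI allI impI)
    show "bounded_linear (\<lambda>h. \<Sum>e\<in>Basis. (h \<bullet> e) * g' e z)"
      by (intro bounded_linear_sum bounded_linear_intros)
    fix \<epsilon> :: real assume e: "\<epsilon> > 0"
    define n where "n = real DIM('a)"
    have n: "n > 0" by (simp add: n_def)
    \<comment> \<open>The error is measured by the sum of the absolute coordinates, which is at most
      \<open>n\<close> times the norm; hence \<open>\<epsilon> / n\<close>.\<close>
    obtain d where d: "d > 0" and d': "\<And>w c. dist w z < d \<Longrightarrow> (\<forall>e\<in>Basis. \<bar>c e\<bar> < d) \<Longrightarrow>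
      \<bar>g (w + (\<Sum>e\<in>Basis. c e *\<^sub>R e)) - g w - (\<Sum>e\<in>Basis. c e * g' e z)\<bar> \<le> \<epsilon> / n * (\<Sum>e\<in>Basis. \<bar>c e\<bar>)"
      using tele[of Basis "\<epsilon> / n"] e n by auto
    show "\<exists>d>0. \<forall>y. norm (y - z) < d \<longrightarrow>
        norm (g y - g z - (\<Sum>e\<in>Basis. ((y - z) \<bullet> e) * g' e z)) \<le> \<epsilon> * norm (y - z)"
    proof (intro exI[of _ d] conjI allI impI d)
      fix y assume y: "norm (y - z) < d"
      have "\<bar>(y - z) \<bullet> e\<bar> \<le> norm (y - z)" if "e \<in> Basis" for e using Basis_le_norm[OF that] .
      then have 1: "\<forall>e\<in>Basis. \<bar>(y - z) \<bullet> e\<bar> < d" and 2: "(\<Sum>e\<in>Basis. \<bar>(y - z) \<bullet> e\<bar>) \<le> n * norm (y - z)"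
        using y sum_bounded_above[of Basis "\<lambda>e. \<bar>(y - z) \<bullet> e\<bar>" "norm (y - z)"] by (force simp: n_def)+
      have "\<epsilon> / n * (\<Sum>e\<in>Basis. \<bar>(y - z) \<bullet> e\<bar>) \<le> \<epsilon> * norm (y - z)"
        using mult_left_mono[OF 2, of "\<epsilon> / n"] e n by (simp add: field_simps)
      then show "norm (g y - g z - (\<Sum>e\<in>Basis. ((y - z) \<bullet> e) * g' e z)) \<le> \<epsilon> * norm (y - z)"
        using d'[of z "\<lambda>e. (y - z) \<bullet> e"] d 1 unfolding euclidean_representation by simp
    qed
  qed
qed

lemma C1_on_of_Ck_open:
  assumes "Ck_open k U g" "k \<ge> 1"
  shows "C1_on U g (\<lambda>z h. \<Sum>e\<in>Basis. (h \<bullet> e) * pdir g e z)"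
proof -
  have U: "open U" using assms by (simp add: Ck_open_def)
  have d: "((\<lambda>t. g (w + t *\<^sub>R e)) has_real_derivative pdir g e w) (at 0)" if "w \<in> U" "e \<in> Basis" for w e
  proof -
    have "(\<lambda>t. iter_pd [] g (w + t *\<^sub>R e)) differentiable (at 0)"
      using assms that unfolding Ck_open_def by (metis One_nat_def Suc_le_lessD empty_set empty_subsetI list.size(3))
    then show ?thesis unfolding pdir_def
      using DERIV_deriv_iff_real_differentiable by fastforce
  qed
  have c: "continuous_on U (pdir g e)" if "e \<in> Basis" for e
  proof -
    have "set [e] \<subseteq> Basis \<and> length [e] \<le> k" using assms that by simp
    then have "continuous_on U (iter_pd [e] g)" using assms(1) unfolding Ck_open_def by blast
    then show ?thesis by simp
  qed
  show ?thesis
  proof (rule C1_onI[OF U])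
    show "(g has_derivative (\<lambda>h. \<Sum>e\<in>Basis. (h \<bullet> e) * pdir g e z)) (at z)" if "z \<in> U" for z
      by (rule partials_imp_has_derivative[OF U that d c])
    show "continuous_on (U \<times> UNIV) (\<lambda>(z, h). \<Sum>e\<in>Basis. (h \<bullet> e) * pdir g e z)"
      unfolding case_prod_unfold
      by (intro continuous_intros continuous_on_compose2[OF c]) auto
  qed
qed

lemma Ck_open_pdir:
  assumes "Ck_open 2 U g" "e \<in> Basis" shows "Ck_open 1 U (pdir g e)"
proof -
  have it: "iter_pd es (pdir g e) = iter_pd (es @ [e]) g" for es by (induction es) auto
  have "set (es @ [e]) \<subseteq> Basis" if "set es \<subseteq> Basis" for es using that assms by auto
  moreover have "length (es @ [e]) \<le> 2" if "length es \<le> 1" for es using that by simp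
  moreover have "length (es @ [e]) < 2" if "length es < 1" for es using that by simp
  ultimately show ?thesis using assms(1) unfolding Ck_open_def it by meson
qed

section \<open>Interchange of derivatives up to the end points of an interval\<close>

text \<open>Differentiability of \<open>gt\<close> in \<open>x\<close> is a conclusion here:
  \<open>g x t - g a t\<close> is the integral of \<open>gx\<close>, differentiation under the
  integral at \<open>t = 0\<close> gives \<open>gt x - gt a\<close> as the integral of
  \<open>gxt\<close>, and the fundamental theorem finishes. In \<open>x\<close> the derivatives are
  one-sided at the ends. This yields Schwarz's theorem and later the equations for variations of
  extremals.\<close>

lemma mixed_partial:
  fixes g :: "real \<Rightarrow> real \<Rightarrow> 'b::banach"
  assumes x: "x \<in> {a..b}" and \<tau>: "\<tau> > 0"
    and gx: "\<And>x t. x \<in> {a..b} \<Longrightarrow> \<bar>t\<bar> < \<tau> \<Longrightarrow> ((\<lambda>x. g x t) has_vector_derivative gx x t) (at x within {a..b})"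
    and gxt: "\<And>x t. x \<in> {a..b} \<Longrightarrow> \<bar>t\<bar> < \<tau> \<Longrightarrow> ((\<lambda>t. gx x t) has_vector_derivative gxt x t) (at t)"
    and cont: "continuous_on ({a..b} \<times> {-\<tau><..<\<tau>}) (\<lambda>(x, t). gxt x t)"
    and gt: "\<And>x. x \<in> {a..b} \<Longrightarrow> ((\<lambda>t. g x t) has_vector_derivative gt x) (at 0)"
  shows "(gt has_vector_derivative gxt x 0) (at x within {a..b})"
proof -
  have ftc: "((\<lambda>s. gx s t) has_integral (g y t - g a t)) {a..y}" if "y \<in> {a..b}" "\<bar>t\<bar> < \<tau>" for y t
    using that by (intro fundamental_theorem_of_calculus has_vector_derivative_within_subset[OF gx]) auto
  have rep: "gt y = gt a + integral {a..y} (\<lambda>s. gxt s 0)" if y: "y \<in> {a..b}" for y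
  proof -
    have "((\<lambda>t. integral (cbox a y) (\<lambda>s. gx s t)) has_vector_derivative integral (cbox a y) (\<lambda>s. gxt s 0))
        (at 0 within {-\<tau><..<\<tau>})"
    proof (rule leibniz_rule_vector_derivative)
      show "((\<lambda>t. gx s t) has_vector_derivative gxt s t) (at t within {-\<tau><..<\<tau>})"
        if "t \<in> {-\<tau><..<\<tau>}" "s \<in> cbox a y" for t s
        using that y by (auto intro!: has_vector_derivative_at_within[OF gxt])
      show "(\<lambda>s. gx s t) integrable_on cbox a y" if "t \<in> {-\<tau><..<\<tau>}" for t
        using has_integral_integrable[OF ftc[OF y, of t]] that by (auto simp: abs_less_iff)
      have "continuous_on ({-\<tau><..<\<tau>} \<times> cbox a y) (\<lambda>t. (\<lambda>(x, t). gxt x t) (snd t, fst t))"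
        by (rule continuous_on_compose2[OF cont]) (use y in \<open>auto intro!: continuous_intros\<close>)
      then show "continuous_on ({-\<tau><..<\<tau>} \<times> cbox a y) (\<lambda>(t, s). gxt s t)"
        by (simp add: case_prod_unfold)
    qed (use \<tau> in auto)
    then have "((\<lambda>t. g y t - g a t) has_vector_derivative integral (cbox a y) (\<lambda>s. gxt s 0)) (at 0 within {-\<tau><..<\<tau>})"
    proof (rule has_vector_derivative_transform[rotated 2])
      show "g y t - g a t = integral (cbox a y) (\<lambda>s. gx s t)" if "t \<in> {-\<tau><..<\<tau>}" for t
        using ftc[OF y, THEN integral_unique] that by (auto simp: abs_less_iff)
    qed (use \<tau> in auto)
    then have "((\<lambda>t. g y t - g a t) has_vector_derivative integral (cbox a y) (\<lambda>s. gxt s 0)) (at 0)"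
      using \<tau> by (subst (asm) has_vector_derivative_within_open) auto
    moreover have "((\<lambda>t. g y t - g a t) has_vector_derivative gt y - gt a) (at 0)"
      using y by (intro has_vector_derivative_diff gt) auto
    ultimately have "gt y - gt a = integral (cbox a y) (\<lambda>s. gxt s 0)"
      by (meson vector_derivative_unique_at)
    then show ?thesis by (simp add: algebra_simps)
  qed
  have "continuous_on {a..b} (\<lambda>s. (\<lambda>(x, t). gxt x t) (s, 0))"
    by (rule continuous_on_compose2[OF cont]) (use \<tau> in \<open>auto intro!: continuous_intros\<close>)
  then have "((\<lambda>y. integral {a..y} (\<lambda>s. gxt s 0)) has_vector_derivative gxt x 0) (at x within {a..b})"
    using x by (intro integral_has_vector_derivative) auto
  then have "((\<lambda>y. gt a + integral {a..y} (\<lambda>s. gxt s 0)) has_vector_derivative gxt x 0) (at x within {a..b})"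
    by (auto intro!: derivative_eq_intros)
  then show ?thesis
    by (rule has_vector_derivative_transform[of x _ gt, OF x rep, rotated])
qed

text \<open>Schwarz's theorem: \<open>mixed_partial\<close> is applied to
  \<open>g (z + x *\<^sub>R e + t *\<^sub>R e')\<close> on an interval with \<open>x = 0\<close> in
  its interior, where the derivative within the interval is the two-sided one.\<close>

lemma pdir_commute:
  fixes g :: "'a::euclidean_space \<Rightarrow> real"
  assumes g: "Ck_open 2 U g" and z: "z \<in> U" and e: "e \<in> Basis" "e' \<in> Basis"
  shows "pdir (pdir g e) e' z = pdir (pdir g e') e z"
proof -
  have U: "open U" using g by (simp add: Ck_open_def)
  then obtain r where r: "r > 0" "ball z r \<subseteq> U" using z openE by blast
  define d where "d = r / 2"
  have d: "d > 0" using r by (simp add: d_def)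
  have in_U: "z + x *\<^sub>R e + t *\<^sub>R e' \<in> U" if "\<bar>x\<bar> < d" "\<bar>t\<bar> < d" for x t
  proof -
    have "norm (x *\<^sub>R e + t *\<^sub>R e') < r"
      using that e norm_triangle_ineq[of "x *\<^sub>R e" "t *\<^sub>R e'"] by (simp add: d_def)
    then show ?thesis using r(2) by (auto simp: subset_iff dist_norm algebra_simps norm_minus_commute)
  qed
  define b where "b = d / 2"
  have b: "b > 0" "b < d" using d by (auto simp: b_def)
  note C = C1_on_of_Ck_open[OF g, simplified]
  note Ce = C1_on_of_Ck_open[OF Ck_open_pdir[OF g e(1)], simplified]
  have "((\<lambda>x. pdir g e' (z + x *\<^sub>R e)) has_vector_derivative pdir (pdir g e) e' (z + 0 *\<^sub>R e + 0 *\<^sub>R e')) (at 0 within {-b..b})"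
  proof (rule mixed_partial[where \<tau> = d and g = "\<lambda>x t. g (z + x *\<^sub>R e + t *\<^sub>R e')"
        and gx = "\<lambda>x t. pdir g e (z + x *\<^sub>R e + t *\<^sub>R e')" and gxt = "\<lambda>x t. pdir (pdir g e) e' (z + x *\<^sub>R e + t *\<^sub>R e')"])
    fix x t assume xt: "x \<in> {-b..b}" "\<bar>t\<bar> < d"
    have w: "z + x *\<^sub>R e + t *\<^sub>R e' \<in> U" using xt b by (intro in_U) auto
    have 1: "((\<lambda>x. z + x *\<^sub>R e + t *\<^sub>R e') has_vector_derivative e) (at x within {-b..b})"
      and 2: "((\<lambda>t. z + x *\<^sub>R e + t *\<^sub>R e') has_vector_derivative e') (at t)"
      by (auto intro!: derivative_eq_intros)
    show "((\<lambda>x. g (z + x *\<^sub>R e + t *\<^sub>R e')) has_vector_derivative pdir g e (z + x *\<^sub>R e + t *\<^sub>R e')) (at x within {-b..b})"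
      using C1_on_curve[OF C 1 w] C1_on_pdir(2)[OF C w, of e] by simp
    show "((\<lambda>t. pdir g e (z + x *\<^sub>R e + t *\<^sub>R e')) has_vector_derivative pdir (pdir g e) e' (z + x *\<^sub>R e + t *\<^sub>R e')) (at t)"
      using C1_on_curve[OF Ce 2 w] C1_on_pdir(2)[OF Ce w, of e'] by simp
  next
    have "set [e', e] \<subseteq> Basis \<and> length [e', e] \<le> 2" using e by simp
    then have "continuous_on U (iter_pd [e', e] g)" using g unfolding Ck_open_def by blast
    then have c: "continuous_on U (pdir (pdir g e) e')" by simp
    show "continuous_on ({- b..b} \<times> {- d<..<d}) (\<lambda>(x, t). pdir (pdir g e) e' (z + x *\<^sub>R e + t *\<^sub>R e'))"
      unfolding case_prod_unfold
      by (rule continuous_on_compose2[OF c]) (use in_U b in \<open>auto intro!: continuous_intros\<close>)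
  next
    fix x assume "x \<in> {-b..b}"
    then have w: "z + x *\<^sub>R e \<in> U" using in_U[of x 0] b d by auto
    show "((\<lambda>t. g (z + x *\<^sub>R e + t *\<^sub>R e')) has_vector_derivative pdir g e' (z + x *\<^sub>R e)) (at 0)"
      using C1_on_pdir[OF C w, of e'] by (simp add: has_real_derivative_iff_has_vector_derivative)
  qed (use b d in auto)
  then have "((\<lambda>x. pdir g e' (z + x *\<^sub>R e)) has_real_derivative pdir (pdir g e) e' z) (at 0)"
    using b by (simp add: at_within_Icc_at has_real_derivative_iff_has_vector_derivative)
  then show ?thesis unfolding pdir_def[of "pdir g e'"] by (simp add: DERIV_imp_deriv)
qed

text \<open>The Hessian as a form: \<open>h\<close> is the direction frozen in the first derivative,
  \<open>k\<close> the direction of the second differentiation. Symmetry is Schwarz's theorem,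
  expanded in coordinates.\<close>

lemma Ck_open_2_second_derivative:
  fixes g :: "'a::euclidean_space \<Rightarrow> real"
  assumes g: "Ck_open 2 U g"
  obtains Dg D2g where "C1_on U g Dg" "\<And>h. C1_on U (\<lambda>z. Dg z h) (\<lambda>z. D2g z h)"
    "\<And>z h k. z \<in> U \<Longrightarrow> D2g z h k = D2g z k h"
proof
  define Dg where "Dg = (\<lambda>z h. \<Sum>e\<in>Basis. (h \<bullet> e) * pdir g e z)"
  define D2g where "D2g = (\<lambda>z h k. \<Sum>e\<in>Basis. (h \<bullet> e) * (\<Sum>e'\<in>Basis. (k \<bullet> e') * pdir (pdir g e) e' z))"
  show "C1_on U g Dg" using C1_on_of_Ck_open[OF g] by (simp add: Dg_def)
  have U: "open U" using g by (simp add: Ck_open_def)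
  show "C1_on U (\<lambda>z. Dg z h) (\<lambda>z. D2g z h)" for h
  proof -
    have "C1_on U (\<lambda>z. \<Sum>e\<in>B. (h \<bullet> e) * pdir g e z)
        (\<lambda>z k. \<Sum>e\<in>B. (h \<bullet> e) * (\<Sum>e'\<in>Basis. (k \<bullet> e') * pdir (pdir g e) e' z))"
      if "finite B" "B \<subseteq> Basis" for B
      using that
    proof (induction B)
      case empty show ?case using C1_on_const[OF U, of "0::real"] by simp
    next
      case (insert e B)
      have "C1_on U (\<lambda>z. (h \<bullet> e) * pdir g e z) (\<lambda>z k. (h \<bullet> e) * (\<Sum>e'\<in>Basis. (k \<bullet> e') * pdir (pdir g e) e' z))"
        using C1_on_compose[OF C1_on_of_Ck_open[OF Ck_open_pdir[OF g]] C1_on_bounded_linear[OF bounded_linear_mult_right open_UNIV]]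
          insert by simp
      from C1_on_add[OF this insert.IH] insert show ?case by simp
    qed
    then show ?thesis by (simp add: Dg_def D2g_def)
  qed
  show "D2g z h k = D2g z k h" if "z \<in> U" for z h k
  proof -
    have "D2g z h k = (\<Sum>e\<in>Basis. \<Sum>e'\<in>Basis. (h \<bullet> e) * (k \<bullet> e') * pdir (pdir g e) e' z)"
      by (simp add: D2g_def sum_distrib_left mult.assoc)
    also have "\<dots> = (\<Sum>e\<in>Basis. \<Sum>e'\<in>Basis. (h \<bullet> e) * (k \<bullet> e') * pdir (pdir g e') e z)"
      by (intro sum.cong refl) (simp add: pdir_commute[OF g that])
    also have "\<dots> = (\<Sum>e'\<in>Basis. \<Sum>e\<in>Basis. (h \<bullet> e) * (k \<bullet> e') * pdir (pdir g e') e z)"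
      by (rule sum.swap)
    also have "\<dots> = D2g z k h"
      by (simp add: D2g_def sum_distrib_left mult_ac)
    finally show ?thesis .
  qed
qed

text \<open>Every component comes with its own open set and extension; the index type is finite, so
  the intersection of these sets is still open.\<close>

lemma Ck_vec_1_C1_on:
  fixes g :: "'a::euclidean_space \<Rightarrow> real^'n"
  assumes "Ck_vec k S g" "k \<ge> 1"
  obtains U h h' where "S \<subseteq> U" "C1_on U h h'" "\<And>z. z \<in> S \<Longrightarrow> h z = g z"
proof -
  have "\<forall>i. \<exists>U h. S \<subseteq> U \<and> Ck_open k U h \<and> (\<forall>z\<in>S. h z = g z $ i)"
    using assms by (simp add: Ck_vec_def Ck_on_def)
  then obtain U h where Uh: "\<And>i. S \<subseteq> U i" "\<And>i. Ck_open k (U i) (h i)" "\<And>i z. z \<in> S \<Longrightarrow> h i z = g z $ i"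
    by metis
  define V where "V = (\<Inter>i. U i)"
  have V: "open V" unfolding V_def using Uh(2) by (auto intro!: open_INT simp: Ck_open_def)
  have C: "C1_on V (\<lambda>z. (\<chi> i. h i z)) (\<lambda>z k. \<chi> i. \<Sum>e\<in>Basis. (k \<bullet> e) * pdir (h i) e z)"
  proof (rule C1_on_vec[OF V])
    fix i
    have "V \<subseteq> U i" by (auto simp: V_def)
    from C1_on_subset[OF C1_on_of_Ck_open[OF Uh(2) assms(2)] V this]
    show "C1_on V (\<lambda>z. (\<chi> i. h i z) $ i) (\<lambda>z k. (\<chi> i. \<Sum>e\<in>Basis. (k \<bullet> e) * pdir (h i) e z) $ i)" by simp
  qed
  have "S \<subseteq> V" using Uh by (auto simp: V_def)
  from that[OF this C] show thesis using Uh(3) by (auto simp: vec_eq_iff)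
qed

lemma Ck_vec_1I:
  fixes g :: "'a::euclidean_space \<Rightarrow> real^'n"
  assumes "S \<subseteq> U" "C1_on U h h'" "\<And>z. z \<in> S \<Longrightarrow> h z = g z"
  shows "Ck_vec 1 S g"
  unfolding Ck_vec_def Ck_on_def
  using assms(1,3) Ck_open_1_of_C1_on[OF C1_on_nth[OF assms(2)]] by (metis (no_types, lifting))

section \<open>Ordinary differential equations\<close>

text \<open>\<open>g'\<close> is uniformly continuous on the compact product of \<open>T\<close>
  with the unit sphere; homogeneity in \<open>h\<close> extends the estimate from unit vectors to
  all \<open>h\<close>.\<close>

lemma C1_on_uniform_deriv:
  fixes g :: "'a::euclidean_space \<Rightarrow> 'b::real_normed_vector"
  assumes g: "C1_on U g g'" and T: "compact T" "T \<subseteq> U" and e: "\<epsilon> > 0"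
  obtains \<delta> where "\<delta> > 0" "\<And>z w h. z \<in> T \<Longrightarrow> w \<in> T \<Longrightarrow> dist z w < \<delta> \<Longrightarrow> norm (g' z h - g' w h) \<le> \<epsilon> * norm h"
proof -
  have cp: "compact (T \<times> sphere (0::'a) 1)" using T by (intro compact_Times) auto
  have ct: "continuous_on (T \<times> sphere 0 1) (\<lambda>(z, h). g' z h)"
    using C1_on_continuous_deriv[OF g] by (rule continuous_on_subset) (use T in auto)
  from compact_uniformly_continuous[OF ct cp, unfolded uniformly_continuous_on_def] e
  obtain \<delta> where d: "\<delta> > 0" "\<And>s t. s \<in> T \<times> sphere 0 1 \<Longrightarrow> t \<in> T \<times> sphere 0 1 \<Longrightarrow> dist t s < \<delta> \<Longrightarrow>
     dist ((\<lambda>(z, h). g' z h) t) ((\<lambda>(z, h). g' z h) s) < \<epsilon>" by metis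
  have "norm (g' z h - g' w h) \<le> \<epsilon> * norm h" if zw: "z \<in> T" "w \<in> T" "dist z w < \<delta>" for z w h
  proof (cases "h = 0")
    case True
    have "g' z 0 = 0" "g' w 0 = 0"
      using C1_on_linear_deriv[OF g] zw T by (auto simp: linear_simps)
    then show ?thesis using True by simp
  next
    case False
    define u where "u = h /\<^sub>R norm h"
    have u: "u \<in> sphere 0 1" "h = norm h *\<^sub>R u" using False by (auto simp: u_def)
    have "dist (z, u) (w, u) < \<delta>" using zw by (simp add: dist_Pair_Pair)
    from d(2)[OF _ _ this] u zw have "norm (g' z u - g' w u) < \<epsilon>" by (auto simp: dist_norm)
    moreover have "g' z h = norm h *\<^sub>R g' z u" "g' w h = norm h *\<^sub>R g' w u"
      using C1_on_linear_deriv[OF g] zw T u(2) by (metis linear_simps(5) subsetD)+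
    ultimately show ?thesis
      using False by (simp add: scaleR_diff_right[symmetric] mult.commute)
  qed
  then show thesis using that d(1) by blast
qed

lemma C1_on_bounded_deriv:
  fixes g :: "'a::euclidean_space \<Rightarrow> 'b::real_normed_vector"
  assumes g: "C1_on U g g'" and T: "compact T" "T \<subseteq> U"
  obtains L where "L > 0" "\<And>z h. z \<in> T \<Longrightarrow> norm (g' z h) \<le> L * norm h"
proof -
  have cp: "compact (T \<times> sphere (0::'a) 1)" using T by (intro compact_Times) auto
  have ct: "continuous_on (T \<times> sphere 0 1) (\<lambda>(z, h). g' z h)"
    using C1_on_continuous_deriv[OF g] by (rule continuous_on_subset) (use T in auto)
  from compact_imp_bounded[OF compact_continuous_image[OF ct cp]]
  obtain L where L: "L > 0" "\<And>t. t \<in> T \<times> sphere 0 1 \<Longrightarrow> norm ((\<lambda>(z, h). g' z h) t) \<le> L"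
    unfolding bounded_pos by auto
  have "norm (g' z h) \<le> L * norm h" if z: "z \<in> T" for z h
  proof (cases "h = 0")
    case True
    have "g' z 0 = 0" using C1_on_linear_deriv[OF g] z T by (auto simp: linear_simps)
    then show ?thesis using True by simp
  next
    case False
    define u where "u = h /\<^sub>R norm h"
    have u: "u \<in> sphere 0 1" "h = norm h *\<^sub>R u" using False by (auto simp: u_def)
    have "norm (g' z u) \<le> L" using L(2)[of "(z, u)"] u z by auto
    moreover have "g' z h = norm h *\<^sub>R g' z u"
      using C1_on_linear_deriv[OF g] z T u(2) by (metis linear_simps(5) subsetD)
    ultimately show ?thesis using False by (simp add: mult.commute)
  qed
  then show thesis using that L(1) by blast
qed

section \<open>Gronwall's inequality and solutions on the whole interval\<close>

text \<open>The constant in Gronwall's inequality: the exponential stems from the differential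
  inequality for the squared norm, \<open>1 + (b - a)\<close> absorbs the accumulated inhomogeneity,
  and the root returns to the norm.\<close>

definition growth :: "real \<Rightarrow> real \<Rightarrow> real \<Rightarrow> real" where
  "growth a b L = sqrt (exp ((2 * L + 1) * (b - a)) * (1 + (b - a)))"

lemma growth_pos: "a \<le> b \<Longrightarrow> growth a b L > 0"
  by (simp add: growth_def)

text \<open>Gronwall's inequality, applied to the square of the norm because that is differentiable.\<close>
lemma norm_le_growth:
  fixes w :: "real \<Rightarrow> 'a::real_inner"
  assumes x: "x \<in> {a..b}" and L: "L \<ge> 0" and e: "\<epsilon> \<ge> 0"
    and d: "\<And>x. x \<in> {a..b} \<Longrightarrow> (w has_vector_derivative w' x) (at x within {a..b})"
    and bd: "\<And>x. x \<in> {a..b} \<Longrightarrow> norm (w' x) \<le> L * norm (w x) + \<epsilon>"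
  shows "norm (w x) \<le> growth a b L * (norm (w a) + \<epsilon>)"
proof -
  \<comment> \<open>\<open>2 * L\<close> bounds the homogeneous part of the derivative of
    \<open>w \<bullet> w\<close>; the extra 1 pays for \<open>2 * \<epsilon> * norm w \<le> (norm
    w)\<^sup>2 + \<epsilon>\<^sup>2\<close>. With this \<open>M\<close> the function
    \<open>q\<close> is nonincreasing.\<close>
  define M where "M = 2 * L + 1"
  define q where "q = (\<lambda>x. (w x \<bullet> w x) * exp (- M * (x - a)) - \<epsilon>\<^sup>2 * (x - a))"
  define q' where "q' = (\<lambda>x. (2 * (w x \<bullet> w' x) - M * (w x \<bullet> w x)) * exp (- M * (x - a)) - \<epsilon>\<^sup>2)"
  have dq: "(q has_real_derivative q' x) (at x within {a..b})" if "x \<in> {a..b}" for x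
  proof -
    have "((\<lambda>x. w x \<bullet> w x) has_real_derivative 2 * (w x \<bullet> w' x)) (at x within {a..b})"
      using has_derivative_inner[OF d[OF that, unfolded has_vector_derivative_def] d[OF that, unfolded has_vector_derivative_def]]
      unfolding has_field_derivative_def
      by (rule has_derivative_eq_rhs) (auto simp: inner_commute algebra_simps)
    then show ?thesis unfolding q_def q'_def
      by (auto intro!: derivative_eq_intros simp: algebra_simps)
  qed
  have q'0: "q' x \<le> 0" if "x \<in> {a..b}" for x
  proof -
    have "w x \<bullet> w' x \<le> norm (w x) * norm (w' x)" by (rule norm_cauchy_schwarz)
    also have "\<dots> \<le> norm (w x) * (L * norm (w x) + \<epsilon>)" by (intro mult_left_mono bd that) auto
    finally have "2 * (w x \<bullet> w' x) \<le> 2 * L * (norm (w x))\<^sup>2 + 2 * \<epsilon> * norm (w x)"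
      by (simp add: algebra_simps power2_eq_square)
    moreover have "2 * \<epsilon> * norm (w x) \<le> (norm (w x))\<^sup>2 + \<epsilon>\<^sup>2"
      using sum_squares_bound[of \<epsilon> "norm (w x)"] by simp
    ultimately have "2 * (w x \<bullet> w' x) - M * (w x \<bullet> w x) \<le> \<epsilon>\<^sup>2"
      by (simp add: M_def dot_square_norm algebra_simps)
    then have "(2 * (w x \<bullet> w' x) - M * (w x \<bullet> w x)) * exp (- M * (x - a)) \<le> \<epsilon>\<^sup>2 * exp (- M * (x - a))"
      by (intro mult_right_mono) auto
    also have "\<dots> \<le> \<epsilon>\<^sup>2 * 1"
    proof (intro mult_left_mono)
      have "0 \<le> M * (x - a)" using that L by (simp add: M_def)
      then show "exp (- M * (x - a)) \<le> 1" by simp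
    qed simp
    finally show ?thesis by (simp add: q'_def)
  qed
  have "q x \<le> q a"
  proof (rule DERIV_nonpos_imp_decreasing_open[of a x q])
    show "a \<le> x" using x by simp
    show "\<exists>y'. (q has_real_derivative y') (at y) \<and> y' \<le> 0" if "a < y" "y < x" for y
    proof -
      have "y \<in> {a..b}" "(at y within {a..b}) = at y" using that x by (auto intro!: at_within_Icc_at)
      then show ?thesis using dq[of y] q'0[of y] by auto
    qed
    have "continuous_on {a..b} q"
      by (rule DERIV_continuous_on) (use dq in auto)
    then show "continuous_on {a..x} q" by (rule continuous_on_subset) (use x in auto)
  qed
  then have "(norm (w x))\<^sup>2 * exp (- M * (x - a)) \<le> (norm (w a))\<^sup>2 + \<epsilon>\<^sup>2 * (x - a)"
    by (simp add: q_def dot_square_norm)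
  then have "(norm (w x))\<^sup>2 * exp (- M * (x - a)) * exp (M * (x - a)) \<le> ((norm (w a))\<^sup>2 + \<epsilon>\<^sup>2 * (x - a)) * exp (M * (x - a))"
    by (intro mult_right_mono) auto
  then have "(norm (w x))\<^sup>2 \<le> ((norm (w a))\<^sup>2 + \<epsilon>\<^sup>2 * (x - a)) * exp (M * (x - a))"
    by (simp add: mult.assoc mult_exp_exp)
  also have "\<dots> \<le> ((norm (w a) + \<epsilon>)\<^sup>2 * (1 + (b - a))) * exp (M * (b - a))"
  proof (intro mult_mono)
    have "\<epsilon>\<^sup>2 * (x - a) \<le> \<epsilon>\<^sup>2 * (b - a)" using x by (intro mult_left_mono) auto
    also have "\<dots> \<le> (norm (w a) + \<epsilon>)\<^sup>2 * (b - a)" using x e by (intro mult_right_mono power_mono) auto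
    finally have 1: "\<epsilon>\<^sup>2 * (x - a) \<le> (norm (w a) + \<epsilon>)\<^sup>2 * (b - a)" .
    have "(norm (w a))\<^sup>2 \<le> (norm (w a) + \<epsilon>)\<^sup>2" using e by (intro power_mono) auto
    with 1 show "(norm (w a))\<^sup>2 + \<epsilon>\<^sup>2 * (x - a) \<le> (norm (w a) + \<epsilon>)\<^sup>2 * (1 + (b - a))"
      by (simp add: algebra_simps)
    show "exp (M * (x - a)) \<le> exp (M * (b - a))" using x L by (auto simp: M_def)
  qed (use x in auto)
  also have "\<dots> = (growth a b L * (norm (w a) + \<epsilon>))\<^sup>2"
    using x by (simp add: growth_def M_def power_mult_distrib mult_ac)
  finally show ?thesis
    using x e growth_pos[of a b L] by (auto intro: power2_le_imp_le)
qed

lemma continuous_on_parametric_ode: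
  fixes F :: "real \<Rightarrow> 'a::real_normed_vector \<Rightarrow> 'b::real_normed_vector"
  assumes "continuous_on (S \<times> UNIV) (\<lambda>(x, y). F x y)" "continuous_on S v"
  shows "continuous_on S (\<lambda>s. F s (v s))"
proof -
  have "continuous_on S (\<lambda>s. (\<lambda>(x, y). F x y) (s, v s))"
    by (rule continuous_on_compose2[OF assms(1)]) (use assms(2) in \<open>auto intro!: continuous_intros\<close>)
  then show ?thesis by simp
qed

text \<open>The fixed point is taken for \<open>exp (- 2 * L * (x - a)) *\<^sub>R Y x\<close>: with this weight the
  Picard operator contracts by the factor \<open>1 / 2\<close> on the whole interval.\<close>
lemma picard_lindelof:
  fixes F :: "real \<Rightarrow> 'a::euclidean_space \<Rightarrow> 'a"
  assumes ab: "a \<le> b" and L: "L > 0"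
    and F: "continuous_on ({a..b} \<times> UNIV) (\<lambda>(x, y). F x y)"
    and lip: "\<And>x y z. x \<in> {a..b} \<Longrightarrow> norm (F x y - F x z) \<le> L * norm (y - z)"
  obtains Y where "Y a = \<eta>" "\<And>x. x \<in> {a..b} \<Longrightarrow> (Y has_vector_derivative F x (Y x)) (at x within {a..b})"
proof -
  define M where "M = 2 * L"
  have M: "M > 0" using L by (simp add: M_def)
  \<comment> \<open>The fixed point lives in the complete space of bounded continuous functions on
    the whole line; composition with the clamp \<open>c\<close> turns functions on {a..b} into
    elements of it.\<close>
  define c where "c = (\<lambda>x::real. max a (min b x))"
  have c: "c x \<in> {a..b}" for x using ab by (auto simp: c_def)
  have c_id: "c x = x" if "x \<in> {a..b}" for x using that by (auto simp: c_def)
  have cc: "continuous_on UNIV c" unfolding c_def by (intro continuous_intros)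
  define I where "I = (\<lambda>(V::real \<Rightarrow>\<^sub>C 'a) s. F s (exp (M * (s - a)) *\<^sub>R apply_bcontfun V s))"
  define R where "R = (\<lambda>V x. exp (- M * (x - a)) *\<^sub>R (\<eta> + integral {a..x} (I V)))"
  have I: "continuous_on {a..b} (I V)" for V
    unfolding I_def by (rule continuous_on_parametric_ode[OF F]) (auto intro!: continuous_intros)
  have int: "I V integrable_on {a..x}" if "x \<in> {a..b}" for V x
    using that by (intro integrable_continuous_real continuous_on_subset[OF I]) auto
  have R: "continuous_on {a..b} (R V)" for V
    unfolding R_def
    by (intro continuous_intros indefinite_integral_continuous_1 int) (use ab in auto)
  have bc: "(\<lambda>x. R V (c x)) \<in> bcontfun" for V
  proof -
    have "continuous_on UNIV (\<lambda>x. R V (c x))"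
      by (rule continuous_on_compose2[OF R cc]) (use c in auto)
    moreover have "bounded (range (\<lambda>x. R V (c x)))"
      by (rule bounded_subset[OF compact_imp_bounded[OF compact_continuous_image[OF R compact_Icc]]]) (use c in auto)
    ultimately show ?thesis by (simp add: bcontfun_def)
  qed
  define T where "T = (\<lambda>V. Bcontfun (\<lambda>x. R V (c x)))"
  have T: "apply_bcontfun (T V) x = R V (c x)" for V x
    using bc by (simp add: T_def Bcontfun_inverse)
  have "dist (T V) (T W) \<le> 1/2 * dist V W" for V W
  proof (rule dist_bound)
    fix x
    define y where "y = c x"
    have y: "y \<in> {a..b}" using c by (simp add: y_def)
    define D where "D = dist V W"
    have *: "((\<lambda>s. L * D * exp (M * (s - a))) has_integral (D / 2 * exp (M * (y - a)) - D / 2 * exp (M * (a - a)))) {a..y}"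
    proof (rule fundamental_theorem_of_calculus)
      show "((\<lambda>s. D / 2 * exp (M * (s - a))) has_vector_derivative L * D * exp (M * (s - a))) (at s within {a..y})" for s
        unfolding has_real_derivative_iff_has_vector_derivative[symmetric]
        by (auto intro!: derivative_eq_intros simp: M_def)
    qed (use y in auto)
    have "norm (integral {a..y} (\<lambda>s. I V s - I W s)) \<le> integral {a..y} (\<lambda>s. L * D * exp (M * (s - a)))"
    proof (rule integral_norm_bound_integral)
      show "(\<lambda>s. I V s - I W s) integrable_on {a..y}" using int[OF y] by (intro integrable_diff)
      show "(\<lambda>s. L * D * exp (M * (s - a))) integrable_on {a..y}" using * by (rule has_integral_integrable)
      fix s assume s: "s \<in> {a..y}"
      then have "norm (I V s - I W s) \<le> L * norm (exp (M * (s - a)) *\<^sub>R apply_bcontfun V s - exp (M * (s - a)) *\<^sub>R apply_bcontfun W s)"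
        unfolding I_def using y by (intro lip) auto
      also have "\<dots> = L * (exp (M * (s - a)) * dist (apply_bcontfun V s) (apply_bcontfun W s))"
        by (simp add: dist_norm scaleR_diff_right[symmetric])
      also have "\<dots> \<le> L * (exp (M * (s - a)) * D)"
        using L unfolding D_def by (intro mult_left_mono dist_bounded) auto
      finally show "norm (I V s - I W s) \<le> L * D * exp (M * (s - a))" by (simp add: mult_ac)
    qed
    also have "\<dots> = D / 2 * (exp (M * (y - a)) - 1)" using integral_unique[OF *] by (simp add: algebra_simps)
    finally have n: "norm (integral {a..y} (I V) - integral {a..y} (I W)) \<le> D / 2 * (exp (M * (y - a)) - 1)"
      using int[OF y] by (simp add: integral_diff)
    have "dist (R V y) (R W y) = exp (- M * (y - a)) * norm (integral {a..y} (I V) - integral {a..y} (I W))"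
      unfolding R_def dist_norm scaleR_diff_right[symmetric] by simp
    also have "\<dots> \<le> exp (- M * (y - a)) * (D / 2 * (exp (M * (y - a)) - 1))" by (intro mult_left_mono n) auto
    also have "\<dots> = D / 2 * (1 - exp (- M * (y - a)))" by (simp add: algebra_simps mult_exp_exp)
    also have "\<dots> \<le> D / 2 * 1" unfolding D_def by (intro mult_left_mono) auto
    finally show "dist (apply_bcontfun (T V) x) (apply_bcontfun (T W) x) \<le> 1/2 * dist V W"
      by (simp add: T y_def D_def)
  qed
  then obtain V where V: "T V = V"
    using banach_fix_type[of "1/2" T] by auto
  define Y where "Y = (\<lambda>x. \<eta> + integral {a..x} (I V))"
  have "apply_bcontfun V x = exp (- M * (x - a)) *\<^sub>R Y x" if "x \<in> {a..b}" for x
    using T[of V x] V c_id[OF that] by (simp add: R_def Y_def)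
  then have VY: "exp (M * (x - a)) *\<^sub>R apply_bcontfun V x = Y x" if "x \<in> {a..b}" for x
    using that by (simp add: exp_minus)
  have "(Y has_vector_derivative I V x) (at x within {a..b})" if "x \<in> {a..b}" for x
    using integral_has_vector_derivative[OF I that, of V] unfolding Y_def
    by (auto intro!: derivative_eq_intros)
  moreover have "I V x = F x (Y x)" if "x \<in> {a..b}" for x
    using VY[OF that] by (simp add: I_def)
  moreover have "Y a = \<eta>" by (simp add: Y_def)
  ultimately show thesis using that by metis
qed

lemma has_vector_derivative_imp_continuous_on:
  assumes "\<And>x. x \<in> S \<Longrightarrow> (f has_vector_derivative f' x) (at x within S)"
  shows "continuous_on S f"
  using assms has_vector_derivative_continuous unfolding continuous_on_eq_continuous_within by blast

lemma tube_in_open: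
  fixes y0 :: "real \<Rightarrow> 'e::euclidean_space"
  assumes \<Omega>: "open \<Omega>" and y0: "continuous_on {a..b} y0" and sub: "\<And>x. x \<in> {a..b} \<Longrightarrow> (x, y0 x) \<in> \<Omega>"
  obtains r where "r > 0" "\<And>x y. x \<in> {a..b} \<Longrightarrow> dist y (y0 x) \<le> r \<Longrightarrow> (x, y) \<in> \<Omega>"
proof -
  have "compact ((\<lambda>x. (x, y0 x)) ` {a..b})"
    by (intro compact_continuous_image continuous_intros y0) auto
  from compact_subset_open_imp_ball_epsilon_subset[OF this \<Omega>] sub
  obtain e where e: "e > 0" "(\<Union>z\<in>(\<lambda>x. (x, y0 x)) ` {a..b}. ball z e) \<subseteq> \<Omega>" by blast
  have "(x, y) \<in> \<Omega>" if "x \<in> {a..b}" "dist y (y0 x) \<le> e / 2" for x y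
  proof -
    have "(x, y) \<in> ball (x, y0 x) e" using that e(1) by (simp add: dist_Pair_Pair dist_commute)
    then show ?thesis using that e(2) by blast
  qed
  then show thesis using e(1) by (intro that[of "e/2"]) auto
qed

text \<open>Continuity in \<open>x\<close> for each fixed \<open>y\<close> suffices when continuity
  in \<open>y\<close> is uniform over \<open>x\<close>. For flows the uniform part is what
  Gronwall's inequality provides.\<close>

lemma continuous_on_Times_uniform:
  fixes f :: "'a::metric_space \<Rightarrow> 'b::metric_space \<Rightarrow> 'c::metric_space"
  assumes 1: "\<And>y. y \<in> B \<Longrightarrow> continuous_on S (\<lambda>x. f x y)"
    and 2: "\<And>y \<epsilon>. y \<in> B \<Longrightarrow> \<epsilon> > 0 \<Longrightarrow> \<exists>\<delta>>0. \<forall>z\<in>B. dist z y < \<delta> \<longrightarrow> (\<forall>x\<in>S. dist (f x z) (f x y) \<le> \<epsilon>)"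
  shows "continuous_on (S \<times> B) (\<lambda>(x, y). f x y)"
  unfolding continuous_on_iff
proof (intro ballI allI impI)
  fix t and e :: real assume t: "t \<in> S \<times> B" and e: "e > 0"
  obtain x y where xy: "t = (x, y)" "x \<in> S" "y \<in> B" using t by auto
  obtain d1 where d1: "d1 > 0" "\<And>w. w \<in> S \<Longrightarrow> dist w x < d1 \<Longrightarrow> dist (f w y) (f x y) < e / 2"
    using 1[OF xy(3)] xy(2) e unfolding continuous_on_iff by (metis half_gt_zero)
  obtain d2 where d2: "d2 > 0" "\<And>z w. z \<in> B \<Longrightarrow> dist z y < d2 \<Longrightarrow> w \<in> S \<Longrightarrow> dist (f w z) (f w y) \<le> e / 2"
    using 2[OF xy(3), of "e / 2"] e by auto
  show "\<exists>d>0. \<forall>t'\<in>S \<times> B. dist t' t < d \<longrightarrow> dist (case t' of (x, y) \<Rightarrow> f x y) (case t of (x, y) \<Rightarrow> f x y) < e"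
  proof (intro exI[of _ "min d1 d2"] conjI ballI impI)
    fix t' assume t': "t' \<in> S \<times> B" "dist t' t < min d1 d2"
    obtain w z where wz: "t' = (w, z)" "w \<in> S" "z \<in> B" using t' by auto
    have "dist w x < d1" "dist z y < d2"
      using t' dist_fst_le[of t' t] dist_snd_le[of t' t] by (auto simp: wz xy)
    then have "dist (f w y) (f x y) < e / 2" "dist (f w z) (f w y) \<le> e / 2" using d1 d2 wz by auto
    then have "dist (f w z) (f x y) < e" using dist_triangle[of "f w z" "f x y" "f w y"] by simp
    then show "dist (case t' of (x, y) \<Rightarrow> f x y) (case t of (x, y) \<Rightarrow> f x y) < e" by (simp add: wz xy)
  qed (use d1 d2 in auto)
qed

text \<open>Outside {a..b} the curve continues along its end tangents, so the one-sided derivatives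
  at \<open>a\<close> and \<open>b\<close> match those of the affine pieces. This helps to supply
  the extension to an open set that smoothness on a closed interval requires.\<close>

lemma linear_extension_has_vector_derivative:
  fixes y :: "real \<Rightarrow> 'e::real_normed_vector"
  assumes ab: "a < b" and y: "\<And>x. x \<in> {a..b} \<Longrightarrow> (y has_vector_derivative y' x) (at x within {a..b})"
  shows "((\<lambda>x. y (max a (min b x)) + (x - max a (min b x)) *\<^sub>R y' (max a (min b x)))
    has_vector_derivative y' (max a (min b x))) (at x)"
proof -
  define Y where "Y = (\<lambda>x. y (max a (min b x)) + (x - max a (min b x)) *\<^sub>R y' (max a (min b x)))"
  have lin: "((\<lambda>x. y s + (x - s) *\<^sub>R y' s) has_vector_derivative y' s) (at x within S)" for s x S
    by (auto intro!: derivative_eq_intros)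
  have left: "(Y has_vector_derivative y' a) (at x within {..a})" if "x \<le> a" for x
    by (rule has_vector_derivative_transform[OF _ _ lin[of a]]) (use that ab in \<open>auto simp: Y_def\<close>)
  have right: "(Y has_vector_derivative y' b) (at x within {b..})" if "x \<ge> b" for x
    by (rule has_vector_derivative_transform[OF _ _ lin[of b]]) (use that ab in \<open>auto simp: Y_def\<close>)
  have mid: "(Y has_vector_derivative y' x) (at x within {a..b})" if "x \<in> {a..b}" for x
    by (rule has_vector_derivative_transform[OF _ _ y[OF that]]) (use that ab in \<open>auto simp: Y_def\<close>)
  have un: "(Y has_vector_derivative d) (at x)"
    if "(Y has_vector_derivative d) (at x within S)" "(Y has_vector_derivative d) (at x within T)" "x \<in> interior (S \<union> T)" for S T d x
  proof -
    have "(Y has_vector_derivative d) (at x within S \<union> T)"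
      using that(1,2) unfolding has_vector_derivative_def has_derivative_within
      by (auto simp: Lim_within_Un)
    then show ?thesis using that(3) by (simp only: at_within_interior)
  qed
  consider "x < a" | "x = a" | "a < x" "x < b" | "x = b" | "b < x" by linarith
  then have "(Y has_vector_derivative y' (max a (min b x))) (at x)"
  proof cases
    case 1
    then show ?thesis using un[OF left[of x] left[of x]] ab by simp
  next
    case 2
    have "a \<in> interior ({..a} \<union> {a..b})"
      using ab by (intro interiorI[of "{..<b}"]) auto
    then show ?thesis using un[OF left[of a] mid[of a]] ab 2 by simp
  next
    case 3
    then show ?thesis using mid[of x] by (simp add: at_within_Icc_at)
  next
    case 4
    have "b \<in> interior ({a..b} \<union> {b..})"
      using ab by (intro interiorI[of "{a<..}"]) auto
    then show ?thesis using un[OF mid[of b] right[of b]] ab 4 by simp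
  next
    case 5
    then show ?thesis using un[OF right[of x] right[of x]] ab by simp
  qed
  then show ?thesis by (simp add: Y_def)
qed

section \<open>Solutions in a closed tube about a reference solution\<close>

text \<open>\<open>G'\<close> is the derivative in all variables, so \<open>G' z (0, h)\<close> is
  the derivative in \<open>y\<close> alone. The closed tube is compact, which gives uniform
  constants, and convex in each fibre, which allows the mean value inequality.\<close>

locale ode_tube =
  fixes a b :: real and \<Omega> :: "(real \<times> 'e::euclidean_space) set" and G G' y0 r
  assumes ab: "a < b" and G: "C1_on \<Omega> G G'"
    and y0: "\<And>x. x \<in> {a..b} \<Longrightarrow> (y0 has_vector_derivative (G (x, y0 x) :: 'e)) (at x within {a..b})"
    and r: "r > 0" and tube: "\<And>x y. x \<in> {a..b} \<Longrightarrow> dist y (y0 x) \<le> r \<Longrightarrow> (x, y) \<in> \<Omega>"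
begin

definition T where "T = {(x, y). x \<in> {a..b} \<and> dist y (y0 x) \<le> r}"

lemma y0_cont: "continuous_on {a..b} y0"
  by (rule has_vector_derivative_imp_continuous_on[OF y0])

lemma T_compact: "compact T"
proof -
  have "T = (\<lambda>(x, h). (x, y0 x + h)) ` ({a..b} \<times> cball 0 r)"
  proof (intro set_eqI iffI)
    fix t assume "t \<in> T"
    then obtain x y where t: "t = (x, y)" "x \<in> {a..b}" "dist y (y0 x) \<le> r" by (auto simp: T_def)
    then show "t \<in> (\<lambda>(x, h). (x, y0 x + h)) ` ({a..b} \<times> cball 0 r)"
      by (intro image_eqI[of _ _ "(x, y - y0 x)"]) (auto simp: dist_norm norm_minus_commute)
  qed (auto simp: T_def dist_norm)
  moreover have "compact ((\<lambda>(x, h). (x, y0 x + h)) ` ({a..b} \<times> cball 0 r))"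
    unfolding case_prod_unfold
    by (intro compact_continuous_image compact_Times continuous_intros continuous_on_compose2[OF y0_cont]) auto
  ultimately show ?thesis by simp
qed

lemma T_sub: "T \<subseteq> \<Omega>" using tube by (auto simp: T_def)

definition L where "L = (SOME L. L > 0 \<and> (\<forall>z\<in>T. \<forall>h. norm (G' z h) \<le> L * norm h))"

lemma L: "L > 0" "\<And>z h. z \<in> T \<Longrightarrow> norm (G' z h) \<le> L * norm h"
proof -
  have "\<exists>L>0. \<forall>z\<in>T. \<forall>h. norm (G' z h) \<le> L * norm h"
    using C1_on_bounded_deriv[OF G T_compact T_sub] by metis
  then have "L > 0 \<and> (\<forall>z\<in>T. \<forall>h. norm (G' z h) \<le> L * norm h)"
    unfolding L_def by (rule someI_ex)
  then show "L > 0" "\<And>z h. z \<in> T \<Longrightarrow> norm (G' z h) \<le> L * norm h" by auto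
qed

lemma G_der:
  assumes "(x, y) \<in> \<Omega>"
  shows "((\<lambda>y. G (x, y)) has_derivative (\<lambda>h. G' (x, y) (0, h))) (at y within S)"
proof -
  have "((\<lambda>y. (x, y)) has_derivative (\<lambda>h. (0, h))) (at y within S)"
    by (auto intro!: derivative_eq_intros)
  from diff_chain_within[OF this has_derivative_at_withinI[OF C1_on_deriv[OF G assms]]]
  show ?thesis by (simp add: o_def)
qed

lemma G'_lin: "(x, y) \<in> \<Omega> \<Longrightarrow> bounded_linear (\<lambda>h. G' (x, y) (0, h))"
  using G_der has_derivative_bounded_linear by blast

lemma G_lip:
  assumes "x \<in> {a..b}" "dist y (y0 x) \<le> r" "dist z (y0 x) \<le> r"
  shows "norm (G (x, y) - G (x, z)) \<le> L * norm (y - z)"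
proof (rule differentiable_bound[of "cball (y0 x) r"])
  show "((\<lambda>y. G (x, y)) has_derivative (\<lambda>h. G' (x, y) (0, h))) (at y within cball (y0 x) r)"
    if "y \<in> cball (y0 x) r" for y
    using that assms(1) by (intro G_der tube) (auto simp: dist_commute)
  show "onorm (\<lambda>h. G' (x, y) (0, h)) \<le> L" if "y \<in> cball (y0 x) r" for y
  proof (rule onorm_le)
    show "norm (G' (x, y) (0, h)) \<le> L * norm h" for h
      using L(2)[of "(x, y)" "(0, h)"] that assms(1) by (auto simp: T_def dist_commute norm_Pair)
  qed
qed (use assms in \<open>auto simp: dist_commute\<close>)

text \<open>Mean value inequality for \<open>G\<close> minus its linearisation at \<open>y\<close>,
  on the convex set \<open>cball (y0 x) r \<inter> ball y \<delta>\<close>. The modulus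
  \<open>\<delta>\<close> is uniform in \<open>x\<close> and \<open>y\<close>, as needed inside
  Gronwall's inequality.\<close>

lemma G_linearization:
  assumes "\<epsilon> > 0"
  obtains \<delta> where "\<delta> > 0" "\<And>x y z. x \<in> {a..b} \<Longrightarrow> dist y (y0 x) \<le> r \<Longrightarrow> dist z (y0 x) \<le> r \<Longrightarrow> dist z y < \<delta> \<Longrightarrow>
    norm (G (x, z) - G (x, y) - G' (x, y) (0, z - y)) \<le> \<epsilon> * norm (z - y)"
proof -
  obtain \<delta> where d: "\<delta> > 0" "\<And>z w h. z \<in> T \<Longrightarrow> w \<in> T \<Longrightarrow> dist z w < \<delta> \<Longrightarrow> norm (G' z h - G' w h) \<le> \<epsilon> * norm h"
    using C1_on_uniform_deriv[OF G T_compact T_sub assms] by metis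
  have "norm (G (x, z) - G (x, y) - G' (x, y) (0, z - y)) \<le> \<epsilon> * norm (z - y)"
    if x: "x \<in> {a..b}" and y: "dist y (y0 x) \<le> r" and z: "dist z (y0 x) \<le> r" "dist z y < \<delta>" for x y z
  proof -
    have yO: "(x, y) \<in> \<Omega>" using tube x y by simp
    interpret bounded_linear "\<lambda>h. G' (x, y) (0, h)" by (rule G'_lin[OF yO])
    have "norm ((G (x, z) - G' (x, y) (0, z)) - (G (x, y) - G' (x, y) (0, y))) \<le> \<epsilon> * norm (z - y)"
    proof (rule differentiable_bound[of "cball (y0 x) r \<inter> ball y \<delta>"])
      fix w assume w: "w \<in> cball (y0 x) r \<inter> ball y \<delta>"
      have wT: "(x, w) \<in> T" "(x, y) \<in> T" using w x y by (auto simp: T_def dist_commute)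
      show "((\<lambda>w. G (x, w) - G' (x, y) (0, w)) has_derivative (\<lambda>h. G' (x, w) (0, h) - G' (x, y) (0, h)))
        (at w within cball (y0 x) r \<inter> ball y \<delta>)"
        using wT T_sub by (intro has_derivative_diff G_der bounded_linear_imp_has_derivative bounded_linear_axioms) auto
      show "onorm (\<lambda>h. G' (x, w) (0, h) - G' (x, y) (0, h)) \<le> \<epsilon>"
      proof (rule onorm_le)
        show "norm (G' (x, w) (0, h) - G' (x, y) (0, h)) \<le> \<epsilon> * norm h" for h
          using d(2)[OF wT, of "(0, h)"] w by (auto simp: dist_Pair_Pair dist_commute norm_Pair)
      qed
    qed (use y z d(1) in \<open>auto simp: dist_commute intro!: convex_Int\<close>)
    then show ?thesis by (simp add: diff algebra_simps)
  qed
  with d(1) show thesis by (rule that)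
qed

text \<open>Retracting onto the tube makes the right-hand side globally Lipschitz; solutions that start
  close to \<open>y0 a\<close> stay in the tube and hence solve the original equation.\<close>
definition retr where "retr v = closest_point (cball 0 r) (v::'e)"

definition Gt where "Gt x y = G (x, y0 x + retr (y - y0 x))"

lemma retr: "norm (retr v) \<le> r" "norm v \<le> r \<Longrightarrow> retr v = v" "norm (retr v - retr w) \<le> norm (v - w)"
proof -
  have "retr v \<in> cball 0 r" unfolding retr_def using r by (intro closest_point_in_set) auto
  then show "norm (retr v) \<le> r" by simp
  show "norm v \<le> r \<Longrightarrow> retr v = v" unfolding retr_def by (intro closest_point_self) auto
  show "norm (retr v - retr w) \<le> norm (v - w)"
    using closest_point_lipschitz[of "cball 0 r" v w] r by (simp add: retr_def dist_norm)
qed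

lemma Gt_eq: "dist y (y0 x) \<le> r \<Longrightarrow> Gt x y = G (x, y)"
  by (simp add: Gt_def retr(2) dist_norm)

lemma Gt_lip: "x \<in> {a..b} \<Longrightarrow> norm (Gt x y - Gt x z) \<le> L * norm (y - z)"
proof -
  assume x: "x \<in> {a..b}"
  have "norm (Gt x y - Gt x z) \<le> L * norm ((y0 x + retr (y - y0 x)) - (y0 x + retr (z - y0 x)))"
    unfolding Gt_def using x by (intro G_lip) (auto simp: dist_norm retr)
  also have "\<dots> \<le> L * norm (y - z)"
    using L(1) retr(3)[of "y - y0 x" "z - y0 x"] by (intro mult_left_mono) auto
  finally show ?thesis .
qed

lemma retr_cont: "continuous_on UNIV retr"
  unfolding retr_def using r by (intro continuous_on_closest_point) auto

lemma Gt_cont: "continuous_on ({a..b} \<times> UNIV) (\<lambda>(x, y). Gt x y)"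
  unfolding Gt_def case_prod_unfold
  by (intro continuous_on_compose2[OF C1_on_continuous[OF G]] continuous_intros
      continuous_on_compose2[OF y0_cont] continuous_on_compose2[OF retr_cont])
    (auto intro!: tube simp: dist_norm retr)

lemma Gt_solution: "\<exists>Y. Y a = \<eta> \<and> (\<forall>x\<in>{a..b}. (Y has_vector_derivative Gt x (Y x)) (at x within {a..b}))"
  using picard_lindelof[OF less_imp_le[OF ab] L(1) Gt_cont Gt_lip] by metis

definition sol where
  "sol \<eta> = (SOME Y. Y a = \<eta> \<and> (\<forall>x\<in>{a..b}. (Y has_vector_derivative Gt x (Y x)) (at x within {a..b})))"

lemma sol: "sol \<eta> a = \<eta>" "\<And>x. x \<in> {a..b} \<Longrightarrow> (sol \<eta> has_vector_derivative Gt x (sol \<eta> x)) (at x within {a..b})"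
  using someI_ex[OF Gt_solution[of \<eta>]] unfolding sol_def by auto

definition K where "K = growth a b L"

lemma K: "K > 0" using ab by (simp add: K_def growth_pos)

lemma sol_dist:
  assumes "x \<in> {a..b}" shows "norm (sol \<eta> x - sol \<theta> x) \<le> K * norm (\<eta> - \<theta>)"
proof -
  have "norm (sol \<eta> x - sol \<theta> x) \<le> growth a b L * (norm (sol \<eta> a - sol \<theta> a) + 0)"
    by (rule norm_le_growth[OF assms, where w' = "\<lambda>x. Gt x (sol \<eta> x) - Gt x (sol \<theta> x)"])
      (use L Gt_lip in \<open>auto intro!: has_vector_derivative_diff sol(2)\<close>)
  then show ?thesis by (simp add: sol K_def)
qed

lemma sol_y0:
  assumes "x \<in> {a..b}" shows "sol (y0 a) x = y0 x"
proof -
  have "norm (sol (y0 a) x - y0 x) \<le> growth a b L * (norm (sol (y0 a) a - y0 a) + 0)"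
  proof (rule norm_le_growth[OF assms, where w' = "\<lambda>x. Gt x (sol (y0 a) x) - Gt x (y0 x)"])
    show "((\<lambda>x. sol (y0 a) x - y0 x) has_vector_derivative Gt x (sol (y0 a) x) - Gt x (y0 x)) (at x within {a..b})"
      if "x \<in> {a..b}" for x
      using y0[OF that] r by (intro has_vector_derivative_diff sol(2) that) (simp add: Gt_eq)
  qed (use L Gt_lip in auto)
  then show ?thesis by (simp add: sol)
qed

lemma G'_cont:
  assumes "continuous_on S p" "continuous_on S q" "\<And>s. s \<in> S \<Longrightarrow> p s \<in> \<Omega>"
  shows "continuous_on S (\<lambda>s. G' (p s) (0, q s))"
  using assms by (intro C1_on_continuous_deriv_compose[OF G] continuous_intros) auto

section \<open>Differentiable dependence on the parameter of the initial value\<close>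

context
  fixes J :: "'p::euclidean_space \<Rightarrow> 'e"
  assumes J: "bounded_linear J"
begin

definition Bj where "Bj = onorm J + 1"

lemma Bj: "Bj > 0" "norm (J \<alpha>) \<le> Bj * norm \<alpha>"
proof -
  show "Bj > 0" using onorm_pos_le[OF J] by (simp add: Bj_def)
  show "norm (J \<alpha>) \<le> Bj * norm \<alpha>"
    using onorm[OF J, of \<alpha>] norm_ge_zero[of \<alpha>] unfolding Bj_def distrib_right by linarith
qed

text \<open>The radius with \<open>K * Bj * \<rho> = r\<close>: for smaller parameters the growth
  bound keeps the solution in the tube.\<close>

definition \<rho> where "\<rho> = r / (K * Bj)"

lemma \<rho>: "\<rho> > 0" using r K Bj by (simp add: \<rho>_def)

definition Y where "Y x \<alpha> = sol (y0 a + J \<alpha>) x"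

lemma Y_dist: "x \<in> {a..b} \<Longrightarrow> norm (Y x \<alpha> - Y x \<beta>) \<le> K * Bj * norm (\<alpha> - \<beta>)"
proof -
  assume x: "x \<in> {a..b}"
  have "norm (Y x \<alpha> - Y x \<beta>) \<le> K * norm (J (\<alpha> - \<beta>))"
    using sol_dist[OF x, of "y0 a + J \<alpha>" "y0 a + J \<beta>"] by (simp add: Y_def linear_simps[OF J])
  also have "\<dots> \<le> K * (Bj * norm (\<alpha> - \<beta>))" using K Bj by (intro mult_left_mono) auto
  finally show ?thesis by (simp add: mult.assoc)
qed

lemma Y_0: "x \<in> {a..b} \<Longrightarrow> Y x 0 = y0 x"
  by (simp add: Y_def sol_y0 linear_simps[OF J])

lemma Y_tube: "x \<in> {a..b} \<Longrightarrow> \<alpha> \<in> ball 0 \<rho> \<Longrightarrow> dist (Y x \<alpha>) (y0 x) \<le> r"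
proof -
  assume x: "x \<in> {a..b}" and \<alpha>: "\<alpha> \<in> ball 0 \<rho>"
  have "K * Bj * norm \<alpha> \<le> K * Bj * \<rho>" using \<alpha> K Bj by (intro mult_left_mono) auto
  also have "\<dots> = r" using K Bj by (simp add: \<rho>_def)
  finally show ?thesis using Y_dist[OF x, of \<alpha> 0] x by (simp add: Y_0 dist_norm)
qed

lemma Y_\<Omega>: "x \<in> {a..b} \<Longrightarrow> \<alpha> \<in> ball 0 \<rho> \<Longrightarrow> (x, Y x \<alpha>) \<in> \<Omega>"
  using Y_tube tube by blast

lemma Y_der: "x \<in> {a..b} \<Longrightarrow> \<alpha> \<in> ball 0 \<rho> \<Longrightarrow> ((\<lambda>x. Y x \<alpha>) has_vector_derivative G (x, Y x \<alpha>)) (at x within {a..b})"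
  using sol(2)[of x "y0 a + J \<alpha>"] Gt_eq[OF Y_tube[of x \<alpha>]] by (simp add: Y_def[abs_def])

lemma Y_cont_x: "\<alpha> \<in> ball 0 \<rho> \<Longrightarrow> continuous_on {a..b} (\<lambda>x. Y x \<alpha>)"
  by (rule has_vector_derivative_imp_continuous_on[OF Y_der])

lemma Y_cont: "continuous_on ({a..b} \<times> ball 0 \<rho>) (\<lambda>(x, \<alpha>). Y x \<alpha>)"
proof (rule continuous_on_Times_uniform)
  fix \<alpha> :: 'p and \<epsilon> :: real assume e: "\<epsilon> > 0"
  have "dist (Y x \<beta>) (Y x \<alpha>) \<le> \<epsilon>" if "dist \<beta> \<alpha> < \<epsilon> / (K * Bj)" "x \<in> {a..b}" for \<beta> x
  proof -
    have "K * Bj * norm (\<beta> - \<alpha>) \<le> \<epsilon>" using that(1) K Bj(1) by (simp add: field_simps dist_norm)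
    then show ?thesis using Y_dist[OF that(2), of \<beta> \<alpha>] by (simp add: dist_norm)
  qed
  then show "\<exists>\<delta>>0. \<forall>\<beta>\<in>ball 0 \<rho>. dist \<beta> \<alpha> < \<delta> \<longrightarrow> (\<forall>x\<in>{a..b}. dist (Y x \<beta>) (Y x \<alpha>) \<le> \<epsilon>)"
    using e K Bj(1) by (intro exI[of _ "\<epsilon> / (K * Bj)"]) auto
qed (rule Y_cont_x)

lemma var_lip:
  assumes "x \<in> {a..b}" "\<alpha> \<in> ball 0 \<rho>"
  shows "norm (G' (x, Y x \<alpha>) (0, y)) \<le> L * norm y"
    "norm (G' (x, Y x \<alpha>) (0, y) - G' (x, Y x \<alpha>) (0, z)) \<le> L * norm (y - z)"
proof -
  interpret bounded_linear "\<lambda>h. G' (x, Y x \<alpha>) (0, h)" by (rule G'_lin[OF Y_\<Omega>[OF assms]])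
  have "(x, Y x \<alpha>) \<in> T" using Y_tube assms by (auto simp: T_def)
  from L(2)[OF this, of "(0, h)" for h]
  have *: "norm (G' (x, Y x \<alpha>) (0, h)) \<le> L * norm h" for h by (simp add: norm_Pair)
  from * show "norm (G' (x, Y x \<alpha>) (0, y)) \<le> L * norm y" .
  from *[of "y - z"] show "norm (G' (x, Y x \<alpha>) (0, y) - G' (x, Y x \<alpha>) (0, z)) \<le> L * norm (y - z)"
    by (simp only: diff)
qed

lemma var_solution:
  assumes \<alpha>: "\<alpha> \<in> ball 0 \<rho>"
  shows "\<exists>Z. Z a = J \<beta> \<and> (\<forall>x\<in>{a..b}. (Z has_vector_derivative G' (x, Y x \<alpha>) (0, Z x)) (at x within {a..b}))"
proof -
  have "continuous_on ({a..b} \<times> UNIV) (\<lambda>(x, y). G' (x, Y x \<alpha>) (0, y))"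
    unfolding case_prod_unfold
    by (intro G'_cont continuous_intros continuous_on_compose2[OF Y_cont_x[OF \<alpha>]]) (use Y_\<Omega> \<alpha> in auto)
  from picard_lindelof[OF less_imp_le[OF ab] L(1) this var_lip(2)[OF _ \<alpha>]]
  show ?thesis by metis
qed

text \<open>Candidate for the derivative of \<open>Y x\<close> at \<open>\<alpha>\<close> in
  direction \<open>\<beta>\<close>: the solution of the variational equation along
  \<open>Y _ \<alpha>\<close> with initial value \<open>J \<beta>\<close>.\<close>

definition Z where "Z x \<alpha> \<beta> = (SOME Z. Z a = J \<beta> \<and>
  (\<forall>x\<in>{a..b}. (Z has_vector_derivative G' (x, Y x \<alpha>) (0, Z x)) (at x within {a..b}))) x"

lemma Z:
  assumes \<alpha>: "\<alpha> \<in> ball 0 \<rho>"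
  shows "Z a \<alpha> \<beta> = J \<beta>"
    "\<And>x. x \<in> {a..b} \<Longrightarrow> ((\<lambda>x. Z x \<alpha> \<beta>) has_vector_derivative G' (x, Y x \<alpha>) (0, Z x \<alpha> \<beta>)) (at x within {a..b})"
  using someI_ex[OF var_solution[OF \<alpha>, of \<beta>]] unfolding Z_def[abs_def] by auto

lemma Z_cont_x: "\<alpha> \<in> ball 0 \<rho> \<Longrightarrow> continuous_on {a..b} (\<lambda>x. Z x \<alpha> \<beta>)"
  by (rule has_vector_derivative_imp_continuous_on[OF Z(2)])

lemma Z_bound: "x \<in> {a..b} \<Longrightarrow> \<alpha> \<in> ball 0 \<rho> \<Longrightarrow> norm (Z x \<alpha> \<beta>) \<le> K * norm (J \<beta>)"
  using norm_le_growth[of x a b L 0 "\<lambda>x. Z x \<alpha> \<beta>" "\<lambda>x. G' (x, Y x \<alpha>) (0, Z x \<alpha> \<beta>)"] L(1) Z var_lip(1)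
  by (simp add: K_def)

lemma Z_unique:
  assumes x: "x \<in> {a..b}" and \<alpha>: "\<alpha> \<in> ball 0 \<rho>" and z: "z a = J \<beta>"
    and "\<And>x. x \<in> {a..b} \<Longrightarrow> (z has_vector_derivative G' (x, Y x \<alpha>) (0, z x)) (at x within {a..b})"
  shows "z x = Z x \<alpha> \<beta>"
proof -
  have "norm (z x - Z x \<alpha> \<beta>) \<le> growth a b L * (norm (z a - Z a \<alpha> \<beta>) + 0)"
    by (rule norm_le_growth[OF x, where w' = "\<lambda>x. G' (x, Y x \<alpha>) (0, z x) - G' (x, Y x \<alpha>) (0, Z x \<alpha> \<beta>)"])
      (use L(1) var_lip(2)[OF _ \<alpha>] assms(4) in \<open>auto intro!: has_vector_derivative_diff Z(2)[OF \<alpha>]\<close>)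
  then show ?thesis by (simp add: z Z(1)[OF \<alpha>])
qed

lemma Z_lin:
  assumes x: "x \<in> {a..b}" and \<alpha>: "\<alpha> \<in> ball 0 \<rho>"
  shows "linear (Z x \<alpha>)"
proof (rule linearI)
  have lin: "bounded_linear (\<lambda>h. G' (x, Y x \<alpha>) (0, h))" if "x \<in> {a..b}" for x
    by (rule G'_lin[OF Y_\<Omega>[OF that \<alpha>]])
  show "Z x \<alpha> (\<beta> + \<gamma>) = Z x \<alpha> \<beta> + Z x \<alpha> \<gamma>" for \<beta> \<gamma>
  proof (rule Z_unique[OF x \<alpha>, symmetric])
    show "Z a \<alpha> \<beta> + Z a \<alpha> \<gamma> = J (\<beta> + \<gamma>)" by (simp add: Z[OF \<alpha>] linear_simps[OF J])
    show "((\<lambda>x. Z x \<alpha> \<beta> + Z x \<alpha> \<gamma>) has_vector_derivative G' (x, Y x \<alpha>) (0, Z x \<alpha> \<beta> + Z x \<alpha> \<gamma>)) (at x within {a..b})"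
      if "x \<in> {a..b}" for x
      using has_vector_derivative_add[OF Z(2)[OF \<alpha> that, of \<beta>] Z(2)[OF \<alpha> that, of \<gamma>]]
      by (simp add: linear_simps(1)[OF lin[OF that]])
  qed
  show "Z x \<alpha> (t *\<^sub>R \<beta>) = t *\<^sub>R Z x \<alpha> \<beta>" for t \<beta>
  proof (rule Z_unique[OF x \<alpha>, symmetric])
    show "t *\<^sub>R Z a \<alpha> \<beta> = J (t *\<^sub>R \<beta>)" by (simp add: Z[OF \<alpha>] linear_simps[OF J])
    show "((\<lambda>x. t *\<^sub>R Z x \<alpha> \<beta>) has_vector_derivative G' (x, Y x \<alpha>) (0, t *\<^sub>R Z x \<alpha> \<beta>)) (at x within {a..b})"
      if "x \<in> {a..b}" for x
      using bounded_linear.has_vector_derivative[OF bounded_linear_scaleR_right Z(2)[OF \<alpha> that, of \<beta>]]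
      by (simp add: linear_simps(5)[OF lin[OF that]])
  qed
qed

text \<open>The remainder \<open>Y x \<beta> - Y x \<alpha> - Z x \<alpha> h\<close> vanishes at
  \<open>a\<close> and satisfies the variational equation up to an error of size
  \<open>\<epsilon>1 * K * Bj * norm h\<close>; Gronwall's inequality then bounds it by a small
  multiple of \<open>norm h\<close>.\<close>

lemma Y_has_derivative:
  assumes x: "x \<in> {a..b}" and \<alpha>: "\<alpha> \<in> ball 0 \<rho>"
  shows "(Y x has_derivative Z x \<alpha>) (at \<alpha>)"
  unfolding has_derivative_at_alt
proof (intro conjI allI impI)
  show "bounded_linear (Z x \<alpha>)" using Z_lin[OF x \<alpha>] by (simp add: linear_conv_bounded_linear)
  fix \<epsilon> :: real assume e: "\<epsilon> > 0"
  \<comment> \<open>One factor \<open>K\<close> (with \<open>Bj\<close>) belongs to the Lipschitz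
    bound on \<open>Y\<close> inside the linearisation error, the other to Gronwall's
    inequality.\<close>
  define \<epsilon>1 where "\<epsilon>1 = \<epsilon> / (K * (K * Bj))"
  have e1: "\<epsilon>1 > 0" using e K Bj(1) by (simp add: \<epsilon>1_def)
  obtain \<delta> where d: "\<delta> > 0" "\<And>x y z. x \<in> {a..b} \<Longrightarrow> dist y (y0 x) \<le> r \<Longrightarrow> dist z (y0 x) \<le> r \<Longrightarrow> dist z y < \<delta> \<Longrightarrow>
    norm (G (x, z) - G (x, y) - G' (x, y) (0, z - y)) \<le> \<epsilon>1 * norm (z - y)"
    using G_linearization[OF e1] by metis
  obtain s where s: "s > 0" "ball \<alpha> s \<subseteq> ball 0 \<rho>" using \<alpha> openE[OF open_ball] by blast
  \<comment> \<open>\<open>s\<close> keeps \<open>\<beta>\<close> in the parameter ball; the second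
    bound forces \<open>norm (Y x \<beta> - Y x \<alpha>) < \<delta>\<close> for every
    \<open>x\<close>.\<close>
  define t where "t = min s (\<delta> / (K * Bj))"
  have t: "t > 0" using s d K Bj(1) by (simp add: t_def)
  show "\<exists>d>0. \<forall>\<beta>. norm (\<beta> - \<alpha>) < d \<longrightarrow> norm (Y x \<beta> - Y x \<alpha> - Z x \<alpha> (\<beta> - \<alpha>)) \<le> \<epsilon> * norm (\<beta> - \<alpha>)"
  proof (intro exI[of _ t] conjI t allI impI)
    fix \<beta> assume b: "norm (\<beta> - \<alpha>) < t"
    have \<beta>: "\<beta> \<in> ball 0 \<rho>" using b s by (auto simp: t_def dist_norm norm_minus_commute subset_iff)
    define h where "h = \<beta> - \<alpha>"
    have small: "K * Bj * norm h < \<delta>" using b K Bj(1) by (simp add: t_def h_def field_simps)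
    have "norm (Y x \<beta> - Y x \<alpha> - Z x \<alpha> h) \<le> growth a b L * (norm (Y a \<beta> - Y a \<alpha> - Z a \<alpha> h) + \<epsilon>1 * (K * Bj * norm h))"
    proof (rule norm_le_growth[OF x, where w' = "\<lambda>x. G (x, Y x \<beta>) - G (x, Y x \<alpha>) - G' (x, Y x \<alpha>) (0, Z x \<alpha> h)"])
      fix x assume x: "x \<in> {a..b}"
      show "((\<lambda>x. Y x \<beta> - Y x \<alpha> - Z x \<alpha> h) has_vector_derivative
          G (x, Y x \<beta>) - G (x, Y x \<alpha>) - G' (x, Y x \<alpha>) (0, Z x \<alpha> h)) (at x within {a..b})"
        using x \<alpha> \<beta> by (intro has_vector_derivative_diff Y_der Z(2)) auto
      interpret bounded_linear "\<lambda>h. G' (x, Y x \<alpha>) (0, h)" by (rule G'_lin[OF Y_\<Omega>[OF x \<alpha>]])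
      have "norm (G (x, Y x \<beta>) - G (x, Y x \<alpha>) - G' (x, Y x \<alpha>) (0, Y x \<beta> - Y x \<alpha>)) \<le> \<epsilon>1 * norm (Y x \<beta> - Y x \<alpha>)"
        using Y_tube[OF x] \<alpha> \<beta> Y_dist[OF x, of \<beta> \<alpha>] small by (intro d(2) x) (auto simp: dist_norm h_def)
      also have "\<dots> \<le> \<epsilon>1 * (K * Bj * norm h)"
        using e1 Y_dist[OF x, of \<beta> \<alpha>] by (intro mult_left_mono) (auto simp: h_def)
      finally have 1: "norm (G (x, Y x \<beta>) - G (x, Y x \<alpha>) - G' (x, Y x \<alpha>) (0, Y x \<beta> - Y x \<alpha>)) \<le> \<epsilon>1 * (K * Bj * norm h)" .
      have 2: "norm (G' (x, Y x \<alpha>) (0, Y x \<beta> - Y x \<alpha> - Z x \<alpha> h)) \<le> L * norm (Y x \<beta> - Y x \<alpha> - Z x \<alpha> h)"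
        by (rule var_lip[OF x \<alpha>])
      have "G (x, Y x \<beta>) - G (x, Y x \<alpha>) - G' (x, Y x \<alpha>) (0, Z x \<alpha> h) =
         G' (x, Y x \<alpha>) (0, Y x \<beta> - Y x \<alpha> - Z x \<alpha> h) + (G (x, Y x \<beta>) - G (x, Y x \<alpha>) - G' (x, Y x \<alpha>) (0, Y x \<beta> - Y x \<alpha>))"
        by (simp add: diff)
      then show "norm (G (x, Y x \<beta>) - G (x, Y x \<alpha>) - G' (x, Y x \<alpha>) (0, Z x \<alpha> h))
          \<le> L * norm (Y x \<beta> - Y x \<alpha> - Z x \<alpha> h) + \<epsilon>1 * (K * Bj * norm h)"
        using norm_triangle_mono[OF 2 1] by (simp only:)
    qed (use L(1) e1 K Bj(1) in auto)
    also have "Y a \<beta> - Y a \<alpha> - Z a \<alpha> h = 0"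
      by (simp add: Y_def sol Z[OF \<alpha>] h_def linear_simps[OF J])
    finally show "norm (Y x \<beta> - Y x \<alpha> - Z x \<alpha> (\<beta> - \<alpha>)) \<le> \<epsilon> * norm (\<beta> - \<alpha>)"
      using K Bj(1) by (simp add: \<epsilon>1_def K_def[symmetric] h_def)
  qed
qed

text \<open>The difference of two variational solutions starts at 0 and solves the equation along
  \<open>\<gamma>\<close> with an inhomogeneity due to the change of coefficients. That change is
  small uniformly in \<open>x\<close>, because \<open>G'\<close> is uniformly continuous on the
  tube.\<close>

lemma Z_cont: "continuous_on ({a..b} \<times> ball 0 \<rho>) (\<lambda>(x, \<alpha>). Z x \<alpha> \<beta>)"
proof (rule continuous_on_Times_uniform)
  fix \<alpha> :: 'p and \<epsilon> :: real assume \<alpha>: "\<alpha> \<in> ball 0 \<rho>" and e: "\<epsilon> > 0"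
  define M where "M = K * norm (J \<beta>) + 1"
  have M: "M > 0" using K by (simp add: M_def add_nonneg_pos)
  define \<epsilon>1 where "\<epsilon>1 = \<epsilon> / (K * M)"
  have e1: "\<epsilon>1 > 0" using e K M by (simp add: \<epsilon>1_def)
  obtain \<delta> where d: "\<delta> > 0" "\<And>z w h. z \<in> T \<Longrightarrow> w \<in> T \<Longrightarrow> dist z w < \<delta> \<Longrightarrow> norm (G' z h - G' w h) \<le> \<epsilon>1 * norm h"
    using C1_on_uniform_deriv[OF G T_compact T_sub e1] by metis
  have "dist (Z x \<gamma> \<beta>) (Z x \<alpha> \<beta>) \<le> \<epsilon>"
    if \<gamma>: "\<gamma> \<in> ball 0 \<rho>" "dist \<gamma> \<alpha> < \<delta> / (K * Bj)" and x: "x \<in> {a..b}" for \<gamma> x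
  proof -
    have small: "K * Bj * norm (\<gamma> - \<alpha>) < \<delta>" using \<gamma>(2) K Bj(1) by (simp add: dist_norm field_simps)
    have "norm (Z x \<gamma> \<beta> - Z x \<alpha> \<beta>) \<le> growth a b L * (norm (Z a \<gamma> \<beta> - Z a \<alpha> \<beta>) + \<epsilon>1 * M)"
    proof (rule norm_le_growth[OF x, where w' = "\<lambda>x. G' (x, Y x \<gamma>) (0, Z x \<gamma> \<beta>) - G' (x, Y x \<alpha>) (0, Z x \<alpha> \<beta>)"])
      fix x assume x: "x \<in> {a..b}"
      show "((\<lambda>x. Z x \<gamma> \<beta> - Z x \<alpha> \<beta>) has_vector_derivative
          G' (x, Y x \<gamma>) (0, Z x \<gamma> \<beta>) - G' (x, Y x \<alpha>) (0, Z x \<alpha> \<beta>)) (at x within {a..b})"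
        using x \<alpha> \<gamma> by (intro has_vector_derivative_diff Z(2)) auto
      have 1: "norm (G' (x, Y x \<gamma>) (0, Z x \<gamma> \<beta>) - G' (x, Y x \<gamma>) (0, Z x \<alpha> \<beta>)) \<le> L * norm (Z x \<gamma> \<beta> - Z x \<alpha> \<beta>)"
        by (rule var_lip[OF x \<gamma>(1)])
      have "norm (G' (x, Y x \<gamma>) (0, Z x \<alpha> \<beta>) - G' (x, Y x \<alpha>) (0, Z x \<alpha> \<beta>)) \<le> \<epsilon>1 * norm (0::real, Z x \<alpha> \<beta>)"
      proof (rule d(2))
        show "dist (x, Y x \<gamma>) (x, Y x \<alpha>) < \<delta>"
          using Y_dist[OF x, of \<gamma> \<alpha>] small by (simp add: dist_Pair_Pair dist_norm)
      qed (use Y_tube[OF x] \<alpha> \<gamma> x in \<open>auto simp: T_def\<close>)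
      also have "\<dots> \<le> \<epsilon>1 * M"
        using e1 Z_bound[OF x \<alpha>, of \<beta>] by (intro mult_left_mono) (auto simp: M_def norm_Pair)
      finally show "norm (G' (x, Y x \<gamma>) (0, Z x \<gamma> \<beta>) - G' (x, Y x \<alpha>) (0, Z x \<alpha> \<beta>))
          \<le> L * norm (Z x \<gamma> \<beta> - Z x \<alpha> \<beta>) + \<epsilon>1 * M"
        using 1 norm_diff_triangle_le by blast
    qed (use L(1) e1 M in auto)
    also have "\<dots> = \<epsilon>" using K M by (simp add: Z(1)[OF \<alpha>] Z(1)[OF \<gamma>(1)] \<epsilon>1_def K_def[symmetric])
    finally show ?thesis by (simp add: dist_norm)
  qed
  then show "\<exists>\<delta>>0. \<forall>\<gamma>\<in>ball 0 \<rho>. dist \<gamma> \<alpha> < \<delta> \<longrightarrow> (\<forall>x\<in>{a..b}. dist (Z x \<gamma> \<beta>) (Z x \<alpha> \<beta>) \<le> \<epsilon>)"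
    using d(1) K Bj(1) by (intro exI[of _ "\<delta> / (K * Bj)"]) auto
qed (rule Z_cont_x)

definition clp where "clp x = max a (min b (x::real))"

lemma clp: "clp x \<in> {a..b}" "x \<in> {a..b} \<Longrightarrow> clp x = x" "continuous_on S clp"
  using ab by (auto simp: clp_def[abs_def] intro!: continuous_intros)

text \<open>Affine continuation in \<open>x\<close> beyond \<open>{a..b}\<close>, so that the flow is \<open>C\<^sup>1\<close> on an open set.\<close>
definition Yx where "Yx = (\<lambda>(x, \<alpha>). Y (clp x) \<alpha> + (x - clp x) *\<^sub>R G (clp x, Y (clp x) \<alpha>))"

definition Yx' where "Yx' = (\<lambda>(x, \<alpha>) (s, \<beta>). s *\<^sub>R G (clp x, Y (clp x) \<alpha>) +
  (Z (clp x) \<alpha> \<beta> + (x - clp x) *\<^sub>R G' (clp x, Y (clp x) \<alpha>) (0, Z (clp x) \<alpha> \<beta>)))"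

lemma clp_cont2: "continuous_on (UNIV \<times> ball 0 \<rho>) (\<lambda>t. (clp (fst t), snd t))"
  by (intro continuous_intros continuous_on_compose2[OF clp(3)[of UNIV]]) auto

lemma Y_clp_cont: "continuous_on (UNIV \<times> ball 0 \<rho>) (\<lambda>t. Y (clp (fst t)) (snd t))"
  using continuous_on_compose2[OF Y_cont clp_cont2] clp(1) by force

lemma Z_clp_cont: "continuous_on (UNIV \<times> ball 0 \<rho>) (\<lambda>t. Z (clp (fst t)) (snd t) \<beta>)"
  using continuous_on_compose2[OF Z_cont clp_cont2] clp(1) by force

lemma G_clp_cont: "continuous_on (UNIV \<times> ball 0 \<rho>) (\<lambda>t. G (clp (fst t), Y (clp (fst t)) (snd t)))"
  by (intro continuous_on_compose2[OF C1_on_continuous[OF G]] continuous_intros Y_clp_cont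
      continuous_on_compose2[OF clp(3)[of UNIV]]) (use Y_\<Omega> clp(1) in auto)

lemma Yx_C1: "C1_on (UNIV \<times> ball 0 \<rho>) Yx Yx'"
proof (rule C1_onI)
  show "open (UNIV \<times> ball (0::'p) \<rho> :: (real \<times> 'p) set)" by (simp add: open_Times)
  show "(Yx has_derivative Yx' t) (at t)" if t: "t \<in> UNIV \<times> ball 0 \<rho>" for t
  proof -
    obtain x \<alpha> where t_eq: "t = (x, \<alpha>)" and \<alpha>: "\<alpha> \<in> ball 0 \<rho>" using t by auto
    \<comment> \<open>\<open>has_derivative_partialsI\<close> asks for a continuous partial
      derivative in the second variable and a pointwise one in the first. With \<open>x\<close>
      placed second, the continuous one is multiplication by an explicit value of
      \<open>G\<close>.\<close>
    have "((\<lambda>(\<alpha>, x). Yx (x, \<alpha>)) has_derivative (\<lambda>(\<beta>, s).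
        (Z (clp x) \<alpha> \<beta> + (x - clp x) *\<^sub>R G' (clp x, Y (clp x) \<alpha>) (0, Z (clp x) \<alpha> \<beta>)) +
        blinfun_apply (blinfun_scaleR_left (G (clp x, Y (clp x) \<alpha>))) s)) (at (\<alpha>, x) within ball 0 \<rho> \<times> UNIV)"
    proof (rule has_derivative_partialsI[where fy = "\<lambda>\<alpha> x. blinfun_scaleR_left (G (clp x, Y (clp x) \<alpha>))"])
      have Yd: "(Y (clp x) has_derivative Z (clp x) \<alpha>) (at \<alpha>)" by (rule Y_has_derivative[OF clp(1) \<alpha>])
      have "((\<lambda>\<alpha>. G (clp x, Y (clp x) \<alpha>)) has_derivative (\<lambda>\<beta>. G' (clp x, Y (clp x) \<alpha>) (0, Z (clp x) \<alpha> \<beta>))) (at \<alpha>)"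
        using diff_chain_at[OF Yd G_der[OF Y_\<Omega>[OF clp(1) \<alpha>], where S = UNIV]] by (simp add: o_def)
      then have "((\<lambda>\<alpha>. Y (clp x) \<alpha> + (x - clp x) *\<^sub>R G (clp x, Y (clp x) \<alpha>)) has_derivative
         (\<lambda>\<beta>. Z (clp x) \<alpha> \<beta> + (x - clp x) *\<^sub>R G' (clp x, Y (clp x) \<alpha>) (0, Z (clp x) \<alpha> \<beta>))) (at \<alpha>)"
        using Yd by (intro has_derivative_add has_derivative_scaleR_right)
      then show "((\<lambda>\<alpha>. Yx (x, \<alpha>)) has_derivative
         (\<lambda>\<beta>. Z (clp x) \<alpha> \<beta> + (x - clp x) *\<^sub>R G' (clp x, Y (clp x) \<alpha>) (0, Z (clp x) \<alpha> \<beta>))) (at \<alpha> within ball 0 \<rho>)"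
        by (simp add: Yx_def has_derivative_at_withinI)
      show "((\<lambda>x. Yx (x, \<gamma>)) has_derivative blinfun_apply (blinfun_scaleR_left (G (clp x, Y (clp x) \<gamma>)))) (at x within UNIV)"
        if "\<gamma> \<in> ball 0 \<rho>" for \<gamma> x
        using linear_extension_has_vector_derivative[OF ab Y_der[OF _ that], of x]
        by (simp add: Yx_def clp_def has_vector_derivative_def)
      have "continuous_on (ball 0 \<rho> \<times> UNIV) (\<lambda>t. blinfun_scaleR_left (G (clp (fst (snd t, fst t)), Y (clp (fst (snd t, fst t))) (snd (snd t, fst t)))))"
        by (intro bounded_linear.continuous_on[OF bounded_linear_blinfun_scaleR_left] continuous_on_compose2[OF G_clp_cont] continuous_intros) auto
      then show "continuous (at (\<alpha>, x) within ball 0 \<rho> \<times> UNIV) (\<lambda>(\<alpha>, x). blinfun_scaleR_left (G (clp x, Y (clp x) \<alpha>)))"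
        using \<alpha> by (auto simp: continuous_on_eq_continuous_within case_prod_unfold)
    qed auto
    moreover have "open (ball (0::'p) \<rho> \<times> (UNIV::real set))" by (simp add: open_Times)
    moreover have "(\<lambda>(\<beta>, s). Yx' (x, \<alpha>) (s, \<beta>)) = (\<lambda>(\<beta>, s).
        (Z (clp x) \<alpha> \<beta> + (x - clp x) *\<^sub>R G' (clp x, Y (clp x) \<alpha>) (0, Z (clp x) \<alpha> \<beta>)) +
        blinfun_apply (blinfun_scaleR_left (G (clp x, Y (clp x) \<alpha>))) s)"
      by (rule ext) (simp add: Yx'_def case_prod_unfold)
    moreover have "(\<alpha>, x) \<in> ball 0 \<rho> \<times> UNIV" using \<alpha> by simp
    ultimately have D: "((\<lambda>(\<alpha>, x). Yx (x, \<alpha>)) has_derivative (\<lambda>(\<beta>, s). Yx' (x, \<alpha>) (s, \<beta>))) (at (\<alpha>, x))"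
      by (simp only: at_within_open)
    have "((\<lambda>t. (snd t, fst t)) has_derivative (\<lambda>t. (snd t, fst t))) (at (x, \<alpha>))"
      by (auto intro!: derivative_eq_intros)
    from diff_chain_at[OF this, of "\<lambda>(\<alpha>, x). Yx (x, \<alpha>)" "\<lambda>(\<beta>, s). Yx' (x, \<alpha>) (s, \<beta>)"] D
    show ?thesis by (simp add: o_def t_eq)
  qed
  have lin: "linear (Z (clp x) \<alpha>)" if "\<alpha> \<in> ball 0 \<rho>" for x \<alpha> by (rule Z_lin[OF clp(1) that])
  \<comment> \<open>Continuity jointly with the direction: \<open>Z\<close> is linear in it, so an
    expansion in the basis reduces to fixed directions.\<close>
  have Zb: "continuous_on ((UNIV \<times> ball 0 \<rho>) \<times> (UNIV :: (real \<times> 'p) set)) (\<lambda>s. Z (clp (fst (fst s))) (snd (fst s)) (snd (snd s)))"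
  proof (rule continuous_on_eq)
    show "continuous_on ((UNIV \<times> ball 0 \<rho>) \<times> UNIV)
      (\<lambda>s. \<Sum>e\<in>Basis. (snd (snd s) \<bullet> e) *\<^sub>R Z (clp (fst (fst s))) (snd (fst s)) e)"
      by (intro continuous_intros continuous_on_compose2[OF Z_clp_cont]) auto
    show "(\<Sum>e\<in>Basis. (snd (snd s) \<bullet> e) *\<^sub>R Z (clp (fst (fst s))) (snd (fst s)) e) = Z (clp (fst (fst s))) (snd (fst s)) (snd (snd s))"
      if "s \<in> (UNIV \<times> ball 0 \<rho>) \<times> UNIV" for s :: "(real \<times> 'p) \<times> (real \<times> 'p)"
    proof -
      have l: "linear (Z (clp (fst (fst s))) (snd (fst s)))" using that by (intro lin) auto
      show ?thesis
        by (subst (2) euclidean_representation[symmetric, of "snd (snd s)"])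
          (simp add: linear_sum[OF l] linear_scale[OF l])
    qed
  qed
  have fs: "continuous_on ((UNIV \<times> ball 0 \<rho>) \<times> UNIV) (fst :: (real \<times> 'p) \<times> (real \<times> 'p) \<Rightarrow> _)" by (intro continuous_intros)
  show "continuous_on ((UNIV \<times> ball 0 \<rho>) \<times> UNIV) (\<lambda>(t, h). Yx' t h)"
    unfolding Yx'_def case_prod_unfold
    by (intro continuous_intros Zb G'_cont continuous_on_compose2[OF G_clp_cont fs] continuous_on_compose2[OF Y_clp_cont fs]
        continuous_on_compose2[OF clp(3)[of UNIV]]) (use Y_\<Omega> clp(1) in auto)
qed

text \<open>What the construction of the field uses: a \<open>C^1\<close> flow on an open set whose
  parameter derivative at 0 solves the linearised equation along \<open>y0\<close>.\<close>

lemma flow: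
  obtains \<rho> Yf Yf' where "\<rho> > 0" "C1_on (UNIV \<times> ball 0 \<rho>) Yf Yf'"
    "\<And>x \<alpha>. x \<in> {a..b} \<Longrightarrow> \<alpha> \<in> ball 0 \<rho> \<Longrightarrow> (x, Yf (x, \<alpha>)) \<in> \<Omega>"
    "\<And>x \<alpha>. x \<in> {a..b} \<Longrightarrow> \<alpha> \<in> ball 0 \<rho> \<Longrightarrow> ((\<lambda>x. Yf (x, \<alpha>)) has_vector_derivative G (x, Yf (x, \<alpha>))) (at x within {a..b})"
    "\<And>\<alpha>. Yf (a, \<alpha>) = y0 a + J \<alpha>"
    "\<And>x. x \<in> {a..b} \<Longrightarrow> Yf (x, 0) = y0 x"
    "\<And>x \<beta>. x \<in> {a..b} \<Longrightarrow> ((\<lambda>x. Yf' (x, 0) (0, \<beta>)) has_vector_derivative G' (x, y0 x) (0, Yf' (x, 0) (0, \<beta>))) (at x within {a..b})"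
    "\<And>\<beta>. Yf' (a, 0) (0, \<beta>) = J \<beta>"
proof -
  have eq: "Yx (x, \<alpha>) = Y x \<alpha>" "Yx' (x, \<alpha>) (0, \<beta>) = Z x \<alpha> \<beta>" if "x \<in> {a..b}" for x \<alpha> \<beta>
    using that by (simp_all add: Yx_def Yx'_def clp)
  have a: "a \<in> {a..b}" and 0: "0 \<in> ball 0 \<rho>" using ab \<rho> by auto
  show thesis
  proof (rule that[OF \<rho> Yx_C1])
    show "((\<lambda>x. Yx (x, \<alpha>)) has_vector_derivative G (x, Yx (x, \<alpha>))) (at x within {a..b})"
      if "x \<in> {a..b}" "\<alpha> \<in> ball 0 \<rho>" for x \<alpha>
      by (rule has_vector_derivative_transform[OF that(1) eq(1)]) (use that Y_der eq in auto)
    show "((\<lambda>x. Yx' (x, 0) (0, \<beta>)) has_vector_derivative G' (x, y0 x) (0, Yx' (x, 0) (0, \<beta>))) (at x within {a..b})"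
      if "x \<in> {a..b}" for x \<beta>
      by (rule has_vector_derivative_transform[OF that(1) eq(2)]) (use Z(2)[OF 0 that, of \<beta>] eq that in \<open>auto simp: Y_0\<close>)
  qed (use eq a 0 Y_\<Omega> Y_0 in \<open>auto simp: Z Y_def sol\<close>)
qed

end
end

section \<open>Inverse functions near compact sets and the integrand\<close>

text \<open>Besides local injectivity, the lower bound \<open>m\<close> on the derivatives holds on
  a whole ball. This uniformity later makes the derivative of the inverse continuous.\<close>

lemma C1_on_local_inverse_bound:
  fixes F :: "'a::euclidean_space \<Rightarrow> 'a"
  assumes F: "C1_on U F F'" and z: "z \<in> U" and inj: "inj (F' z)"
  obtains r m where "r > 0" "m > 0" "ball z r \<subseteq> U" "inj_on F (ball z r)"
    "\<And>w h. w \<in> ball z r \<Longrightarrow> m * norm h \<le> norm (F' w h)"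
proof -
  have lin: "linear (F' z)" using C1_on_linear_deriv[OF F z] by (simp add: linear_conv_bounded_linear)
  obtain s0 where s0: "s0 > 0" "cball z s0 \<subseteq> U" using C1_on_open[OF F] z open_contains_cball by blast
  have unif: "\<exists>d>0. d \<le> s0 \<and> (\<forall>w h. dist z w < d \<longrightarrow> norm (F' w h - F' z h) \<le> e * norm h)" if e: "e > 0" for e
  proof -
    obtain d where d: "d > 0" "\<And>v w h. v \<in> cball z s0 \<Longrightarrow> w \<in> cball z s0 \<Longrightarrow> dist v w < d \<Longrightarrow> norm (F' v h - F' w h) \<le> e * norm h"
      using C1_on_uniform_deriv[OF F compact_cball s0(2) e] by metis
    show ?thesis
      by (intro exI[of _ "min d s0"]) (use d s0 in \<open>auto simp: dist_commute\<close>)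
  qed
  obtain g' where g': "linear g'" "g' \<circ> F' z = id" using linear_injective_left_inverse[OF lin inj] by blast
  obtain B where B: "B > 0" "\<And>x. B * norm x \<le> norm (F' z x)"
    using linear_inj_bounded_below_pos[OF lin inj] by blast
  have "\<exists>d>0. \<forall>x. dist z x < d \<longrightarrow> onorm (\<lambda>v. F' x v - F' z v) < e" if e: "e > 0" for e
  proof -
    obtain d where d: "d > 0" "\<And>w h. dist z w < d \<Longrightarrow> norm (F' w h - F' z h) \<le> e / 2 * norm h"
      using unif[of "e / 2"] e by auto
    have "onorm (\<lambda>v. F' x v - F' z v) \<le> e / 2" if "dist z x < d" for x
      using d(2)[OF that] e by (intro onorm_bound) auto
    then show ?thesis using d(1) e by (force intro!: exI[of _ d])
  qed
  from has_derivative_locally_injective[OF z C1_on_open[OF F] linear_conv_bounded_linear[THEN iffD1, OF g'(1)] g'(2) C1_on_deriv[OF F] this]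
  obtain r1 where r1: "r1 > 0" "ball z r1 \<subseteq> U" "inj_on F (ball z r1)" by metis
  obtain d where d: "d > 0" "\<And>w h. dist z w < d \<Longrightarrow> norm (F' w h - F' z h) \<le> B / 2 * norm h"
    using unif[of "B / 2"] B by auto
  show thesis
  proof (rule that[of "min r1 d" "B / 2"])
    show "inj_on F (ball z (min r1 d))" using r1(3) by (rule inj_on_subset) auto
    show "B / 2 * norm h \<le> norm (F' w h)" if "w \<in> ball z (min r1 d)" for w h
      using B(2)[of h] d(2)[of w h] that norm_triangle_ineq2[of "F' z h" "F' w h"]
      by (auto simp: norm_minus_commute)
  qed (use r1 d B in auto)
qed

text \<open>Otherwise there are distinct \<open>z n\<close>, \<open>w n\<close> with equal images
  and distances from \<open>K\<close> tending to 0. Along a subsequence they converge to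
  \<open>P\<close>, \<open>Q\<close> in \<open>K\<close> with \<open>F P = F Q\<close>, so
  \<open>P = Q\<close>, and local injectivity at \<open>P\<close> is violated.\<close>

lemma inj_on_neighbourhood_of_compact:
  fixes F :: "'a::euclidean_space \<Rightarrow> 'b::metric_space"
  assumes K: "compact K" "K \<subseteq> U" and U: "open U" and F: "continuous_on U F" and inj: "inj_on F K"
    and loc: "\<And>z. z \<in> K \<Longrightarrow> \<exists>r>0. inj_on F (ball z r)"
  obtains V where "open V" "K \<subseteq> V" "inj_on F V"
proof -
  define V where "V = (\<lambda>n. \<Union>z\<in>K. ball z (inverse (real (Suc n))))"
  have "\<exists>n. inj_on F (V n)"
  proof (rule ccontr)
    assume "\<not> ?thesis"
    then have "\<forall>n. \<exists>z w p q. p \<in> K \<and> q \<in> K \<and> dist p z < inverse (real (Suc n)) \<and> dist q w < inverse (real (Suc n)) \<and> z \<noteq> w \<and> F z = F w"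
      unfolding inj_on_def V_def by (simp add: Bex_def) blast
    then obtain z w p q where zw: "\<And>n. p n \<in> K" "\<And>n. q n \<in> K" "\<And>n. dist (p n) (z n) < inverse (real (Suc n))"
      "\<And>n. dist (q n) (w n) < inverse (real (Suc n))" "\<And>n. z n \<noteq> w n" "\<And>n. F (z n) = F (w n)" by metis
    have "compact (K \<times> K)" using K by (intro compact_Times)
    then obtain l \<sigma> where l: "l \<in> K \<times> K" "strict_mono (\<sigma> :: nat \<Rightarrow> nat)" "((\<lambda>n. (p n, q n)) \<circ> \<sigma>) \<longlonglongrightarrow> l"
      using zw(1,2) unfolding compact_def by (elim allE[of _ "\<lambda>n. (p n, q n)"]) auto
    obtain P Q where PQ: "l = (P, Q)" "P \<in> K" "Q \<in> K" using l by auto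
    have pP: "(\<lambda>n. p (\<sigma> n)) \<longlonglongrightarrow> P" and qQ: "(\<lambda>n. q (\<sigma> n)) \<longlonglongrightarrow> Q"
      using tendsto_fst[OF l(3)] tendsto_snd[OF l(3)] by (auto simp: o_def PQ)
    have inv0: "(\<lambda>n. inverse (real (Suc (\<sigma> n)))) \<longlonglongrightarrow> 0"
      using LIMSEQ_subseq_LIMSEQ[OF LIMSEQ_inverse_real_of_nat l(2)] by (simp add: o_def)
    have "(\<lambda>n. p (\<sigma> n) - z (\<sigma> n)) \<longlonglongrightarrow> 0" "(\<lambda>n. q (\<sigma> n) - w (\<sigma> n)) \<longlonglongrightarrow> 0"
      using zw(3,4) by (auto intro!: Lim_null_comparison[OF _ inv0] always_eventually simp: dist_norm less_imp_le)
    then have zP: "(\<lambda>n. z (\<sigma> n)) \<longlonglongrightarrow> P" and wQ: "(\<lambda>n. w (\<sigma> n)) \<longlonglongrightarrow> Q"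
      using tendsto_diff[OF pP, of "\<lambda>n. p (\<sigma> n) - z (\<sigma> n)" 0] tendsto_diff[OF qQ, of "\<lambda>n. q (\<sigma> n) - w (\<sigma> n)" 0] by simp_all
    have "isCont F P" "isCont F Q" using F U K PQ by (auto simp: continuous_on_eq_continuous_at)
    then have "(\<lambda>n. F (z (\<sigma> n))) \<longlonglongrightarrow> F P" "(\<lambda>n. F (w (\<sigma> n))) \<longlonglongrightarrow> F Q"
      using zP wQ by (auto intro: isCont_tendsto_compose)
    then have "F P = F Q" using zw(6) LIMSEQ_unique[of "\<lambda>n. F (z (\<sigma> n))"] by simp
    then have "P = Q" using inj PQ by (auto dest: inj_onD)
    obtain r where r: "r > 0" "inj_on F (ball P r)" using loc PQ by blast
    have "eventually (\<lambda>n. z (\<sigma> n) \<in> ball P r \<and> w (\<sigma> n) \<in> ball P r) sequentially"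
      using tendstoD[OF zP r(1)] tendstoD[OF wQ[folded \<open>P = Q\<close>] r(1)] by eventually_elim (auto simp: dist_commute)
    then obtain n where "z (\<sigma> n) \<in> ball P r" "w (\<sigma> n) \<in> ball P r" by (auto simp: eventually_sequentially)
    then show False using r(2) zw(5,6) by (meson inj_onD)
  qed
  then obtain n where "inj_on F (V n)" by blast
  moreover have "open (V n)" by (auto simp: V_def)
  moreover have "K \<subseteq> V n" by (force simp: V_def)
  ultimately show thesis using that by blast
qed

text \<open>One inverse near all of \<open>K\<close> instead of a local one at each point:
  injectivity spreads from \<open>K\<close> by compactness, invariance of domain makes the image
  open, and the lower bounds on \<open>F'\<close> give continuity of the inverse derivative.\<close>

lemma C1_inverse_near_compact:
  fixes F :: "'a::euclidean_space \<Rightarrow> 'a"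
  assumes F: "C1_on U F F'" and K: "compact K" "K \<subseteq> U" and inj: "inj_on F K"
    and inj': "\<And>z. z \<in> K \<Longrightarrow> inj (F' z)"
  obtains V g g' where "open V" "K \<subseteq> V" "V \<subseteq> U" "inj_on F V" "C1_on (F ` V) g g'"
    "\<And>z. z \<in> V \<Longrightarrow> g (F z) = z" "\<And>z k. z \<in> V \<Longrightarrow> F' z (g' (F z) k) = k"
proof -
  have "\<forall>z. \<exists>r m. z \<in> K \<longrightarrow> r > 0 \<and> m > 0 \<and> ball z r \<subseteq> U \<and> inj_on F (ball z r) \<and>
      (\<forall>w h. w \<in> ball z r \<longrightarrow> m * norm h \<le> norm (F' w h))"
    using C1_on_local_inverse_bound[OF F] inj' K(2) by (metis subsetD)
  then obtain r m where rm: "\<And>z. z \<in> K \<Longrightarrow> r z > 0" "\<And>z. z \<in> K \<Longrightarrow> m z > 0" "\<And>z. z \<in> K \<Longrightarrow> ball z (r z) \<subseteq> U"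
    "\<And>z. z \<in> K \<Longrightarrow> inj_on F (ball z (r z))" "\<And>z w h. z \<in> K \<Longrightarrow> w \<in> ball z (r z) \<Longrightarrow> m z * norm h \<le> norm (F' w h)"
    by metis
  obtain W where W: "open W" "K \<subseteq> W" "inj_on F W"
    using inj_on_neighbourhood_of_compact[OF K C1_on_open[OF F] C1_on_continuous[OF F] inj] rm by metis
  define V where "V = W \<inter> (\<Union>z\<in>K. ball z (r z))"
  have V: "open V" "K \<subseteq> V" "V \<subseteq> U" "inj_on F V"
    using W rm(1,3) by (auto simp: V_def intro!: open_Int inj_on_subset[OF W(3)])
  have lin: "linear (F' z)" if "z \<in> V" for z
    using C1_on_linear_deriv[OF F] V(3) that by (auto simp: linear_conv_bounded_linear)
  have bnd: "\<exists>m>0. \<exists>B. open B \<and> z \<in> B \<and> (\<forall>w\<in>B. \<forall>h. m * norm h \<le> norm (F' w h))" if "z \<in> V" for z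
  proof -
    obtain p where p: "p \<in> K" "z \<in> ball p (r p)" using \<open>z \<in> V\<close> by (auto simp: V_def)
    then show ?thesis using rm(2)[OF p(1)] rm(5)[OF p(1)]
      by (intro exI[of _ "m p"] conjI exI[of _ "ball p (r p)"]) auto
  qed
  have injV: "inj (F' z)" if z: "z \<in> V" for z
  proof -
    obtain m where m: "m > 0" "\<And>h. m * norm h \<le> norm (F' z h)" using bnd[OF z] by blast
    have "h = 0" if "F' z h = 0" for h using m(2)[of h] m(1) that by (auto simp: mult_le_0_iff)
    then show ?thesis using linear_injective_0[OF lin[OF z]] by blast
  qed
  have surjV: "surj (F' z)" if "z \<in> V" for z
    using linear_inj_imp_surj[OF lin[OF that] injV[OF that]] .
  define g where "g = inv_into V F"
  define g' where "g' = (\<lambda>y k. inv (F' (g y)) k)"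
  have contF: "continuous_on V F" using C1_on_continuous[OF F] V(3) continuous_on_subset by blast
  have gF: "g (F z) = z" if "z \<in> V" for z using V(4) that by (simp add: g_def)
  have Fg': "F' z (g' (F z) k) = k" if "z \<in> V" for z k
    using surj_f_inv_f[OF surjV[OF that]] gF[OF that] by (simp add: g'_def)
  have dg: "(g has_derivative g' (F z)) (at (F z))" if z: "z \<in> V" for z
  proof (rule has_derivative_inverse_strong[OF V(1) z contF gF C1_on_deriv[OF F]])
    show "F' z \<circ> g' (F z) = id" using Fg'[OF z] by auto
  qed (use z V in auto)
  have oF: "open (F ` V)" by (rule invariance_of_domain[OF contF V(1,4)])
  have "C1_on (F ` V) g g'"
  proof (rule C1_onI[OF oF])
    show der: "(g has_derivative g' y) (at y)" if "y \<in> F ` V" for y using dg that by auto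
    from has_derivative_continuous_on[OF has_derivative_at_withinI[OF der]]
    have contg: "continuous_on (F ` V) g" .
    show "continuous_on (F ` V \<times> UNIV) (\<lambda>(y, k). g' y k)"
      unfolding continuous_on_def
    proof
      fix t assume t: "t \<in> F ` V \<times> (UNIV :: 'a set)"
      then obtain z k where zk: "t = (F z, k)" "z \<in> V" by auto
      define c where "c = g' (F z) k"
      obtain m B where m: "m > 0" and B: "open B" "z \<in> B" "\<And>w h. w \<in> B \<Longrightarrow> m * norm h \<le> norm (F' w h)"
        using bnd[OF zk(2)] by blast
      have contg2: "continuous_on (F ` V \<times> UNIV) (\<lambda>s::'a\<times>'a. g (fst s))"
        by (rule continuous_on_compose2[OF contg]) (auto intro!: continuous_intros)
      have "continuous_on (F ` V \<times> UNIV) (\<lambda>s. snd s - F' (g (fst s)) c)"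
        by (intro continuous_intros C1_on_continuous_deriv_compose[OF F] contg2) (use gF V in auto)
      then have "((\<lambda>s. snd s - F' (g (fst s)) c) \<longlongrightarrow> snd t - F' (g (fst t)) c) (at t within F ` V \<times> UNIV)"
        using t by (auto simp: continuous_on_def)
      then have lim0: "((\<lambda>s. norm (snd s - F' (g (fst s)) c) / m) \<longlongrightarrow> 0) (at t within F ` V \<times> UNIV)"
        using Fg'[OF zk(2), of k] gF[OF zk(2)] by (intro tendsto_divide_zero tendsto_norm_zero) (simp add: zk c_def)
      have "((\<lambda>s. g (fst s)) \<longlongrightarrow> z) (at t within F ` V \<times> UNIV)"
        using contg2[unfolded continuous_on_def, rule_format, OF t] gF[OF zk(2)] by (simp add: zk)
      then have "\<forall>\<^sub>F s in at t within F ` V \<times> UNIV. g (fst s) \<in> B" using B(1,2) by (rule topological_tendstoD)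
      moreover have "\<forall>\<^sub>F s in at t within F ` V \<times> UNIV. s \<in> F ` V \<times> UNIV" by (simp add: eventually_at_filter)
      \<comment> \<open>\<open>F' (g (fst s))\<close> maps \<open>g' (fst s) (snd s) - c\<close> to
        \<open>snd s - F' (g (fst s)) c\<close>. The latter tends to 0, and the lower bound
        \<open>m\<close> transfers this to the former.\<close>
      ultimately have "\<forall>\<^sub>F s in at t within F ` V \<times> UNIV. norm (g' (fst s) (snd s) - c) \<le> norm (snd s - F' (g (fst s)) c) / m"
      proof eventually_elim
        case (elim s)
        then obtain w where w: "fst s = F w" "w \<in> V" by auto
        have "m * norm (g' (fst s) (snd s) - c) \<le> norm (F' (g (fst s)) (g' (fst s) (snd s) - c))" using elim by (intro B(3))
        also have "F' (g (fst s)) (g' (fst s) (snd s) - c) = snd s - F' (g (fst s)) c"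
          using linear_diff[OF lin[OF w(2)]] Fg'[OF w(2)] gF[OF w(2)] w by simp
        finally show ?case using m by (simp add: field_simps)
      qed
      from Lim_null_comparison[OF this lim0]
      show "((\<lambda>(y, k). g' y k) \<longlongrightarrow> (case t of (y, k) \<Rightarrow> g' y k)) (at t within F ` V \<times> UNIV)"
        by (simp add: LIM_zero_iff case_prod_unfold) (simp add: zk c_def)
    qed
  qed
  then show thesis using that[OF V] gF Fg' by blast
qed

section \<open>The integrand, its extension and its second derivatives\<close>

text \<open>One \<open>C^2\<close> extension \<open>F\<close> of the integrand to an open set is
  fixed, so that derivatives in all variables make sense at \<open>x = a\<close> and
  \<open>x = b\<close>. For \<open>x\<close> in {a..b} the derivatives in \<open>u\<close> and
  \<open>p\<close> are determined by \<open>f\<close> itself.\<close>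

locale C2_integrand =
  fixes f :: "real \<Rightarrow> real^'n \<Rightarrow> real^'n \<Rightarrow> real" and a b :: real
    and U :: "(real \<times> (real^'n) \<times> (real^'n)) set" and F DF D2F
  assumes ab: "a < b" and sub: "{a..b} \<times> UNIV \<subseteq> U" and F: "C1_on U F DF"
    and DF: "\<And>h. C1_on U (\<lambda>z. DF z h) (\<lambda>z. D2F z h)"
    and sym: "\<And>z h k. z \<in> U \<Longrightarrow> (D2F z h k :: real) = D2F z k h"
    and Ff: "\<And>x u p. x \<in> {a..b} \<Longrightarrow> F (x, u, p) = f x u p"
begin

definition fP where "fP z = (\<chi> i. DF z (0, 0, axis i 1))"
definition fU where "fU z = (\<chi> i. DF z (0, axis i 1, 0))"
definition DfP where "DfP z k = (\<chi> i. D2F z (0, 0, axis i 1) k)"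
definition DfU where "DfU z k = (\<chi> i. D2F z (0, axis i 1, 0) k)"

lemma U_open: "open U" using F by (rule C1_on_open)

lemma in_U: "x \<in> {a..b} \<Longrightarrow> (x, u, p) \<in> U" using sub by auto

lemma fP_C1: "C1_on U fP DfP"
  by (rule C1_on_vec[OF U_open]) (simp add: fP_def DfP_def DF)

lemma fU_C1: "C1_on U fU DfU"
  by (rule C1_on_vec[OF U_open]) (simp add: fU_def DfU_def DF)

lemma fp_eq: "x \<in> {a..b} \<Longrightarrow> fp f x u p = fP (x, u, p)"
proof -
  assume x: "x \<in> {a..b}"
  have "pdir (f x u) (axis i 1) p = DF (x, u, p) (0, 0, axis i 1)" for i
    using C1_on_pdir(2)[OF F in_U[OF x, of u p], of "(0, 0, axis i 1)"] x by (simp add: pdir_def Ff)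
  then show ?thesis by (simp add: fp_def fP_def)
qed

lemma fu_eq: "x \<in> {a..b} \<Longrightarrow> fu f x u p = fU (x, u, p)"
proof -
  assume x: "x \<in> {a..b}"
  have "pdir (\<lambda>w. f x w p) (axis i 1) u = DF (x, u, p) (0, axis i 1, 0)" for i
    using C1_on_pdir(2)[OF F in_U[OF x, of u p], of "(0, axis i 1, 0)"] x by (simp add: pdir_def Ff)
  then show ?thesis by (simp add: fu_def fU_def)
qed

lemma D2F_linear: "z \<in> U \<Longrightarrow> linear (D2F z h)"
  using C1_on_linear_deriv[OF DF] by (simp add: linear_conv_bounded_linear)

lemma vec_expand: "(q::real^'n) = (\<Sum>i\<in>UNIV. (q $ i) *\<^sub>R axis i 1)"
  using basis_expansion[of q] by (simp add: scalar_mult_eq_scaleR)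

lemma linear_slots:
  fixes l :: "real \<times> (real^'n) \<times> (real^'n) \<Rightarrow> real"
  assumes "linear l"
  shows "l (0, 0, q) = (\<Sum>i\<in>UNIV. q $ i * l (0, 0, axis i 1))"
    "l (0, w, 0) = (\<Sum>i\<in>UNIV. w $ i * l (0, axis i 1, 0))"
    "l (0, w, q) = l (0, w, 0) + l (0, 0, q)"
proof -
  have "linear (\<lambda>q. l (0, 0, q))" "linear (\<lambda>w. l (0, w, 0))"
    using linear_compose[OF _ assms, of "\<lambda>q. (0, 0, q)"] linear_compose[OF _ assms, of "\<lambda>w. (0, w, 0)"]
    by (simp_all add: o_def linear_iff)
  from linear_sum[OF this(1), of "\<lambda>i. (q $ i) *\<^sub>R axis i 1" UNIV] linear_sum[OF this(2), of "\<lambda>i. (w $ i) *\<^sub>R axis i 1" UNIV]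
  show "l (0, 0, q) = (\<Sum>i\<in>UNIV. q $ i * l (0, 0, axis i 1))"
    "l (0, w, 0) = (\<Sum>i\<in>UNIV. w $ i * l (0, axis i 1, 0))"
    using linear_scale[OF \<open>linear (\<lambda>q. l (0, 0, q))\<close>] linear_scale[OF \<open>linear (\<lambda>w. l (0, w, 0))\<close>]
    unfolding vec_expand[symmetric] by simp_all
  show "l (0, w, q) = l (0, w, 0) + l (0, 0, q)"
    using linear_add[OF assms, of "(0, w, 0)" "(0, 0, q)"] by simp
qed

lemma DF_split: "z \<in> U \<Longrightarrow> DF z (0, w, q) = fU z \<bullet> w + fP z \<bullet> q"
proof -
  assume "z \<in> U"
  then have "linear (DF z)" using C1_on_linear_deriv[OF F] by (simp add: linear_conv_bounded_linear)
  from linear_slots(1)[OF this, of q] linear_slots(2)[OF this, of w] linear_slots(3)[OF this, of w q] show ?thesis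
    by (simp add: fU_def fP_def inner_vec_def mult.commute)
qed

lemma D2F_split: "z \<in> U \<Longrightarrow> D2F z (0, w, q) k = DfU z k \<bullet> w + DfP z k \<bullet> q"
proof -
  assume z: "z \<in> U"
  have "(\<lambda>h. D2F z h k) = D2F z k" using sym[OF z] by blast
  then have "linear (\<lambda>h. D2F z h k)" using D2F_linear[OF z, of k] by simp
  from linear_slots(1)[OF this, of q] linear_slots(2)[OF this, of w] linear_slots(3)[OF this, of w q] show ?thesis
    by (simp add: DfU_def DfP_def inner_vec_def mult.commute)
qed

text \<open>Symmetry of the second derivative on directions \<open>(0, w, q)\<close>. In this form
  it cancels the terms in the derivative of the Lagrange bracket.\<close>

lemma hessian_sym:
  "z \<in> U \<Longrightarrow> DfU z (0, w, q) \<bullet> w' + DfP z (0, w, q) \<bullet> q' = DfU z (0, w', q') \<bullet> w + DfP z (0, w', q') \<bullet> q"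
  using D2F_split[of z w' q' "(0, w, q)"] D2F_split[of z w q "(0, w', q')"] sym[of z] by simp

end

lemma integrand_C2_extension:
  assumes "a < b" "integrand_Ck 2 a b f"
  obtains U F DF D2F where "C2_integrand f a b U F DF D2F"
proof -
  obtain U F where UF: "{a..b} \<times> UNIV \<times> UNIV \<subseteq> U" "Ck_open 2 U F" "\<And>z. z \<in> {a..b} \<times> UNIV \<times> UNIV \<Longrightarrow> F z = (\<lambda>(x, u, p). f x u p) z"
    using assms(2) unfolding integrand_Ck_def Ck_on_def by auto
  obtain DF D2F where "C1_on U F DF" "\<And>h. C1_on U (\<lambda>z. DF z h) (\<lambda>z. D2F z h)"
    "\<And>z h k. z \<in> U \<Longrightarrow> D2F z h k = D2F z k h"
    using Ck_open_2_second_derivative[OF UF(2)] by metis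
  then have "C2_integrand f a b U F DF D2F" using assms(1) UF by unfold_locales auto
  then show thesis by (rule that)
qed

section \<open>Fields of extremals and Hilbert's invariant integral\<close>

text \<open>\<open>Ph\<close>, \<open>Al\<close> and \<open>Px\<close> are \<open>C\<^sup>1\<close> extensions to open sets of the parametrisation \<open>\<phi>\<close>, of
  \<open>(x, v) \<mapsto> \<alpha>(x, v)\<close> and of \<open>\<phi>\<^sub>x\<close>.\<close>
locale extremal_field = C2_integrand f a b U F DF D2F
  for f :: "real \<Rightarrow> real^'n \<Rightarrow> real^'n \<Rightarrow> real" and a b U F DF D2F +
  fixes et :: real and U1 Ph Ph' U2 and Al :: "real \<times> (real^'n) \<Rightarrow> real^'n" and Al' U3 Px Px'
  assumes et: "et > 0"
    and Ph: "C1_on U1 Ph Ph'" and U1: "{a..b} \<times> ball 0 et \<subseteq> U1"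
    and Al: "C1_on U2 Al Al'" and AlPh: "\<And>x \<beta>. x \<in> {a..b} \<Longrightarrow> \<beta> \<in> ball 0 et \<Longrightarrow> Al (x, Ph (x, \<beta>)) = \<beta>"
    and U2: "\<And>x \<beta>. x \<in> {a..b} \<Longrightarrow> \<beta> \<in> ball 0 et \<Longrightarrow> (x, Ph (x, \<beta>)) \<in> U2"
    and Px: "C1_on U3 Px Px'" and U3: "{a..b} \<times> ball 0 et \<subseteq> U3"
    and Ph_x: "\<And>x \<beta>. x \<in> {a..b} \<Longrightarrow> \<beta> \<in> ball 0 et \<Longrightarrow>
       ((\<lambda>y. Ph (y, \<beta>)) has_vector_derivative Px (x, \<beta>)) (at x within {a..b})"
    and EL: "\<And>x \<beta>. x \<in> {a..b} \<Longrightarrow> \<beta> \<in> ball 0 et \<Longrightarrow>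
       ((\<lambda>y. fP (y, Ph (y, \<beta>), Px (y, \<beta>))) has_vector_derivative fU (x, Ph (x, \<beta>), Px (x, \<beta>))) (at x within {a..b})"
begin

definition FS where "FS = (\<lambda>(x, \<alpha>). (x, Ph (x, \<alpha>))) ` ({a..b} \<times> ball 0 et)"

lemma FS_E:
  assumes "(x, v) \<in> FS" obtains \<beta> where "x \<in> {a..b}" "\<beta> \<in> ball 0 et" "v = Ph (x, \<beta>)" "Al (x, v) = \<beta>"
  using assms AlPh by (auto simp: FS_def)

lemma FS_I: "x \<in> {a..b} \<Longrightarrow> \<beta> \<in> ball 0 et \<Longrightarrow> (x, Ph (x, \<beta>)) \<in> FS"
  by (auto simp: FS_def)

text \<open>Freezing \<open>x\<close> outside \<open>{a..b}\<close> extends the field map injectively to all \<open>x\<close>, so that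
  invariance of domain applies.\<close>
lemma FS_rel_open: obtains N where "open N" "\<And>x v. x \<in> {a..b} \<Longrightarrow> (x, v) \<in> N \<longleftrightarrow> (x, v) \<in> FS"
proof -
  define c where "c = (\<lambda>x::real. max a (min b x))"
  have c: "c x \<in> {a..b}" "x \<in> {a..b} \<Longrightarrow> c x = x" for x using ab by (auto simp: c_def)
  define Q where "Q = (\<lambda>t::real \<times> (real^'n). (fst t, Ph (c (fst t), snd t)))"
  have "continuous_on (UNIV \<times> ball 0 et) Q"
    unfolding Q_def c_def
    by (intro continuous_intros continuous_on_compose2[OF C1_on_continuous[OF Ph]]) (use U1 ab in auto)
  moreover have "open (UNIV \<times> ball (0::real^'n) et :: (real \<times> (real^'n)) set)" by (simp add: open_Times)
  moreover have "inj_on Q (UNIV \<times> ball 0 et)"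
  proof (rule inj_onI)
    fix s t :: "real \<times> (real^'n)"
    assume st: "s \<in> UNIV \<times> ball 0 et" "t \<in> UNIV \<times> ball 0 et" and eq: "Q s = Q t"
    have 1: "fst s = fst t" using eq by (simp add: Q_def)
    have "snd s = Al (c (fst s), Ph (c (fst s), snd s))" "snd t = Al (c (fst t), Ph (c (fst t), snd t))"
      using AlPh[OF c(1)] st by auto
    then have "snd s = snd t" using eq 1 by (simp add: Q_def)
    with 1 show "s = t" by (simp add: prod_eq_iff)
  qed
  ultimately have "open (Q ` (UNIV \<times> ball 0 et))" by (rule invariance_of_domain)
  moreover have "(x, v) \<in> Q ` (UNIV \<times> ball 0 et) \<longleftrightarrow> (x, v) \<in> FS" if "x \<in> {a..b}" for x v
    using that c by (force simp: Q_def FS_def)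
  ultimately show thesis using that by blast
qed

text \<open>\<open>psi\<close> is the slope; \<open>AA\<close> and \<open>pp\<close> are the coefficients of Hilbert's form
  \<open>AA dx + pp \<bullet> dv\<close>.\<close>
definition xAl where "xAl z = (fst z, Al z)"
definition W0 where "W0 = {z \<in> U2. xAl z \<in> U3}"
definition psi where "psi z = Px (xAl z)"
definition psi' where "psi' z h = Px' (xAl z) (fst h, Al' z h)"
definition zz where "zz z = (fst z, snd z, psi z)"
definition W where "W = {z \<in> W0. zz z \<in> U}"
definition pp where "pp z = fP (zz z)"
definition pp' where "pp' z h = DfP (zz z) (fst h, snd h, psi' z h)"
definition AA where "AA z = F (zz z) - psi z \<bullet> pp z"
definition AA' where "AA' z h = DF (zz z) (fst h, snd h, psi' z h) - (psi z \<bullet> pp' z h + psi' z h \<bullet> pp z)"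

lemma C1_id: "open S \<Longrightarrow> C1_on S fst (\<lambda>z. fst)" "open S \<Longrightarrow> C1_on S snd (\<lambda>z. snd)"
  by (auto intro!: C1_on_bounded_linear bounded_linear_fst bounded_linear_snd)

lemma psi_C1: "C1_on W0 psi psi'"
proof -
  have "C1_on U2 xAl (\<lambda>z h. (fst h, Al' z h))"
    unfolding xAl_def[abs_def] using C1_on_open[OF Al] by (intro C1_on_Pair C1_id Al)
  from C1_on_compose_vimage[OF this Px] show ?thesis
    by (simp add: W0_def psi_def[abs_def] psi'_def[abs_def])
qed

lemma zz_C1: "C1_on W0 zz (\<lambda>z h. (fst h, snd h, psi' z h))"
  unfolding zz_def[abs_def] using C1_on_open[OF psi_C1] by (intro C1_on_Pair C1_id psi_C1)

lemma W_open: "open W" unfolding W_def by (rule open_vimage_C1_on[OF zz_C1 U_open])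

lemma pp_C1: "C1_on W pp pp'"
  using C1_on_compose_vimage[OF zz_C1 fP_C1] by (simp add: W_def pp_def[abs_def] pp'_def[abs_def])

lemma AA_C1: "C1_on W AA AA'"
proof -
  have "C1_on W (\<lambda>z. F (zz z)) (\<lambda>z h. DF (zz z) (fst h, snd h, psi' z h))"
    using C1_on_compose_vimage[OF zz_C1 F] by (simp add: W_def)
  moreover have "C1_on W psi psi'" using C1_on_subset[OF psi_C1 W_open] by (auto simp: W_def)
  ultimately show ?thesis
    unfolding AA_def[abs_def] AA'_def[abs_def]
    by (intro C1_on_diff C1_on_bilinear[OF bounded_bilinear_inner] pp_C1)
qed

lemma on_field:
  assumes "x \<in> {a..b}" "\<beta> \<in> ball 0 et"
  shows "psi (x, Ph (x, \<beta>)) = Px (x, \<beta>)" "zz (x, Ph (x, \<beta>)) = (x, Ph (x, \<beta>), Px (x, \<beta>))"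
    "(x, Ph (x, \<beta>)) \<in> W" "pp (x, Ph (x, \<beta>)) = fP (x, Ph (x, \<beta>), Px (x, \<beta>))"
proof -
  have x: "xAl (x, Ph (x, \<beta>)) = (x, \<beta>)" using AlPh[OF assms] by (simp add: xAl_def)
  show p: "psi (x, Ph (x, \<beta>)) = Px (x, \<beta>)" by (simp add: psi_def x)
  show z: "zz (x, Ph (x, \<beta>)) = (x, Ph (x, \<beta>), Px (x, \<beta>))" by (simp add: zz_def p)
  show "pp (x, Ph (x, \<beta>)) = fP (x, Ph (x, \<beta>), Px (x, \<beta>))" by (simp add: pp_def z)
  show "(x, Ph (x, \<beta>)) \<in> W" using U2[OF assms] U3 assms in_U x z by (auto simp: W_def W0_def)
qed

lemma FS_W: "FS \<subseteq> W" using on_field(3) by (auto simp: FS_def)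

text \<open>The terms with \<open>psi'\<close> cancel because \<open>pp\<close> is
  \<open>f_p\<close> taken at the slope; this is the reason for the form
  \<open>f - psi \<bullet> f_p\<close> of \<open>AA\<close>.\<close>

lemma AA'_vertical: "(x, v) \<in> W \<Longrightarrow> AA' (x, v) (0, w) = fU (zz (x, v)) \<bullet> w - psi (x, v) \<bullet> pp' (x, v) (0, w)"
proof -
  assume "(x, v) \<in> W"
  then have "zz (x, v) \<in> U" by (simp add: W_def)
  from DF_split[OF this, of w "psi' (x, v) (0, w)"] show ?thesis
    by (simp add: AA'_def pp_def inner_commute)
qed

text \<open>The Euler-Lagrange equation as a directional derivative of \<open>pp\<close>: a member
  of the field has velocity \<open>(1, Px (x, \<beta>))\<close>, and along it \<open>pp\<close> is
  \<open>f_p\<close>. Uniqueness of derivatives within the interval identifies the two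
  expressions.\<close>

lemma pp'_x:
  assumes "x \<in> {a..b}" "\<beta> \<in> ball 0 et"
  shows "pp' (x, Ph (x, \<beta>)) (1, Px (x, \<beta>)) = fU (x, Ph (x, \<beta>), Px (x, \<beta>))"
proof -
  have "((\<lambda>y. (y, Ph (y, \<beta>))) has_vector_derivative (1, Px (x, \<beta>))) (at x within {a..b})"
    by (intro has_vector_derivative_Pair Ph_x[OF assms]) (auto intro!: derivative_eq_intros)
  from C1_on_curve[OF pp_C1 this] on_field(3)[OF assms]
  have "((\<lambda>y. pp (y, Ph (y, \<beta>))) has_vector_derivative pp' (x, Ph (x, \<beta>)) (1, Px (x, \<beta>))) (at x within {a..b})" by simp
  then have "((\<lambda>y. fP (y, Ph (y, \<beta>), Px (y, \<beta>))) has_vector_derivative pp' (x, Ph (x, \<beta>)) (1, Px (x, \<beta>))) (at x within {a..b})"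
    by (rule has_vector_derivative_transform[rotated 2]) (use assms on_field(4) in auto)
  from vector_derivative_unique_within_closed_interval[OF ab _ this[folded cbox_interval] EL[OF assms, folded cbox_interval]]
  show ?thesis using assms(1) by simp
qed

section \<open>Variations of the field and their Lagrange bracket\<close>

text \<open>The variation of the field in the parameter direction \<open>c\<close>. Correspondingly
  \<open>Pxc\<close> is the variation of the slope, \<open>zf\<close> the 1-jet of an extremal and
  \<open>dz\<close> the variation of that jet.\<close>

definition Phc where "Phc \<beta> c x = Ph' (x, \<beta>) (0, c)"
definition Pxc where "Pxc \<beta> c x = Px' (x, \<beta>) (0, c)"
definition dz where "dz \<beta> c x = (0::real, Phc \<beta> c x, Pxc \<beta> c x)"
definition zf where "zf \<beta> x = (x, Ph (x, \<beta>), Px (x, \<beta>))"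

lemma small_step:
  fixes c :: "real^'n"
  assumes "\<beta> \<in> ball 0 et"
  obtains \<tau> where "\<tau> > 0" "\<And>t. \<bar>t\<bar> < \<tau> \<Longrightarrow> \<beta> + t *\<^sub>R c \<in> ball 0 (et::real)"
proof -
  obtain s where s: "s > 0" "ball \<beta> s \<subseteq> ball 0 et" using assms openE[OF open_ball] by blast
  have "\<beta> + t *\<^sub>R c \<in> ball 0 et" if "\<bar>t\<bar> < s / (norm c + 1)" for t
  proof -
    have "\<bar>t\<bar> * norm c \<le> \<bar>t\<bar> * (norm c + 1)" by (intro mult_left_mono) auto
    also have "\<dots> < s" using that by (simp add: pos_less_divide_eq add_nonneg_pos)
    finally have "\<beta> + t *\<^sub>R c \<in> ball \<beta> s" by (simp add: dist_norm)
    then show ?thesis using s(2) by blast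
  qed
  then show thesis using s(1) by (intro that[of "s / (norm c + 1)"]) (auto simp: add_nonneg_pos)
qed

lemma step_derivs:
  assumes "x \<in> {a..b}" "\<beta> + t *\<^sub>R c \<in> ball 0 et"
  shows "((\<lambda>t. Ph (x, \<beta> + t *\<^sub>R c)) has_vector_derivative Phc (\<beta> + t *\<^sub>R c) c x) (at t)"
    "((\<lambda>t. Px (x, \<beta> + t *\<^sub>R c)) has_vector_derivative Pxc (\<beta> + t *\<^sub>R c) c x) (at t)"
    "((\<lambda>t. zf (\<beta> + t *\<^sub>R c) x) has_vector_derivative dz (\<beta> + t *\<^sub>R c) c x) (at t)"
proof -
  have l: "((\<lambda>t. (x, \<beta> + t *\<^sub>R c)) has_vector_derivative (0, c)) (at t)"
    by (intro has_vector_derivative_Pair) (auto intro!: derivative_eq_intros)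
  show 1: "((\<lambda>t. Ph (x, \<beta> + t *\<^sub>R c)) has_vector_derivative Phc (\<beta> + t *\<^sub>R c) c x) (at t)"
    unfolding Phc_def using assms U1 by (intro C1_on_curve[OF Ph l]) auto
  show 2: "((\<lambda>t. Px (x, \<beta> + t *\<^sub>R c)) has_vector_derivative Pxc (\<beta> + t *\<^sub>R c) c x) (at t)"
    unfolding Pxc_def using assms U3 by (intro C1_on_curve[OF Px l]) auto
  show "((\<lambda>t. zf (\<beta> + t *\<^sub>R c) x) has_vector_derivative dz (\<beta> + t *\<^sub>R c) c x) (at t)"
    unfolding zf_def dz_def by (intro has_vector_derivative_Pair 1 2) auto
qed

text \<open>Differentiating the family and its Euler-Lagrange equation in the parameter gives the
  Jacobi system. The variations are only known to be continuous, so their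
  \<open>x\<close>-derivatives are obtained by interchanging derivatives with
  \<open>mixed_partial\<close>.\<close>

lemma variation_derivs:
  assumes x: "x \<in> {a..b}" and \<beta>: "\<beta> \<in> ball 0 et"
  shows "(Phc \<beta> c has_vector_derivative Pxc \<beta> c x) (at x within {a..b})"
    "((\<lambda>x. DfP (zf \<beta> x) (dz \<beta> c x)) has_vector_derivative DfU (zf \<beta> x) (dz \<beta> c x)) (at x within {a..b})"
proof -
  obtain \<tau> where \<tau>: "\<tau> > 0" "\<And>t. \<bar>t\<bar> < \<tau> \<Longrightarrow> \<beta> + t *\<^sub>R c \<in> ball 0 et" using small_step[OF \<beta>] by metis
  let ?S = "{a..b} \<times> {-\<tau><..<\<tau>}"
  have \<tau>2: "\<beta> + t *\<^sub>R c \<in> ball 0 et" if "(x, t) \<in> ?S" for x t using \<tau>(2)[of t] that by (auto simp: abs_less_iff)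
  have cPh: "continuous_on ?S (\<lambda>s. Ph (fst s, \<beta> + snd s *\<^sub>R c))"
    by (intro continuous_on_compose2[OF C1_on_continuous[OF Ph]] continuous_intros) (use U1 \<tau>2 in auto)
  have cPx: "continuous_on ?S (\<lambda>s. Px (fst s, \<beta> + snd s *\<^sub>R c))"
    by (intro continuous_on_compose2[OF C1_on_continuous[OF Px]] continuous_intros) (use U3 \<tau>2 in auto)
  have cPhc: "continuous_on ?S (\<lambda>s. Phc (\<beta> + snd s *\<^sub>R c) c (fst s))"
    unfolding Phc_def by (intro C1_on_continuous_deriv_compose[OF Ph] continuous_intros) (use U1 \<tau>2 in auto)
  have cPxc: "continuous_on ?S (\<lambda>s. Pxc (\<beta> + snd s *\<^sub>R c) c (fst s))"
    unfolding Pxc_def by (intro C1_on_continuous_deriv_compose[OF Px] continuous_intros) (use U3 \<tau>2 in auto)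
  have "(Phc (\<beta> + 0 *\<^sub>R c) c has_vector_derivative Pxc (\<beta> + 0 *\<^sub>R c) c x) (at x within {a..b})"
  proof (rule mixed_partial[OF x \<tau>(1), where g = "\<lambda>x t. Ph (x, \<beta> + t *\<^sub>R c)" and gx = "\<lambda>x t. Px (x, \<beta> + t *\<^sub>R c)" and gxt = "\<lambda>x t. Pxc (\<beta> + t *\<^sub>R c) c x"])
    fix y assume y: "y \<in> {a..b}"
    show "((\<lambda>t. Ph (y, \<beta> + t *\<^sub>R c)) has_vector_derivative Phc (\<beta> + 0 *\<^sub>R c) c y) (at 0)"
      by (rule step_derivs(1)[OF y \<tau>(2)]) (use \<tau> in auto)
  qed (use \<tau> Ph_x step_derivs cPxc in \<open>auto simp: case_prod_unfold\<close>)
  then show "(Phc \<beta> c has_vector_derivative Pxc \<beta> c x) (at x within {a..b})" by simp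
  have zU: "zf \<gamma> y \<in> U" if "y \<in> {a..b}" for \<gamma> y using in_U[OF that] by (simp add: zf_def)
  have "((\<lambda>x. DfP (zf (\<beta> + 0 *\<^sub>R c) x) (dz (\<beta> + 0 *\<^sub>R c) c x)) has_vector_derivative
      DfU (zf (\<beta> + 0 *\<^sub>R c) x) (dz (\<beta> + 0 *\<^sub>R c) c x)) (at x within {a..b})"
  proof (rule mixed_partial[OF x \<tau>(1), where g = "\<lambda>x t. fP (zf (\<beta> + t *\<^sub>R c) x)" and gx = "\<lambda>x t. fU (zf (\<beta> + t *\<^sub>R c) x)"
        and gxt = "\<lambda>x t. DfU (zf (\<beta> + t *\<^sub>R c) x) (dz (\<beta> + t *\<^sub>R c) c x)"])
    fix y t assume y: "y \<in> {a..b}" "\<bar>t\<bar> < \<tau>"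
    show "((\<lambda>x. fP (zf (\<beta> + t *\<^sub>R c) x)) has_vector_derivative fU (zf (\<beta> + t *\<^sub>R c) y)) (at y within {a..b})"
      unfolding zf_def by (rule EL[OF y(1) \<tau>(2)[OF y(2)]])
    show "((\<lambda>t. fU (zf (\<beta> + t *\<^sub>R c) y)) has_vector_derivative DfU (zf (\<beta> + t *\<^sub>R c) y) (dz (\<beta> + t *\<^sub>R c) c y)) (at t)"
      by (rule C1_on_curve[OF fU_C1 step_derivs(3)[OF y(1) \<tau>(2)[OF y(2)]] zU[OF y(1)]])
  next
    show "continuous_on ?S (\<lambda>(x, t). DfU (zf (\<beta> + t *\<^sub>R c) x) (dz (\<beta> + t *\<^sub>R c) c x))"
      unfolding case_prod_unfold
      by (rule C1_on_continuous_deriv_compose[OF fU_C1])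
        (use zU in \<open>auto simp: zf_def dz_def intro!: continuous_intros cPh cPx cPhc cPxc\<close>)
  next
    fix y assume y: "y \<in> {a..b}"
    show "((\<lambda>t. fP (zf (\<beta> + t *\<^sub>R c) y)) has_vector_derivative DfP (zf (\<beta> + 0 *\<^sub>R c) y) (dz (\<beta> + 0 *\<^sub>R c) c y)) (at 0)"
      by (rule C1_on_curve[OF fP_C1 step_derivs(3)[OF y \<tau>(2)] zU[OF y]]) (use \<tau> in auto)
  qed
  then show "((\<lambda>x. DfP (zf \<beta> x) (dz \<beta> c x)) has_vector_derivative DfU (zf \<beta> x) (dz \<beta> c x)) (at x within {a..b})" by simp
qed

text \<open>The derivative of the bracket is an antisymmetrised Hessian of \<open>f\<close>.\<close>
lemma lagrange_bracket:
  assumes x: "x \<in> {a..b}" and \<beta>: "\<beta> \<in> ball 0 et"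
  shows "Phc \<beta> c x \<bullet> DfP (zf \<beta> x) (dz \<beta> d x) - Phc \<beta> d x \<bullet> DfP (zf \<beta> x) (dz \<beta> c x) =
     Phc \<beta> c a \<bullet> DfP (zf \<beta> a) (dz \<beta> d a) - Phc \<beta> d a \<bullet> DfP (zf \<beta> a) (dz \<beta> c a)"
proof -
  define L where "L = (\<lambda>x. Phc \<beta> c x \<bullet> DfP (zf \<beta> x) (dz \<beta> d x) - Phc \<beta> d x \<bullet> DfP (zf \<beta> x) (dz \<beta> c x))"
  have "(L has_vector_derivative 0) (at x within {a..b})" if x: "x \<in> {a..b}" for x
  proof -
    note [derivative_intros] = bounded_bilinear.has_vector_derivative[OF bounded_bilinear_inner]
    have "(L has_vector_derivative
        (Phc \<beta> c x \<bullet> DfU (zf \<beta> x) (dz \<beta> d x) + Pxc \<beta> c x \<bullet> DfP (zf \<beta> x) (dz \<beta> d x))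
      - (Phc \<beta> d x \<bullet> DfU (zf \<beta> x) (dz \<beta> c x) + Pxc \<beta> d x \<bullet> DfP (zf \<beta> x) (dz \<beta> c x))) (at x within {a..b})"
      unfolding L_def by (intro derivative_intros variation_derivs x \<beta>)
    moreover have "zf \<beta> x \<in> U" using in_U[OF x] by (simp add: zf_def)
    from hessian_sym[OF this, of "Phc \<beta> c x" "Pxc \<beta> c x" "Phc \<beta> d x" "Pxc \<beta> d x"]
    have "(Phc \<beta> c x \<bullet> DfU (zf \<beta> x) (dz \<beta> d x) + Pxc \<beta> c x \<bullet> DfP (zf \<beta> x) (dz \<beta> d x))
      - (Phc \<beta> d x \<bullet> DfU (zf \<beta> x) (dz \<beta> c x) + Pxc \<beta> d x \<bullet> DfP (zf \<beta> x) (dz \<beta> c x)) = 0"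
      by (simp add: dz_def inner_commute)
    ultimately show ?thesis by simp
  qed
  then have "(L has_derivative (\<lambda>h. 0)) (at x within {a..b})" if "x \<in> {a..b}" for x
    using that by (simp add: has_vector_derivative_def)
  then obtain k where "\<And>x. x \<in> {a..b} \<Longrightarrow> L x = k"
    using has_derivative_zero_constant[of "{a..b}" L] by auto
  then have "L x = L a" using x ab by auto
  then show ?thesis by (simp add: L_def)
qed

text \<open>\<open>pp\<close> and \<open>Al\<close> are differentiated along
  \<open>t \<mapsto> Ph (x, \<beta> + t *\<^sub>R c)\<close> and compared with their known values on
  the field. The second identity is a left inverse of
  \<open>c \<mapsto> Phc \<beta> c x\<close>.\<close>

lemma pp'_Phc:
  assumes x: "x \<in> {a..b}" and \<beta>: "\<beta> \<in> ball 0 et"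
  shows "pp' (x, Ph (x, \<beta>)) (0, Phc \<beta> c x) = DfP (zf \<beta> x) (dz \<beta> c x)" "Al' (x, Ph (x, \<beta>)) (0, Phc \<beta> c x) = c"
proof -
  obtain \<tau> where \<tau>: "\<tau> > 0" "\<And>t. \<bar>t\<bar> < \<tau> \<Longrightarrow> \<beta> + t *\<^sub>R c \<in> ball 0 et" using small_step[OF \<beta>] by metis
  have 0: "0 \<in> {-\<tau><..<\<tau>}" using \<tau> by auto
  have \<tau>2: "\<beta> + t *\<^sub>R c \<in> ball 0 et" if "t \<in> {-\<tau><..<\<tau>}" for t using \<tau>(2)[of t] that by (auto simp: abs_less_iff)
  have d: "((\<lambda>t. (x, Ph (x, \<beta> + t *\<^sub>R c))) has_vector_derivative (0, Phc (\<beta> + 0 *\<^sub>R c) c x)) (at 0)"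
    using \<beta> by (intro has_vector_derivative_Pair step_derivs x) auto
  have "((\<lambda>t. pp (x, Ph (x, \<beta> + t *\<^sub>R c))) has_vector_derivative pp' (x, Ph (x, \<beta>)) (0, Phc \<beta> c x)) (at 0)"
    using C1_on_curve[OF pp_C1 d] on_field(3)[OF x \<beta>] by simp
  then have "((\<lambda>t. fP (zf (\<beta> + t *\<^sub>R c) x)) has_vector_derivative pp' (x, Ph (x, \<beta>)) (0, Phc \<beta> c x)) (at 0)"
    by (rule has_vector_derivative_transform_within_open[OF _ open_greaterThanLessThan 0])
      (use on_field(4)[OF x \<tau>2] in \<open>simp add: zf_def\<close>)
  moreover have "((\<lambda>t. fP (zf (\<beta> + t *\<^sub>R c) x)) has_vector_derivative DfP (zf (\<beta> + 0 *\<^sub>R c) x) (dz (\<beta> + 0 *\<^sub>R c) c x)) (at 0)"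
    by (rule C1_on_curve[OF fP_C1 step_derivs(3)]) (use x \<beta> in_U in \<open>auto simp: zf_def\<close>)
  ultimately show "pp' (x, Ph (x, \<beta>)) (0, Phc \<beta> c x) = DfP (zf \<beta> x) (dz \<beta> c x)"
    using vector_derivative_unique_at by fastforce
  have "((\<lambda>t. Al (x, Ph (x, \<beta> + t *\<^sub>R c))) has_vector_derivative Al' (x, Ph (x, \<beta>)) (0, Phc \<beta> c x)) (at 0)"
    using C1_on_curve[OF Al d] U2[OF x \<beta>] by simp
  then have "((\<lambda>t. \<beta> + t *\<^sub>R c) has_vector_derivative Al' (x, Ph (x, \<beta>)) (0, Phc \<beta> c x)) (at 0)"
    by (rule has_vector_derivative_transform_within_open[OF _ open_greaterThanLessThan 0])
      (use AlPh[OF x \<tau>2] in simp)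
  moreover have "((\<lambda>t. \<beta> + t *\<^sub>R c) has_vector_derivative c) (at 0)" by (auto intro!: derivative_eq_intros)
  ultimately show "Al' (x, Ph (x, \<beta>)) (0, Phc \<beta> c x) = c" by (rule vector_derivative_unique_at)
qed

text \<open>The left inverse makes \<open>c \<mapsto> Phc \<beta> c x\<close> injective, hence
  bijective in finite dimension. Identities proved for variations therefore hold for all vertical
  vectors.\<close>

lemma Phc_surj:
  assumes x: "x \<in> {a..b}" and \<beta>: "\<beta> \<in> ball 0 et"
  obtains c where "w = Phc \<beta> c x"
proof -
  have "(x, \<beta>) \<in> U1" using U1 x \<beta> by blast
  then have "bounded_linear (Ph' (x, \<beta>))" by (rule C1_on_linear_deriv[OF Ph])
  then have "linear (\<lambda>c. Phc \<beta> c x)"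
    unfolding Phc_def by (auto intro!: linearI simp: linear_simps[symmetric])
  moreover have "inj (\<lambda>c. Phc \<beta> c x)" using pp'_Phc(2)[OF x \<beta>] by (metis injI)
  ultimately have "surj (\<lambda>c. Phc \<beta> c x)" by (rule linear_inj_imp_surj)
  then show thesis using that by (metis surjD)
qed

text \<open>Condition (S) without coordinates, attached to the extremal with parameter
  \<open>\<beta>\<close>: the derivative of the momentum at its starting point is symmetric.\<close>

definition closed_at where "closed_at \<beta> \<longleftrightarrow> (\<forall>w w'. pp' (a, Ph (a, \<beta>)) (0, w) \<bullet> w' = pp' (a, Ph (a, \<beta>)) (0, w') \<bullet> w)"

text \<open>The constant Lagrange bracket moves the symmetry from \<open>a\<close> to
  \<open>x\<close>. For the mixed identity, the Euler-Lagrange equation expresses \<open>f_u\<close>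
  as the \<open>x\<close>-derivative of \<open>pp\<close> plus its derivative along the slope, and
  symmetry cancels the latter against \<open>psi \<bullet> pp'\<close> in
  \<open>AA'\<close>.\<close>

lemma closed_form:
  assumes x: "x \<in> {a..b}" and \<beta>: "\<beta> \<in> ball 0 et" and S: "closed_at \<beta>"
  shows "pp' (x, Ph (x, \<beta>)) (0, w) \<bullet> w' = pp' (x, Ph (x, \<beta>)) (0, w') \<bullet> w"
    "AA' (x, Ph (x, \<beta>)) (0, w) = pp' (x, Ph (x, \<beta>)) (1, 0) \<bullet> w"
proof -
  have a: "a \<in> {a..b}" using ab by simp
  show sy: "pp' (x, Ph (x, \<beta>)) (0, w) \<bullet> w' = pp' (x, Ph (x, \<beta>)) (0, w') \<bullet> w" for w w'
  proof -
    obtain c d where cd: "w = Phc \<beta> c x" "w' = Phc \<beta> d x" using Phc_surj[OF x \<beta>] by metis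
    show ?thesis
      using lagrange_bracket[OF x \<beta>, of c d] S unfolding closed_at_def cd pp'_Phc(1)[OF x \<beta>]
      by (simp add: pp'_Phc(1)[OF a \<beta>, symmetric] inner_commute)
  qed
  have W: "(x, Ph (x, \<beta>)) \<in> W" by (rule on_field(3)[OF x \<beta>])
  have bl: "bounded_linear (pp' (x, Ph (x, \<beta>)))" by (rule C1_on_linear_deriv[OF pp_C1 W])
  have "fU (x, Ph (x, \<beta>), Px (x, \<beta>)) = pp' (x, Ph (x, \<beta>)) (1, 0) + pp' (x, Ph (x, \<beta>)) (0, Px (x, \<beta>))"
    using pp'_x[OF x \<beta>] linear_simps(1)[OF bl, of "(1, 0)" "(0, Px (x, \<beta>))"] by simp
  then show "AA' (x, Ph (x, \<beta>)) (0, w) = pp' (x, Ph (x, \<beta>)) (1, 0) \<bullet> w"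
    using AA'_vertical[OF W, of w] sy[of w "Px (x, \<beta>)"]
    by (simp add: on_field[OF x \<beta>] inner_add_right inner_commute)
qed

end

lemma has_vector_derivative_vec:
  fixes u :: "real \<Rightarrow> real^'n"
  assumes "\<And>i. ((\<lambda>y. u y $ i) has_real_derivative u' $ i) (at x within S)"
  shows "(u has_vector_derivative u') (at x within S)"
proof -
  have "((\<lambda>y. u y $ i) has_derivative (\<lambda>t. t * u' $ i)) (at x within S)" for i
    using assms[of i] unfolding has_field_derivative_def
    by (rule has_derivative_eq_rhs) (simp add: fun_eq_iff mult.commute)
  then show ?thesis
    unfolding has_vector_derivative_def has_derivative_componentwise_within[of u]
    by (auto simp: Basis_vec_def inner_axis)
qed

lemma vderiv_eq:
  assumes "a < b" "x \<in> {a..b}" "(u has_vector_derivative u') (at x within {a..b})"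
  shows "vderiv a b u x = u'"
  unfolding vderiv_def using vector_derivative_within_cbox[of a b x u u'] assms by simp

lemma Ck_vec_has_vderiv:
  fixes u :: "real \<Rightarrow> real^'n"
  assumes ab: "a < b" and u: "Ck_vec k {a..b} u" "k \<ge> 1"
  shows "\<And>x. x \<in> {a..b} \<Longrightarrow> (u has_vector_derivative vderiv a b u x) (at x within {a..b})"
    "continuous_on {a..b} (vderiv a b u)"
proof -
  obtain V h h' where h: "{a..b} \<subseteq> V" "C1_on V h h'" "\<And>x. x \<in> {a..b} \<Longrightarrow> h x = u x"
    using Ck_vec_1_C1_on[OF u] by metis
  have d: "(u has_vector_derivative h' x 1) (at x within {a..b})" if x: "x \<in> {a..b}" for x
  proof -
    have "((\<lambda>t. h t) has_vector_derivative h' x 1) (at x within {a..b})"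
      using x h(1) by (intro C1_on_curve[OF h(2)]) (auto intro!: derivative_eq_intros)
    from has_vector_derivative_transform[of x "{a..b}" u h, OF x h(3)[symmetric] this] show ?thesis .
  qed
  have v: "vderiv a b u x = h' x 1" if "x \<in> {a..b}" for x by (rule vderiv_eq[OF ab that d[OF that]])
  show "\<And>x. x \<in> {a..b} \<Longrightarrow> (u has_vector_derivative vderiv a b u x) (at x within {a..b})" using d v by simp
  have "continuous_on {a..b} (\<lambda>x. h' x 1)"
    by (rule C1_on_continuous_deriv_compose[OF h(2)]) (use h(1) in \<open>auto intro!: continuous_intros\<close>)
  then show "continuous_on {a..b} (vderiv a b u)" by (rule continuous_on_eq) (simp add: v)
qed

section \<open>Hilbert's integral along the linear deformation\<close>

context extremal_field begin

text \<open>Let \<open>B s x\<close> be \<open>pp \<bullet> w\<close> on the deformed curve. By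
  closedness the \<open>s\<close>-derivative of Hilbert's integrand is the
  \<open>x\<close>-derivative of \<open>B s\<close>, so the integral changes with \<open>s\<close>
  at the rate \<open>B s b - B s a\<close>. The mean value theorem yields one common
  \<open>s\<close> for both end points.\<close>

lemma hilbert_invariant_integral:
  assumes u0: "\<And>x. x \<in> {a..b} \<Longrightarrow> (u0 has_vector_derivative u0' x) (at x within {a..b})" "continuous_on {a..b} u0'"
    and v: "\<And>x. x \<in> {a..b} \<Longrightarrow> (v has_vector_derivative v' x) (at x within {a..b})" "continuous_on {a..b} v'"
    and H: "\<And>x s. x \<in> {a..b} \<Longrightarrow> s \<in> {0..1} \<Longrightarrow>
      \<exists>\<beta>\<in>ball 0 et. closed_at \<beta> \<and> u0 x + s *\<^sub>R (v x - u0 x) = Ph (x, \<beta>)"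
  obtains s where "0 < s" "s < 1"
    "integral {a..b} (\<lambda>x. AA (x, v x) + v' x \<bullet> pp (x, v x)) - integral {a..b} (\<lambda>x. AA (x, u0 x) + u0' x \<bullet> pp (x, u0 x))
     = pp (b, u0 b + s *\<^sub>R (v b - u0 b)) \<bullet> (v b - u0 b) - pp (a, u0 a + s *\<^sub>R (v a - u0 a)) \<bullet> (v a - u0 a)"
proof -
  define w where "w = (\<lambda>x. v x - u0 x)"
  define w' where "w' = (\<lambda>x. v' x - u0' x)"
  define H where "H = (\<lambda>s x. u0 x + s *\<^sub>R w x)"
  define H' where "H' = (\<lambda>s x. u0' x + s *\<^sub>R w' x)"
  define g where "g = (\<lambda>s x. AA (x, H s x) + H' s x \<bullet> pp (x, H s x))"
  define g' where "g' = (\<lambda>s x. AA' (x, H s x) (0, w x) + (H' s x \<bullet> pp' (x, H s x) (0, w x) + w' x \<bullet> pp (x, H s x)))"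
  define B where "B = (\<lambda>s x. pp (x, H s x) \<bullet> w x)"
  have HW: "(x, H s x) \<in> W" if "x \<in> {a..b}" "s \<in> {0..1}" for x s
    using assms(5)[OF that] on_field(3)[OF that(1)] by (auto simp: H_def w_def)
  have cu: "continuous_on {a..b} u0" "continuous_on {a..b} v"
    by (rule has_vector_derivative_imp_continuous_on, fact)+
  have cw: "continuous_on {a..b} w" "continuous_on {a..b} w'"
    unfolding w_def w'_def by (rule continuous_on_diff[OF cu(2,1)] continuous_on_diff[OF v(2) u0(2)])+
  let ?S = "{0..1} \<times> {a..b}"
  have c2: "continuous_on ?S (\<lambda>t. q (snd t))" if "continuous_on {a..b} q" for q :: "real \<Rightarrow> real^'n"
    by (rule continuous_on_compose2[OF that]) (auto intro!: continuous_intros)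
  have cH: "continuous_on ?S (\<lambda>t. H (fst t) (snd t))" "continuous_on ?S (\<lambda>t. H' (fst t) (snd t))"
    unfolding H_def H'_def by (intro continuous_intros c2 cw cu u0)+
  have cpair: "continuous_on ?S (\<lambda>t. (snd t, H (fst t) (snd t)))" by (intro continuous_intros cH)
  have inW: "(snd t, H (fst t) (snd t)) \<in> W" if "t \<in> ?S" for t using HW that by auto
  have cg: "continuous_on ?S (\<lambda>t. g (fst t) (snd t))"
    unfolding g_def using inW
    by (intro continuous_intros cH continuous_on_compose2[OF C1_on_continuous[OF AA_C1] cpair] continuous_on_compose2[OF C1_on_continuous[OF pp_C1] cpair]) auto
  have cg': "continuous_on ?S (\<lambda>t. g' (fst t) (snd t))"
    unfolding g'_def using inW
    by (intro continuous_intros cH c2 cw C1_on_continuous_deriv_compose[OF AA_C1 cpair] C1_on_continuous_deriv_compose[OF pp_C1 cpair]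
        continuous_on_compose2[OF C1_on_continuous[OF pp_C1] cpair]) auto
  have dH_x: "(H s has_vector_derivative H' s x) (at x within {a..b})" if "x \<in> {a..b}" for s x
    unfolding H_def H'_def w_def w'_def
    using u0(1)[OF that] v(1)[OF that] by (auto intro!: derivative_eq_intros)
  have dw: "(w has_vector_derivative w' x) (at x within {a..b})" if "x \<in> {a..b}" for x
    unfolding w_def w'_def using u0(1)[OF that] v(1)[OF that] by (auto intro!: derivative_eq_intros)
  have dg: "((\<lambda>s. g s x) has_vector_derivative g' s x) (at s within {0..1})" if "x \<in> {a..b}" "s \<in> {0..1}" for x s
  proof -
    have 1: "((\<lambda>s. (x, H s x)) has_vector_derivative (0, w x)) (at s within {0..1})"
      unfolding H_def by (intro has_vector_derivative_Pair) (auto intro!: derivative_eq_intros)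
    have 2: "((\<lambda>s. H' s x) has_vector_derivative w' x) (at s within {0..1})"
      unfolding H'_def by (auto intro!: derivative_eq_intros)
    show ?thesis unfolding g_def g'_def
      by (intro has_vector_derivative_add C1_on_curve[OF AA_C1 1] bounded_bilinear.has_vector_derivative[OF bounded_bilinear_inner]
          C1_on_curve[OF pp_C1 1] 2 HW that)
  qed
  \<comment> \<open>Both halves of \<open>closed_form\<close> enter here: together they turn the
    \<open>x\<close>-derivative of \<open>B s\<close> into the \<open>s\<close>-derivative
    \<open>g'\<close> of the integrand.\<close>
  have dB: "(B s has_vector_derivative g' s x) (at x within {a..b})" if x: "x \<in> {a..b}" and s: "s \<in> {0..1}" for x s
  proof -
    obtain \<beta> where \<beta>: "\<beta> \<in> ball 0 et" "closed_at \<beta>" "H s x = Ph (x, \<beta>)"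
      using assms(5)[OF x s] by (auto simp: H_def w_def)
    have 1: "((\<lambda>x. (x, H s x)) has_vector_derivative (1, H' s x)) (at x within {a..b})"
      by (intro has_vector_derivative_Pair dH_x x) (auto intro!: derivative_eq_intros)
    have "(B s has_vector_derivative pp (x, H s x) \<bullet> w' x + pp' (x, H s x) (1, H' s x) \<bullet> w x) (at x within {a..b})"
      unfolding B_def
      by (intro bounded_bilinear.has_vector_derivative[OF bounded_bilinear_inner] C1_on_curve[OF pp_C1 1] dw HW x s)
    moreover have "pp' (x, H s x) (1, H' s x) = pp' (x, H s x) (1, 0) + pp' (x, H s x) (0, H' s x)"
      using linear_simps(1)[OF C1_on_linear_deriv[OF pp_C1 HW[OF x s]], of "(1, 0)" "(0, H' s x)"] by simp
    moreover have "AA' (x, H s x) (0, w x) = pp' (x, H s x) (1, 0) \<bullet> w x"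
      "pp' (x, H s x) (0, H' s x) \<bullet> w x = H' s x \<bullet> pp' (x, H s x) (0, w x)"
      using closed_form[OF x \<beta>(1,2)] by (simp_all add: \<beta>(3) inner_commute)
    ultimately show ?thesis by (simp add: g'_def inner_add_right inner_commute add_ac)
  qed
  have int: "integral {a..b} (g' s) = B s b - B s a" if "s \<in> {0..1}" for s
    using fundamental_theorem_of_calculus[of a b "B s" "g' s"] dB that ab by (intro integral_unique) auto
  have slice: "continuous_on {a..b} (g s)" if "s \<in> {0..1}" for s
  proof -
    have "continuous_on {a..b} (\<lambda>x. g (fst (s, x)) (snd (s, x)))"
      by (rule continuous_on_compose2[OF cg]) (use that in \<open>auto intro!: continuous_intros\<close>)
    then show ?thesis by simp
  qed
  have leib: "((\<lambda>s. integral (cbox a b) (g s)) has_vector_derivative integral (cbox a b) (g' s)) (at s within {0..1})"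
    if "s \<in> {0..1}" for s
    by (rule leibniz_rule_vector_derivative)
      (use dg cg' slice that in \<open>auto intro!: integrable_continuous_real simp: case_prod_unfold\<close>)
  have "((\<lambda>s. integral {a..b} (g s)) has_derivative (\<lambda>h. h *\<^sub>R (B s b - B s a))) (at s within {0..1})"
    if "s \<in> {0..1}" for s
    using leib[OF that] int[OF that] by (simp add: has_vector_derivative_def)
  from mvt_simple[OF _ this] obtain s where s: "s \<in> {0<..<1::real}"
    "integral {a..b} (g 1) - integral {a..b} (g 0) = B s b - B s a" by auto
  have "g 1 = (\<lambda>x. AA (x, v x) + v' x \<bullet> pp (x, v x))" "g 0 = (\<lambda>x. AA (x, u0 x) + u0' x \<bullet> pp (x, u0 x))"
    by (auto simp: g_def H_def H'_def w_def w'_def)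
  then show thesis using s by (intro that[of s]) (auto simp: B_def H_def w_def)
qed

end

section \<open>Comparison of values of the functional by means of a field\<close>

locale extremal_field_for = extremal_field f a b U F DF D2F et U1 Ph Ph' U2 Al Al' U3 Px Px'
  for f :: "real \<Rightarrow> real^'n \<Rightarrow> real^'n \<Rightarrow> real" and a b U F DF D2F et U1 Ph Ph' U2 Al Al' U3 Px Px' +
  fixes u0 :: "real \<Rightarrow> real^'n" and \<phi>
  assumes Ph_\<phi>: "\<And>x \<beta>. x \<in> {a..b} \<Longrightarrow> \<beta> \<in> ball 0 et \<Longrightarrow> Ph (x, \<beta>) = \<phi> x \<beta>"
    and \<phi>0: "\<And>x. x \<in> {a..b} \<Longrightarrow> \<phi> x 0 = u0 x"
    and \<phi>_C1: "\<And>\<beta>. \<beta> \<in> ball 0 et \<Longrightarrow> Ck_vec 1 {a..b} (\<lambda>x. \<phi> x \<beta>)"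
begin

abbreviation "slope \<equiv> field_slope a b et \<phi>"

lemma zero_in: "0 \<in> ball 0 et" using et by simp

lemma FS_eq: "FS = field_set a b et \<phi>"
  unfolding FS_def field_set_def by (rule image_cong) (auto simp: Ph_\<phi>)

lemma u0_Ph: "x \<in> {a..b} \<Longrightarrow> u0 x = Ph (x, 0)" using Ph_\<phi> \<phi>0 zero_in by simp

lemma \<phi>_x: "x \<in> {a..b} \<Longrightarrow> \<beta> \<in> ball 0 et \<Longrightarrow> ((\<lambda>y. \<phi> y \<beta>) has_vector_derivative Px (x, \<beta>)) (at x within {a..b})"
  by (rule has_vector_derivative_transform[OF _ Ph_\<phi>[symmetric] Ph_x]) auto

lemma vderiv_\<phi>: "x \<in> {a..b} \<Longrightarrow> \<beta> \<in> ball 0 et \<Longrightarrow> vderiv a b (\<lambda>y. \<phi> y \<beta>) x = Px (x, \<beta>)"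
  using vderiv_eq[OF ab _ \<phi>_x] by blast

lemma u0_x: "x \<in> {a..b} \<Longrightarrow> (u0 has_vector_derivative Px (x, 0)) (at x within {a..b})"
  by (rule has_vector_derivative_transform[OF _ \<phi>0[symmetric] \<phi>_x]) (use zero_in in auto)

lemma vderiv_u0: "x \<in> {a..b} \<Longrightarrow> vderiv a b u0 x = Px (x, 0)"
  using vderiv_eq[OF ab _ u0_x] by blast

lemma slope_\<phi>: "x \<in> {a..b} \<Longrightarrow> \<beta> \<in> ball 0 et \<Longrightarrow> slope x (\<phi> x \<beta>) = Px (x, \<beta>)"
proof -
  assume x: "x \<in> {a..b}" and \<beta>: "\<beta> \<in> ball 0 et"
  have "(THE \<alpha>. \<alpha> \<in> ball 0 et \<and> \<phi> x \<alpha> = \<phi> x \<beta>) = \<beta>"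
    using \<beta> AlPh[OF x] Ph_\<phi>[OF x] by (intro the_equality) metis+
  then show ?thesis by (simp add: field_slope_def vderiv_\<phi>[OF x \<beta>])
qed

lemma slope_psi: "(x, v) \<in> FS \<Longrightarrow> slope x v = psi (x, v)"
  using on_field(1) slope_\<phi> Ph_\<phi> by (metis FS_E)

lemma fp_pp: "(x, v) \<in> FS \<Longrightarrow> fp f x v (slope x v) = pp (x, v)"
  by (frule slope_psi) (auto elim: FS_E simp: fp_eq pp_def zz_def)

lemma Px_cont: "continuous_on {a..b} (\<lambda>x. Px (x, 0))"
  by (rule continuous_on_compose2[OF C1_on_continuous[OF Px]]) (use U3 zero_in in \<open>auto intro!: continuous_intros\<close>)

lemma u0_cont: "continuous_on {a..b} u0"
  by (rule has_vector_derivative_imp_continuous_on[OF u0_x])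

text \<open>\<open>cond_S\<close> differentiates \<open>f_p\<close> at \<open>slope\<close>, which
  is identified with \<open>pp\<close> only on the field; the field is relatively open over
  \<open>a\<close>, so the two agree near \<open>v\<close> and have the same derivatives. Symmetry
  of the matrix then passes to the bilinear form.\<close>

lemma cond_S_closed_at:
  assumes S: "cond_S f a b u0 et \<phi> Wset" and \<beta>: "\<beta> \<in> ball 0 et" "Ph (a, \<beta>) - u0 a \<in> Wset"
  shows "closed_at \<beta>"
proof -
  define v where "v = Ph (a, \<beta>)"
  have a: "a \<in> {a..b}" using ab by simp
  have vFS: "(a, v) \<in> FS" unfolding v_def by (rule FS_I[OF a \<beta>(1)])
  obtain N where N: "open N" "\<And>x v. x \<in> {a..b} \<Longrightarrow> (x, v) \<in> N \<longleftrightarrow> (x, v) \<in> FS" using FS_rel_open by blast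
  have pd: "pdir (\<lambda>w. fp f a w (slope a w) $ i) e v = pp' (a, v) (0, e) $ i" for i e
  proof -
    have "((\<lambda>t. (a, v + t *\<^sub>R e)) has_vector_derivative (0, e)) (at 0)"
      by (intro has_vector_derivative_Pair) (auto intro!: derivative_eq_intros)
    from C1_on_curve[OF C1_on_nth[OF pp_C1, of i] this] vFS FS_W
    have d: "((\<lambda>t. pp (a, v + t *\<^sub>R e) $ i) has_real_derivative pp' (a, v) (0, e) $ i) (at 0)"
      by (auto simp: has_real_derivative_iff_has_vector_derivative)
    have "open ((\<lambda>t. (a, v + t *\<^sub>R e)) -` N)"
      by (intro open_vimage N continuous_intros)
    moreover have "0 \<in> (\<lambda>t. (a, v + t *\<^sub>R e)) -` N" using N(2)[OF a, of v] vFS by simp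
    ultimately have "\<forall>\<^sub>F t in nhds 0. t \<in> (\<lambda>t. (a, v + t *\<^sub>R e)) -` N" by (rule eventually_nhds_in_open)
    then have "\<forall>\<^sub>F t in nhds 0. fp f a (v + t *\<^sub>R e) (slope a (v + t *\<^sub>R e)) $ i = pp (a, v + t *\<^sub>R e) $ i"
      by eventually_elim (use N(2)[OF a] fp_pp in auto)
    from deriv_cong_ev[OF this refl] show ?thesis
      unfolding pdir_def using DERIV_imp_deriv[OF d] by simp
  qed
  have sy: "pp' (a, v) (0, axis j 1) $ i = pp' (a, v) (0, axis i 1) $ j" for i j
    using S[unfolded cond_S_def, rule_format, of v i j] vFS \<beta>(2) unfolding FS_eq pd by (simp add: v_def)
  have bl: "bounded_linear (pp' (a, v))" using C1_on_linear_deriv[OF pp_C1] vFS FS_W by blast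
  have l: "linear (\<lambda>w. pp' (a, v) (0, w))"
    using linear_simps(1)[OF bl, of "(0, _)" "(0, _)"] linear_simps(5)[OF bl, of _ "(0, _)"] by (intro linearI) auto
  have ex: "pp' (a, v) (0, w) \<bullet> w' = (\<Sum>i\<in>UNIV. \<Sum>j\<in>UNIV. w $ j * w' $ i * pp' (a, v) (0, axis j 1) $ i)" for w w'
  proof -
    have "pp' (a, v) (0, w) = (\<Sum>j\<in>UNIV. w $ j *\<^sub>R pp' (a, v) (0, axis j 1))"
      by (subst vec_expand[of w]) (simp only: linear_sum[OF l] linear_scale[OF l])
    then show ?thesis by (simp add: inner_vec_def sum_distrib_left sum_distrib_right mult_ac)
  qed
  show ?thesis
    unfolding closed_at_def v_def[symmetric]
  proof (intro allI)
    fix w w'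
    have "pp' (a, v) (0, w) \<bullet> w' = (\<Sum>j\<in>UNIV. \<Sum>i\<in>UNIV. w $ j * w' $ i * pp' (a, v) (0, axis j 1) $ i)"
      unfolding ex by (rule sum.swap)
    also have "\<dots> = pp' (a, v) (0, w') \<bullet> w"
      unfolding ex by (intro sum.cong refl) (simp add: sy[of _ _] mult_ac)
    finally show "pp' (a, v) (0, w) \<bullet> w' = pp' (a, v) (0, w') \<bullet> w" .
  qed
qed

text \<open>The part of the field on which closedness is available: points whose extremal starts in
  \<open>u0 a + Wset\<close>. \<open>Wset\<close> is a ball for the local statements and
  \<open>UNIV\<close> for the global one.\<close>

definition GS where "GS Wset = {(x, v) \<in> FS. Ph (a, Al (x, v)) - u0 a \<in> Wset}"

lemma GS_rel_open:
  assumes "open Wset"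
  obtains N where "open N" "\<And>x v. x \<in> {a..b} \<Longrightarrow> (x, v) \<in> N \<longleftrightarrow> (x, v) \<in> GS Wset"
proof -
  obtain N where N: "open N" "\<And>x v. x \<in> {a..b} \<Longrightarrow> (x, v) \<in> N \<longleftrightarrow> (x, v) \<in> FS" using FS_rel_open by blast
  have "C1_on U2 (\<lambda>z. (a, Al z)) (\<lambda>z h. (0, Al' z h))"
    using C1_on_open[OF Al] by (intro C1_on_Pair C1_on_const Al)
  from C1_on_compose_vimage[OF this Ph]
  have C: "C1_on {z \<in> U2. (a, Al z) \<in> U1} (\<lambda>z. Ph (a, Al z)) (\<lambda>z h. Ph' (a, Al z) (0, Al' z h))" .
  have "open ((\<lambda>y. y - u0 a) -` Wset)" by (intro open_vimage assms continuous_intros)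
  from open_vimage_C1_on[OF C this]
  have o: "open (N \<inter> {z \<in> {z \<in> U2. (a, Al z) \<in> U1}. Ph (a, Al z) \<in> (\<lambda>y. y - u0 a) -` Wset})" by (intro open_Int N)
  have a: "a \<in> {a..b}" using ab by simp
  have "(x, v) \<in> U2 \<and> (a, Al (x, v)) \<in> U1" if "(x, v) \<in> FS" for x v
    using that FS_W U1 a by (elim FS_E) (auto simp: W_def W0_def intro!: U2)
  then show thesis using N(2) by (intro that[OF o]) (auto simp: GS_def)
qed

lemma GS_u0: "0 \<in> Wset \<Longrightarrow> x \<in> {a..b} \<Longrightarrow> (x, u0 x) \<in> GS Wset"
  using FS_I[OF _ zero_in] AlPh[OF _ zero_in] ab by (auto simp: GS_def u0_Ph)

lemma GS_tube:
  assumes "open Wset" "0 \<in> Wset"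
  obtains r where "r > 0" "\<And>x v. x \<in> {a..b} \<Longrightarrow> dist v (u0 x) \<le> r \<Longrightarrow> (x, v) \<in> GS Wset"
proof -
  obtain N where N: "open N" "\<And>x v. x \<in> {a..b} \<Longrightarrow> (x, v) \<in> N \<longleftrightarrow> (x, v) \<in> GS Wset" using GS_rel_open[OF assms(1)] by blast
  obtain r where "r > 0" "\<And>x v. x \<in> {a..b} \<Longrightarrow> dist v (u0 x) \<le> r \<Longrightarrow> (x, v) \<in> N"
    using tube_in_open[OF N(1) u0_cont] N(2) GS_u0[OF assms(2)] by metis
  then show thesis using N(2) by (intro that) auto
qed

text \<open>Hilbert's integrand is \<open>f\<close> minus the excess along \<open>v\<close> and
  \<open>f\<close> itself along \<open>u0\<close>. No sign condition enters, so the formula serves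
  both the sufficient criteria and the failure of minimality.\<close>

lemma weierstrass_identity:
  assumes S: "cond_S f a b u0 et \<phi> Wset" and v: "Ck_vec 1 {a..b} v"
    and H: "\<And>x s. x \<in> {a..b} \<Longrightarrow> s \<in> {0..1} \<Longrightarrow> (x, u0 x + s *\<^sub>R (v x - u0 x)) \<in> GS Wset"
  obtains s va vb where "0 < s" "s < 1" "va = u0 a + s *\<^sub>R (v a - u0 a)" "vb = u0 b + s *\<^sub>R (v b - u0 b)"
    "(\<lambda>x. excess f x (v x) (slope x (v x)) (vderiv a b v x)) integrable_on {a..b}"
    "Phi f a b v = Phi f a b u0 + integral {a..b} (\<lambda>x. excess f x (v x) (slope x (v x)) (vderiv a b v x))
      + fp f b vb (slope b vb) \<bullet> (v b - u0 b) - fp f a va (slope a va) \<bullet> (v a - u0 a)"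
proof -
  note v' = Ck_vec_has_vderiv[OF ab v order_refl]
  have Hb: "\<exists>\<beta>\<in>ball 0 et. closed_at \<beta> \<and> u0 x + s *\<^sub>R (v x - u0 x) = Ph (x, \<beta>)"
    if "x \<in> {a..b}" "s \<in> {0..1}" for x s
  proof -
    have "(x, u0 x + s *\<^sub>R (v x - u0 x)) \<in> FS" and w: "Ph (a, Al (x, u0 x + s *\<^sub>R (v x - u0 x))) - u0 a \<in> Wset"
      using H[OF that] by (auto simp: GS_def)
    from this(1) obtain \<beta> where "\<beta> \<in> ball 0 et" "u0 x + s *\<^sub>R (v x - u0 x) = Ph (x, \<beta>)" "Al (x, u0 x + s *\<^sub>R (v x - u0 x)) = \<beta>"
      by (rule FS_E)
    then show ?thesis using cond_S_closed_at[OF S, of \<beta>] w by metis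
  qed
  have HF: "(x, u0 x + s *\<^sub>R (v x - u0 x)) \<in> FS" if "x \<in> {a..b}" "s \<in> {0..1}" for x s
    using H[OF that] by (simp add: GS_def)
  have vFS: "(x, v x) \<in> FS" "(x, u0 x) \<in> FS" if "x \<in> {a..b}" for x using HF[OF that, of 1] HF[OF that, of 0] by auto
  obtain s where s: "0 < s" "s < 1"
    "integral {a..b} (\<lambda>x. AA (x, v x) + vderiv a b v x \<bullet> pp (x, v x)) - integral {a..b} (\<lambda>x. AA (x, u0 x) + Px (x, 0) \<bullet> pp (x, u0 x))
     = pp (b, u0 b + s *\<^sub>R (v b - u0 b)) \<bullet> (v b - u0 b) - pp (a, u0 a + s *\<^sub>R (v a - u0 a)) \<bullet> (v a - u0 a)"
    using hilbert_invariant_integral[OF u0_x Px_cont v' Hb] by blast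
  have e0: "AA (x, u0 x) + Px (x, 0) \<bullet> pp (x, u0 x) = f x (u0 x) (vderiv a b u0 x)" if "x \<in> {a..b}" for x
    using that on_field[OF that zero_in] vderiv_u0[OF that] by (simp add: AA_def u0_Ph Ff)
  have e1: "excess f x (v x) (slope x (v x)) (vderiv a b v x) =
      f x (v x) (vderiv a b v x) - (AA (x, v x) + vderiv a b v x \<bullet> pp (x, v x))" if x: "x \<in> {a..b}" for x
    using x slope_psi[OF vFS(1)[OF x]]
    by (simp add: excess_def AA_def pp_def zz_def Ff fp_eq inner_diff_left)
  have cv: "continuous_on {a..b} v" by (rule has_vector_derivative_imp_continuous_on[OF v'(1)])
  have "continuous_on {a..b} (\<lambda>x. F (x, v x, vderiv a b v x))"
    by (intro continuous_on_compose2[OF C1_on_continuous[OF F]] continuous_intros cv v'(2)) (use in_U in auto)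
  then have "continuous_on {a..b} (\<lambda>x. f x (v x) (vderiv a b v x))"
    by (rule continuous_on_eq) (simp add: Ff)
  then have i1: "(\<lambda>x. f x (v x) (vderiv a b v x)) integrable_on {a..b}"
    by (rule integrable_continuous_real)
  have i2: "(\<lambda>x. AA (x, v x) + vderiv a b v x \<bullet> pp (x, v x)) integrable_on {a..b}"
    using vFS(1) FS_W
    by (intro integrable_continuous_real continuous_intros continuous_on_compose2[OF C1_on_continuous[OF AA_C1]]
        continuous_on_compose2[OF C1_on_continuous[OF pp_C1]] cv v'(2)) auto
  have i3: "(\<lambda>x. excess f x (v x) (slope x (v x)) (vderiv a b v x)) integrable_on {a..b}"
    using integrable_diff[OF i1 i2] by (rule integrable_eq) (simp add: e1)
  have "integral {a..b} (\<lambda>x. excess f x (v x) (slope x (v x)) (vderiv a b v x)) =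
     Phi f a b v - integral {a..b} (\<lambda>x. AA (x, v x) + vderiv a b v x \<bullet> pp (x, v x))"
    unfolding Phi_def integral_diff[OF i1 i2, symmetric] by (rule integral_cong) (rule e1)
  moreover have "integral {a..b} (\<lambda>x. AA (x, u0 x) + Px (x, 0) \<bullet> pp (x, u0 x)) = Phi f a b u0"
    unfolding Phi_def by (rule integral_cong) (rule e0)
  moreover have "fp f b (u0 b + s *\<^sub>R (v b - u0 b)) (slope b (u0 b + s *\<^sub>R (v b - u0 b))) = pp (b, u0 b + s *\<^sub>R (v b - u0 b))"
    "fp f a (u0 a + s *\<^sub>R (v a - u0 a)) (slope a (u0 a + s *\<^sub>R (v a - u0 a))) = pp (a, u0 a + s *\<^sub>R (v a - u0 a))"
    using s ab by (auto intro!: fp_pp HF)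
  ultimately show thesis using s i3 by (intro that[of s]) auto
qed

text \<open>The boundary terms pair the momentum at an intermediate point with the full difference
  \<open>v - u0\<close>, while (Fa) and (Fb) pair it with \<open>s\<close> times that difference;
  since \<open>s > 0\<close>, the signs are the same.\<close>

lemma field_comparison:
  assumes W: "open Wset" "0 \<in> Wset" and S: "cond_S f a b u0 et \<phi> Wset"
    and Fa: "cond_Fa f a b IDa u0 et \<phi> Wset" and Fb: "cond_Fb f a b IDb u0 et \<phi> Wset"
    and v: "admissible a b IDa IDb u0 v"
    and H: "\<And>x s. x \<in> {a..b} \<Longrightarrow> s \<in> {0..1} \<Longrightarrow> (x, u0 x + s *\<^sub>R (v x - u0 x)) \<in> GS Wset"
    and HW: "\<And>x s. x \<in> {a..b} \<Longrightarrow> s \<in> {0..1} \<Longrightarrow> s *\<^sub>R (v x - u0 x) \<in> Wset"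
    and E: "\<And>x. x \<in> {a..b} \<Longrightarrow> excess f x (v x) (slope x (v x)) (vderiv a b v x) \<ge> 0"
  shows "Phi f a b v \<ge> Phi f a b u0"
proof -
  have vC: "Ck_vec 1 {a..b} v" using v by (simp add: admissible_def)
  obtain s va vb where s: "0 < s" "s < 1" "va = u0 a + s *\<^sub>R (v a - u0 a)" "vb = u0 b + s *\<^sub>R (v b - u0 b)"
    and i: "(\<lambda>x. excess f x (v x) (slope x (v x)) (vderiv a b v x)) integrable_on {a..b}"
    and eq: "Phi f a b v = Phi f a b u0 + integral {a..b} (\<lambda>x. excess f x (v x) (slope x (v x)) (vderiv a b v x))
      + fp f b vb (slope b vb) \<bullet> (v b - u0 b) - fp f a va (slope a va) \<bullet> (v a - u0 a)"
    using weierstrass_identity[OF S vC H] by blast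
  have FSab: "(a, va) \<in> FS" "(b, vb) \<in> FS" using H[of a s] H[of b s] s ab by (auto simp: GS_def)
  have RD: "va - u0 a \<in> RD IDa" "vb - u0 b \<in> RD IDb" using v by (auto simp: RD_def admissible_def s)
  have "fp f a va (slope a va) \<bullet> (va - u0 a) \<le> 0"
    using Fa RD(1) FSab(1) HW[of a s] s ab unfolding cond_Fa_def FS_eq by (metis IntI add_diff_cancel_left' atLeastAtMost_iff less_imp_le order_refl)
  then have 1: "fp f a va (slope a va) \<bullet> (v a - u0 a) \<le> 0"
    using s by (simp add: mult_le_0_iff)
  have "fp f b vb (slope b vb) \<bullet> (vb - u0 b) \<ge> 0"
    using Fb RD(2) FSab(2) HW[of b s] s ab unfolding cond_Fb_def FS_eq by (metis IntI add_diff_cancel_left' atLeastAtMost_iff less_imp_le order_refl)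
  then have 2: "fp f b vb (slope b vb) \<bullet> (v b - u0 b) \<ge> 0"
    using s by (simp add: zero_le_mult_iff)
  have "integral {a..b} (\<lambda>x. excess f x (v x) (slope x (v x)) (vderiv a b v x)) \<ge> 0"
    by (rule integral_nonneg[OF i E])
  with 1 2 eq show ?thesis by linarith
qed

lemma Cnorm_bound:
  assumes "continuous_on {a..b} w" "x \<in> {a..b}" shows "norm (w x) \<le> Cnorm a b w"
proof -
  have "bdd_above ((\<lambda>x. norm (w x)) ` {a..b})"
    by (intro bounded_imp_bdd_above compact_imp_bounded compact_continuous_image continuous_intros assms) auto
  then show ?thesis unfolding Cnorm_def using assms(2) by (rule cSUP_upper2) auto
qed

lemma local_field_comparison:
  assumes e: "\<epsilon> > 0" and S: "cond_S f a b u0 et \<phi> (ball 0 \<epsilon>)"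
    and Fa: "cond_Fa f a b IDa u0 et \<phi> (ball 0 \<epsilon>)" and Fb: "cond_Fb f a b IDb u0 et \<phi> (ball 0 \<epsilon>)"
  obtains r where "r > 0" "\<And>x v. x \<in> {a..b} \<Longrightarrow> dist v (u0 x) < r \<Longrightarrow> (x, v) \<in> FS"
    "\<And>v. admissible a b IDa IDb u0 v \<Longrightarrow> (\<And>x. x \<in> {a..b} \<Longrightarrow> dist (v x) (u0 x) < r) \<Longrightarrow>
      (\<And>x. x \<in> {a..b} \<Longrightarrow> excess f x (v x) (slope x (v x)) (vderiv a b v x) \<ge> 0) \<Longrightarrow> Phi f a b v \<ge> Phi f a b u0"
proof -
  obtain r where r: "r > 0" "\<And>x v. x \<in> {a..b} \<Longrightarrow> dist v (u0 x) \<le> r \<Longrightarrow> (x, v) \<in> GS (ball 0 \<epsilon>)"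
    using GS_tube[of "ball 0 \<epsilon>"] e by auto
  \<comment> \<open>\<open>r\<close> keeps the deformation in the region where closedness holds,
    \<open>\<epsilon>\<close> keeps its end points where (Fa) and (Fb) are assumed.\<close>
  show thesis
  proof (rule that[of "min r \<epsilon>"])
    show "(x, v) \<in> FS" if "x \<in> {a..b}" "dist v (u0 x) < min r \<epsilon>" for x v
      using r(2)[OF that(1), of v] that by (simp add: GS_def)
    fix v assume v: "admissible a b IDa IDb u0 v" and vr: "\<And>x. x \<in> {a..b} \<Longrightarrow> dist (v x) (u0 x) < min r \<epsilon>"
      and E: "\<And>x. x \<in> {a..b} \<Longrightarrow> excess f x (v x) (slope x (v x)) (vderiv a b v x) \<ge> 0"
    have sc: "norm (s *\<^sub>R (v x - u0 x)) < min r \<epsilon>" if "x \<in> {a..b}" "s \<in> {0..1}" for x s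
    proof -
      have "norm (s *\<^sub>R (v x - u0 x)) \<le> 1 * norm (v x - u0 x)"
        using that by (simp only: norm_scaleR) (intro mult_right_mono, auto)
      then show ?thesis using vr[OF that(1)] by (simp add: dist_norm)
    qed
    show "Phi f a b v \<ge> Phi f a b u0"
    proof (rule field_comparison[OF _ _ S Fa Fb v _ _ E])
      show "(x, u0 x + s *\<^sub>R (v x - u0 x)) \<in> GS (ball 0 \<epsilon>)" if "x \<in> {a..b}" "s \<in> {0..1}" for x s
        using sc[OF that] by (intro r(2) that) (simp add: dist_norm)
      show "s *\<^sub>R (v x - u0 x) \<in> ball 0 \<epsilon>" if "x \<in> {a..b}" "s \<in> {0..1}" for x s
        using sc[OF that] by simp
    qed (use e in auto)
  qed (use r e in auto)
qed

lemma diff_u0_cont: "Ck_vec 1 {a..b} v \<Longrightarrow> continuous_on {a..b} (\<lambda>x. v x - u0 x)"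
  using has_vector_derivative_imp_continuous_on[OF Ck_vec_has_vderiv(1)[OF ab, of 1 v]]
  by (intro continuous_intros u0_cont) auto

lemma diff_u0'_cont: "Ck_vec 1 {a..b} v \<Longrightarrow> continuous_on {a..b} (\<lambda>x. vderiv a b v x - vderiv a b u0 x)"
  using Ck_vec_has_vderiv(2)[OF ab, of 1 v] continuous_on_eq[OF Px_cont, of "vderiv a b u0"]
  by (intro continuous_intros) (auto simp: vderiv_u0)

lemma field_strong_min:
  assumes "\<epsilon> > 0" "cond_S f a b u0 et \<phi> (ball 0 \<epsilon>)" "cond_Fa f a b IDa u0 et \<phi> (ball 0 \<epsilon>)" "cond_Fb f a b IDb u0 et \<phi> (ball 0 \<epsilon>)"
    and E: "\<forall>(x, v)\<in>field_set a b et \<phi>. \<forall>q. excess f x v (slope x v) q \<ge> 0"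
  shows "strong_min f a b IDa IDb u0"
proof -
  obtain r where r: "r > 0" "\<And>x v. x \<in> {a..b} \<Longrightarrow> dist v (u0 x) < r \<Longrightarrow> (x, v) \<in> FS"
    "\<And>v. admissible a b IDa IDb u0 v \<Longrightarrow> (\<And>x. x \<in> {a..b} \<Longrightarrow> dist (v x) (u0 x) < r) \<Longrightarrow>
      (\<And>x. x \<in> {a..b} \<Longrightarrow> excess f x (v x) (slope x (v x)) (vderiv a b v x) \<ge> 0) \<Longrightarrow> Phi f a b v \<ge> Phi f a b u0"
    using local_field_comparison[OF assms(1-4)] by blast
  show ?thesis
    unfolding strong_min_def
  proof (intro exI[of _ r] conjI allI impI r(1))
    fix v assume v: "admissible a b IDa IDb u0 v \<and> Cnorm a b (\<lambda>x. v x - u0 x) < r"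
    have d: "dist (v x) (u0 x) < r" if "x \<in> {a..b}" for x
      using Cnorm_bound[OF diff_u0_cont that, of v] v by (auto simp: dist_norm admissible_def)
    show "Phi f a b v \<ge> Phi f a b u0"
      using v d bspec[OF E, of "(x, v x)" for x] r(2)[OF _ d] unfolding FS_eq by (intro r(3)) auto
  qed
qed

text \<open>Needed when the excess is controlled only for directions near the slope: close to
  \<open>u0\<close> the slope is uniformly close to the derivative of \<open>u0\<close>, which is
  \<open>Px (x, 0)\<close>.\<close>

lemma slope_near_u0:
  assumes "\<eta> > 0"
  obtains r where "r > 0" "\<And>x v. x \<in> {a..b} \<Longrightarrow> dist v (u0 x) \<le> r \<Longrightarrow> norm (psi (x, v) - Px (x, 0)) < \<eta>"
proof -
  have C: "C1_on {z \<in> W0. (fst z, 0) \<in> U3} (\<lambda>z. psi z - Px (fst z, 0)) (\<lambda>z h. psi' z h - Px' (fst z, 0) (fst h, 0))"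
  proof -
    have 1: "C1_on W0 (\<lambda>z. (fst z, 0)) (\<lambda>z h. (fst h, 0))"
      using C1_on_open[OF psi_C1] by (intro C1_on_Pair C1_id C1_on_const)
    show ?thesis
      by (intro C1_on_diff C1_on_compose_vimage[OF 1 Px] C1_on_subset[OF psi_C1] open_vimage_C1_on[OF 1 C1_on_open[OF Px]]) auto
  qed
  have "(x, u0 x) \<in> {z \<in> {z \<in> W0. (fst z, 0) \<in> U3}. psi z - Px (fst z, 0) \<in> ball 0 \<eta>}" if "x \<in> {a..b}" for x
    using on_field[OF that zero_in] U3 zero_in that assms by (auto simp: W_def u0_Ph)
  then obtain r where "r > 0" "\<And>x v. x \<in> {a..b} \<Longrightarrow> dist v (u0 x) \<le> r \<Longrightarrow>
     (x, v) \<in> {z \<in> {z \<in> W0. (fst z, 0) \<in> U3}. psi z - Px (fst z, 0) \<in> ball 0 \<eta>}"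
    using tube_in_open[OF open_vimage_C1_on[OF C open_ball] u0_cont] by blast
  then show thesis by (intro that[of r]) auto
qed

lemma field_weak_min:
  assumes "\<epsilon> > 0" "cond_S f a b u0 et \<phi> (ball 0 \<epsilon>)" "cond_Fa f a b IDa u0 et \<phi> (ball 0 \<epsilon>)" "cond_Fb f a b IDb u0 et \<phi> (ball 0 \<epsilon>)"
    and \<eta>: "\<eta> > 0" and E: "\<forall>(x, v)\<in>field_set a b et \<phi>. \<forall>q. norm (q - slope x v) \<le> \<eta> \<longrightarrow> excess f x v (slope x v) q \<ge> 0"
  shows "weak_min f a b IDa IDb u0"
proof -
  obtain r where r: "r > 0" "\<And>x v. x \<in> {a..b} \<Longrightarrow> dist v (u0 x) < r \<Longrightarrow> (x, v) \<in> FS"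
    "\<And>v. admissible a b IDa IDb u0 v \<Longrightarrow> (\<And>x. x \<in> {a..b} \<Longrightarrow> dist (v x) (u0 x) < r) \<Longrightarrow>
      (\<And>x. x \<in> {a..b} \<Longrightarrow> excess f x (v x) (slope x (v x)) (vderiv a b v x) \<ge> 0) \<Longrightarrow> Phi f a b v \<ge> Phi f a b u0"
    using local_field_comparison[OF assms(1-4)] by blast
  obtain r2 where r2: "r2 > 0" "\<And>x v. x \<in> {a..b} \<Longrightarrow> dist v (u0 x) \<le> r2 \<Longrightarrow> norm (psi (x, v) - Px (x, 0)) < \<eta> / 2"
    using slope_near_u0[of "\<eta> / 2"] \<eta> by auto
  \<comment> \<open>Half of \<open>\<eta>\<close> bounds the distance from \<open>v'\<close> to
    \<open>u0'\<close>, the other half that from \<open>u0'\<close> to the slope at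
    \<open>v\<close>.\<close>
  define q where "q = min (min r r2) (\<eta> / 2)"
  show ?thesis
    unfolding weak_min_def
  proof (intro exI[of _ q] conjI allI impI)
    show "q > 0" using r r2 \<eta> by (simp add: q_def)
    fix v assume v: "admissible a b IDa IDb u0 v \<and> C1dist a b v u0 < q"
    have vC: "Ck_vec 1 {a..b} v" using v by (simp add: admissible_def)
    have n: "norm (v x - u0 x) + norm (vderiv a b v y - vderiv a b u0 y) < q" if "x \<in> {a..b}" "y \<in> {a..b}" for x y
      using Cnorm_bound[OF diff_u0_cont[OF vC] that(1)] Cnorm_bound[OF diff_u0'_cont[OF vC] that(2)] v by (auto simp: C1dist_def)
    have d: "dist (v x) (u0 x) < q" if "x \<in> {a..b}" for x
      using n[OF that that] norm_ge_zero[of "vderiv a b v x - vderiv a b u0 x"] unfolding dist_norm by linarith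
    have d': "norm (vderiv a b v x - Px (x, 0)) < q" if "x \<in> {a..b}" for x
      using n[OF that that] norm_ge_zero[of "v x - u0 x"] unfolding vderiv_u0[OF that] by linarith
    show "Phi f a b v \<ge> Phi f a b u0"
    proof (rule r(3))
      show "dist (v x) (u0 x) < r" if "x \<in> {a..b}" for x using d[OF that] by (simp add: q_def)
      fix x assume x: "x \<in> {a..b}"
      have FS: "(x, v x) \<in> FS" using d[OF x] by (intro r(2) x) (simp add: q_def)
      have "norm (psi (x, v x) - Px (x, 0)) < \<eta> / 2" using d[OF x] by (intro r2(2) x) (simp add: q_def)
      moreover have "norm (vderiv a b v x - Px (x, 0)) < \<eta> / 2" using d'[OF x] by (simp add: q_def)
      ultimately have "norm (vderiv a b v x - psi (x, v x)) \<le> \<eta>"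
        using norm_triangle_ineq4[of "vderiv a b v x - Px (x, 0)" "psi (x, v x) - Px (x, 0)"] by simp
      then show "excess f x (v x) (slope x (v x)) (vderiv a b v x) \<ge> 0"
        using E FS unfolding FS_eq[symmetric] by (auto simp: slope_psi)
    qed (use v in auto)
  qed
qed

lemma field_global_min:
  assumes G: "field_set a b et \<phi> = {a..b} \<times> UNIV"
    and S: "cond_S f a b u0 et \<phi> UNIV" "cond_Fa f a b IDa u0 et \<phi> UNIV" "cond_Fb f a b IDb u0 et \<phi> UNIV"
    and E: "\<forall>(x, v)\<in>field_set a b et \<phi>. \<forall>q. excess f x v (slope x v) q \<ge> 0"
  shows "global_min f a b IDa IDb u0"
  unfolding global_min_def
proof (intro allI impI)
  fix v assume v: "admissible a b IDa IDb u0 v"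
  have "(x, w) \<in> GS UNIV" if "x \<in> {a..b}" for x w using that by (simp add: GS_def FS_eq G)
  then show "Phi f a b v \<ge> Phi f a b u0"
    using E unfolding G by (intro field_comparison[OF _ _ S v]) auto
qed

section \<open>Members of the field as competitors\<close>

text \<open>Uniform \<open>C^1\<close> closeness of the members to \<open>u0\<close>, by the tube
  argument about the constant curve 0 in parameter space.\<close>

lemma \<phi>_near_u0:
  assumes "\<epsilon> > 0"
  obtains \<delta> where "\<delta> > 0" "\<And>x \<beta>. x \<in> {a..b} \<Longrightarrow> norm \<beta> \<le> \<delta> \<Longrightarrow>
    \<beta> \<in> ball 0 et \<and> norm (\<phi> x \<beta> - u0 x) < \<epsilon> \<and> norm (Px (x, \<beta>) - Px (x, 0)) < \<epsilon>"
proof -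
  have proj: "C1_on UNIV (\<lambda>z::real\<times>(real^'n). (fst z, 0)) (\<lambda>z h. (fst h, 0))"
    by (intro C1_on_Pair C1_id C1_on_const) auto
  have diff: "open {z. z \<in> V \<and> (fst z, 0) \<in> V \<and> norm (g z - g (fst z, 0)) < \<epsilon>}"
    if g: "C1_on V g g'" for V and g :: "real\<times>(real^'n) \<Rightarrow> real^'n" and g'
  proof -
    have o: "open (V \<inter> {z \<in> UNIV. (fst z, 0) \<in> V})" by (intro open_Int C1_on_open[OF g] open_vimage_C1_on[OF proj])
    have "C1_on (V \<inter> {z \<in> UNIV. (fst z, 0) \<in> V}) (\<lambda>z. g z - g (fst z, 0)) (\<lambda>z h. g' z h - g' (fst z, 0) (fst h, 0))"
      by (intro C1_on_diff C1_on_subset[OF g o] C1_on_subset[OF C1_on_compose_vimage[OF proj g] o]) auto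
    from open_vimage_C1_on[OF this open_ball[of 0 \<epsilon>]]
    have "open {z \<in> V \<inter> {z \<in> UNIV. (fst z, 0) \<in> V}. g z - g (fst z, 0) \<in> ball 0 \<epsilon>}" .
    moreover have "{z \<in> V \<inter> {z \<in> UNIV. (fst z, 0) \<in> V}. g z - g (fst z, 0) \<in> ball 0 \<epsilon>} =
        {z. z \<in> V \<and> (fst z, 0) \<in> V \<and> norm (g z - g (fst z, 0)) < \<epsilon>}" by auto
    ultimately show ?thesis by (simp only:)
  qed
  have mem: "(x, 0) \<in> (UNIV \<times> ball 0 et) \<inter> ({z. z \<in> U1 \<and> (fst z, 0) \<in> U1 \<and> norm (Ph z - Ph (fst z, 0)) < \<epsilon>} \<inter>
      {z. z \<in> U3 \<and> (fst z, 0) \<in> U3 \<and> norm (Px z - Px (fst z, 0)) < \<epsilon>})" if "x \<in> {a..b}" for x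
    using that U1 U3 zero_in assms by auto
  have o: "open ((UNIV \<times> ball 0 et) \<inter> ({z. z \<in> U1 \<and> (fst z, 0) \<in> U1 \<and> norm (Ph z - Ph (fst z, 0)) < \<epsilon>} \<inter>
      {z. z \<in> U3 \<and> (fst z, 0) \<in> U3 \<and> norm (Px z - Px (fst z, 0)) < \<epsilon>}))"
    by (intro open_Int open_Times diff[OF Ph] diff[OF Px]) auto
  obtain r where r: "r > 0" "\<And>x \<beta>. x \<in> {a..b} \<Longrightarrow> dist \<beta> 0 \<le> r \<Longrightarrow>
     (x, \<beta>) \<in> (UNIV \<times> ball 0 et) \<inter> ({z. z \<in> U1 \<and> (fst z, 0) \<in> U1 \<and> norm (Ph z - Ph (fst z, 0)) < \<epsilon>} \<inter>
      {z. z \<in> U3 \<and> (fst z, 0) \<in> U3 \<and> norm (Px z - Px (fst z, 0)) < \<epsilon>})"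
    using tube_in_open[OF o continuous_on_const mem] by blast
  show thesis
  proof (rule that[OF r(1)])
    fix x and \<beta> :: "real^'n" assume "x \<in> {a..b}" "norm \<beta> \<le> r"
    then show "\<beta> \<in> ball 0 et \<and> norm (\<phi> x \<beta> - u0 x) < \<epsilon> \<and> norm (Px (x, \<beta>) - Px (x, 0)) < \<epsilon>"
      using r(2)[of x \<beta>] Ph_\<phi>[of x \<beta>] u0_Ph[of x] by auto
  qed
qed

text \<open>Over \<open>b\<close> the field contains a neighbourhood of \<open>u0 b\<close>, and the
  parameter of a member depends continuously on its end point, with value 0 at
  \<open>u0 b\<close>.\<close>

lemma \<phi>_b_near_u0:
  assumes "\<delta> > 0"
  obtains \<tau> where "\<tau> > 0" "\<And>w. norm w < \<tau> \<Longrightarrow> \<exists>\<beta>\<in>ball 0 et. norm \<beta> < \<delta> \<and> \<phi> b \<beta> = u0 b + w"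
proof -
  obtain N where N: "open N" "\<And>x v. x \<in> {a..b} \<Longrightarrow> (x, v) \<in> N \<longleftrightarrow> (x, v) \<in> FS" using FS_rel_open by blast
  have b: "b \<in> {a..b}" using ab by simp
  have o: "open (N \<inter> {z \<in> U2. Al z \<in> ball 0 \<delta>})" by (intro open_Int N open_vimage_C1_on[OF Al] open_ball)
  have "(b, u0 b) \<in> N \<inter> {z \<in> U2. Al z \<in> ball 0 \<delta>}"
    using N(2)[OF b] FS_I[OF b zero_in] AlPh[OF b zero_in] U2[OF b zero_in] assms by (simp add: u0_Ph[OF b])
  then obtain \<tau> where \<tau>: "\<tau> > 0" "ball (b, u0 b) \<tau> \<subseteq> N \<inter> {z \<in> U2. Al z \<in> ball 0 \<delta>}" using o openE by blast
  show thesis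
  proof (rule that[OF \<tau>(1)])
    fix w :: "real^'n" assume "norm w < \<tau>"
    then have "(b, u0 b + w) \<in> ball (b, u0 b) \<tau>" by (simp add: dist_Pair_Pair dist_norm)
    then have "(b, u0 b + w) \<in> FS" "norm (Al (b, u0 b + w)) < \<delta>" using \<tau>(2) N(2)[OF b] by auto
    then show "\<exists>\<beta>\<in>ball 0 et. norm \<beta> < \<delta> \<and> \<phi> b \<beta> = u0 b + w"
      using Ph_\<phi> by (elim FS_E) (metis)
  qed
qed

text \<open>For a competitor that belongs to the field the excess vanishes identically, so the
  boundary terms decide. With \<open>IDa = {}\<close> nothing is prescribed at \<open>a\<close>, and
  a member is admissible wherever it starts.\<close>

lemma field_not_weak_min:
  assumes e: "\<epsilon> > 0" and IDa: "IDa = {}" and S: "cond_S f a b u0 et \<phi> (ball 0 \<epsilon>)"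
    and Fa: "\<forall>v. v - u0 a \<in> RD IDa \<inter> ball 0 \<epsilon> \<and> (a, v) \<in> field_set a b et \<phi> \<longrightarrow> fp f a v (slope a v) \<bullet> (v - u0 a) \<ge> 0"
    and w0: "w0 \<in> RD IDb"
    and Fb: "\<forall>t v. 0 < t \<and> t < 1 \<and> v = u0 b + t *\<^sub>R w0 \<and> (b, v) \<in> field_set a b et \<phi> \<longrightarrow> fp f b v (slope b v) \<bullet> (v - u0 b) < 0"
  shows "\<not> weak_min f a b IDa IDb u0"
proof
  assume "weak_min f a b IDa IDb u0"
  then obtain \<epsilon>' where e': "\<epsilon>' > 0" "\<And>v. admissible a b IDa IDb u0 v \<Longrightarrow> C1dist a b v u0 < \<epsilon>' \<Longrightarrow> Phi f a b v \<ge> Phi f a b u0"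
    unfolding weak_min_def by blast
  obtain r where r: "r > 0" "\<And>x v. x \<in> {a..b} \<Longrightarrow> dist v (u0 x) \<le> r \<Longrightarrow> (x, v) \<in> GS (ball 0 \<epsilon>)"
    using GS_tube[of "ball 0 \<epsilon>"] e by auto
  \<comment> \<open>\<open>C1dist\<close> adds two suprema, each at most \<open>q\<close>; a third
    of \<open>\<epsilon>'\<close> leaves the sum strictly below \<open>\<epsilon>'\<close>.\<close>
  define q where "q = min (min r \<epsilon>) (\<epsilon>' / 3)"
  have q: "q > 0" using r e e' by (simp add: q_def)
  obtain \<delta> where \<delta>: "\<delta> > 0" "\<And>x \<beta>. x \<in> {a..b} \<Longrightarrow> norm \<beta> \<le> \<delta> \<Longrightarrow>
    \<beta> \<in> ball 0 et \<and> norm (\<phi> x \<beta> - u0 x) < q \<and> norm (Px (x, \<beta>) - Px (x, 0)) < q"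
    using \<phi>_near_u0[OF q] by blast
  obtain \<tau> where \<tau>: "\<tau> > 0" "\<And>w. norm w < \<tau> \<Longrightarrow> \<exists>\<beta>\<in>ball 0 et. norm \<beta> < \<delta> \<and> \<phi> b \<beta> = u0 b + w"
    using \<phi>_b_near_u0[OF \<delta>(1)] by blast
  \<comment> \<open>Chosen so that \<open>t *\<^sub>R w0\<close> is shorter than
    \<open>\<tau>\<close>; the denominator \<open>norm w0 + 1\<close> covers \<open>w0 = 0\<close>
    as well.\<close>
  define t where "t = min (1/2) (\<tau> / (norm w0 + 1) / 2)"
  have t: "0 < t" "t < 1" using \<tau>(1) by (auto simp: t_def add_nonneg_pos)
  have "t * norm w0 < \<tau>"
  proof -
    have "t * norm w0 \<le> \<tau> / (norm w0 + 1) / 2 * norm w0" by (intro mult_right_mono) (auto simp: t_def)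
    also have "\<dots> \<le> \<tau> / 2" using \<tau>(1) by (simp add: divide_simps add_nonneg_pos)
    finally show ?thesis using \<tau>(1) by simp
  qed
  then obtain \<beta> where \<beta>: "\<beta> \<in> ball 0 et" "norm \<beta> < \<delta>" "\<phi> b \<beta> = u0 b + t *\<^sub>R w0" using \<tau>(2)[of "t *\<^sub>R w0"] t by auto
  define v where "v = (\<lambda>x. \<phi> x \<beta>)"
  have vC: "Ck_vec 1 {a..b} v" unfolding v_def by (rule \<phi>_C1[OF \<beta>(1)])
  have vb: "v b - u0 b = t *\<^sub>R w0" by (simp add: v_def \<beta>)
  have adm: "admissible a b IDa IDb u0 v"
  proof -
    have "v b $ i = u0 b $ i" if "i \<in> IDb" for i using w0 that by (simp add: v_def \<beta> RD_def)
    then show ?thesis using vC by (simp add: admissible_def IDa)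
  qed
  have n1: "norm (v x - u0 x) < q" and n2: "norm (vderiv a b v x - vderiv a b u0 x) < q" if "x \<in> {a..b}" for x
    using \<delta>(2)[OF that, of \<beta>] \<beta>(2) vderiv_\<phi>[OF that \<beta>(1)] vderiv_u0[OF that] by (auto simp: v_def)
  have "Cnorm a b (\<lambda>x. v x - u0 x) \<le> q" "Cnorm a b (\<lambda>x. vderiv a b v x - vderiv a b u0 x) \<le> q"
    unfolding Cnorm_def using ab n1 n2 by (intro cSUP_least less_imp_le; auto)+
  then have "C1dist a b v u0 < \<epsilon>'" using e'(1) by (simp add: C1dist_def q_def)
  from e'(2)[OF adm this] have ge: "Phi f a b v \<ge> Phi f a b u0" .
  have H: "(x, u0 x + s *\<^sub>R (v x - u0 x)) \<in> GS (ball 0 \<epsilon>)" and Hn: "norm (s *\<^sub>R (v x - u0 x)) < q"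
    if "x \<in> {a..b}" "s \<in> {0..1}" for x s
  proof -
    have "norm (s *\<^sub>R (v x - u0 x)) \<le> 1 * norm (v x - u0 x)"
      using that by (simp only: norm_scaleR) (intro mult_right_mono, auto)
    then show "norm (s *\<^sub>R (v x - u0 x)) < q" using n1[OF that(1)] by simp
    then show "(x, u0 x + s *\<^sub>R (v x - u0 x)) \<in> GS (ball 0 \<epsilon>)"
      by (intro r(2) that) (simp add: dist_norm q_def)
  qed
  obtain s va vb' where s: "0 < s" "s < 1" "va = u0 a + s *\<^sub>R (v a - u0 a)" "vb' = u0 b + s *\<^sub>R (v b - u0 b)"
    and i: "(\<lambda>x. excess f x (v x) (slope x (v x)) (vderiv a b v x)) integrable_on {a..b}"
    and eq: "Phi f a b v = Phi f a b u0 + integral {a..b} (\<lambda>x. excess f x (v x) (slope x (v x)) (vderiv a b v x))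
      + fp f b vb' (slope b vb') \<bullet> (v b - u0 b) - fp f a va (slope a va) \<bullet> (v a - u0 a)"
    using weierstrass_identity[OF S vC H] by blast
  have FSab: "(a, va) \<in> FS" "(b, vb') \<in> FS" using H[of a s] H[of b s] s ab by (auto simp: GS_def)
  have "fp f a va (slope a va) \<bullet> (va - u0 a) \<ge> 0"
  proof -
    have "va - u0 a \<in> RD IDa \<inter> ball 0 \<epsilon>" using Hn[of a s] s ab by (auto simp: RD_def q_def IDa)
    then show ?thesis using Fa FSab(1) unfolding FS_eq by blast
  qed
  then have 1: "fp f a va (slope a va) \<bullet> (v a - u0 a) \<ge> 0"
    using s by (simp add: zero_le_mult_iff)
  \<comment> \<open>The intermediate point is \<open>u0 b + (s * t) *\<^sub>R w0\<close>, so the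
    strict inequality is applied at \<open>s * t\<close> and not at \<open>t\<close>.\<close>
  have st: "0 < s * t" "s * t < 1" using s t mult_strict_mono[of s 1 t 1] by auto
  have vb'': "vb' = u0 b + (s * t) *\<^sub>R w0" by (simp add: s vb)
  have "fp f b vb' (slope b vb') \<bullet> (vb' - u0 b) < 0" using Fb FSab(2) st vb'' unfolding FS_eq by blast
  then have 2: "fp f b vb' (slope b vb') \<bullet> (v b - u0 b) < 0"
    using s by (simp add: mult_less_0_iff)
  have "integral {a..b} (\<lambda>x. excess f x (v x) (slope x (v x)) (vderiv a b v x)) = integral {a..b} (\<lambda>x. 0)"
    by (rule integral_cong) (simp add: v_def slope_\<phi>[OF _ \<beta>(1)] vderiv_\<phi>[OF _ \<beta>(1)] excess_def del: atLeastAtMost_iff)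
  then show False using ge eq 1 2 by simp
qed

end

text \<open>The extensions hidden in \<open>Ck_vec\<close> become the open-set data of the locale;
  the inverse postulated in \<open>is_field\<close> provides \<open>Al\<close>.\<close>

lemma is_field_extremal_field_for:
  fixes f :: "real \<Rightarrow> real^'n \<Rightarrow> real^'n \<Rightarrow> real"
  assumes ab: "a < b" and f: "integrand_Ck 2 a b f" and fld: "is_field f a b u0 et \<phi>"
  obtains U F DF D2F U1 Ph Ph' U2 Al Al' U3 Px Px' where
    "extremal_field_for f a b U F DF D2F et U1 Ph Ph' U2 Al Al' U3 Px Px' u0 \<phi>"
proof -
  obtain U F DF D2F where C2: "C2_integrand f a b U F DF D2F" using integrand_C2_extension[OF ab f] by metis
  interpret C2_integrand f a b U F DF D2F by fact
  let ?D = "{a..b} \<times> ball 0 et"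
  obtain U1 Ph Ph' where 1: "?D \<subseteq> U1" "C1_on U1 Ph Ph'" "\<And>z. z \<in> ?D \<Longrightarrow> Ph z = (\<lambda>(x, \<alpha>). \<phi> x \<alpha>) z"
    by (rule Ck_vec_1_C1_on[of 1 ?D "\<lambda>(x, \<alpha>). \<phi> x \<alpha>"]) (use fld in \<open>auto simp: is_field_def\<close>)
  obtain ainv where ainv: "\<forall>x\<in>{a..b}. \<forall>\<beta>\<in>ball 0 et. ainv x (\<phi> x \<beta>) = \<beta>" "Ck_vec 1 (field_set a b et \<phi>) (\<lambda>(x, v). ainv x v)"
    using fld unfolding is_field_def by blast
  obtain U2 Al Al' where 2: "field_set a b et \<phi> \<subseteq> U2" "C1_on U2 Al Al'" "\<And>z. z \<in> field_set a b et \<phi> \<Longrightarrow> Al z = (\<lambda>(x, v). ainv x v) z"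
    using Ck_vec_1_C1_on[OF ainv(2) order_refl] by blast
  obtain U3 Px Px' where 3: "?D \<subseteq> U3" "C1_on U3 Px Px'" "\<And>z. z \<in> ?D \<Longrightarrow> Px z = (\<lambda>(x, \<alpha>). vderiv a b (\<lambda>y. \<phi> y \<alpha>) x) z"
    by (rule Ck_vec_1_C1_on[of 1 ?D "\<lambda>(x, \<alpha>). vderiv a b (\<lambda>y. \<phi> y \<alpha>) x"]) (use fld in \<open>auto simp: is_field_def\<close>)
  have Ph: "Ph (x, \<beta>) = \<phi> x \<beta>" and Px: "Px (x, \<beta>) = vderiv a b (\<lambda>y. \<phi> y \<beta>) x"
    and fs: "(x, \<phi> x \<beta>) \<in> field_set a b et \<phi>" if "x \<in> {a..b}" "\<beta> \<in> ball 0 et" for x \<beta>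
    using 1(3)[of "(x, \<beta>)"] 3(3)[of "(x, \<beta>)"] that by (auto simp: field_set_def)
  have ext: "extremal f a b (\<lambda>x. \<phi> x \<beta>)" if "\<beta> \<in> ball 0 et" for \<beta> using fld that unfolding is_field_def by blast
  have C\<phi>: "Ck_vec 1 {a..b} (\<lambda>x. \<phi> x \<beta>)" if "\<beta> \<in> ball 0 et" for \<beta> using ext[OF that] by (simp add: extremal_def)
  have "extremal_field_for f a b U F DF D2F et U1 Ph Ph' U2 Al Al' U3 Px Px' u0 \<phi>"
  proof (unfold_locales)
    show "et > 0" "\<And>x. x \<in> {a..b} \<Longrightarrow> \<phi> x 0 = u0 x" using fld by (auto simp: is_field_def)
    fix x \<beta> assume x: "x \<in> {a..b}" and \<beta>: "\<beta> \<in> ball (0::real^'n) et"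
    show "Al (x, Ph (x, \<beta>)) = \<beta>" using 2(3)[OF fs[OF x \<beta>]] ainv(1) x \<beta> Ph[OF x \<beta>] by simp
    show "(x, Ph (x, \<beta>)) \<in> U2" using fs[OF x \<beta>] 2(1) Ph[OF x \<beta>] by auto
    have "((\<lambda>y. \<phi> y \<beta>) has_vector_derivative Px (x, \<beta>)) (at x within {a..b})"
      using Ck_vec_has_vderiv(1)[OF ab C\<phi>[OF \<beta>] order_refl x] Px[OF x \<beta>] by simp
    then show "((\<lambda>y. Ph (y, \<beta>)) has_vector_derivative Px (x, \<beta>)) (at x within {a..b})"
      by (rule has_vector_derivative_transform[of x "{a..b}" "\<lambda>y. Ph (y, \<beta>)" "\<lambda>y. \<phi> y \<beta>", OF x Ph[OF _ \<beta>], rotated])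
    have "((\<lambda>y. fp f y (\<phi> y \<beta>) (vderiv a b (\<lambda>x. \<phi> x \<beta>) y) $ i) has_real_derivative
         (fu f x (\<phi> x \<beta>) (vderiv a b (\<lambda>x. \<phi> x \<beta>) x) $ i)) (at x within {a..b})" for i
      using ext[OF \<beta>] x unfolding extremal_def by blast
    then have "((\<lambda>y. fp f y (\<phi> y \<beta>) (vderiv a b (\<lambda>x. \<phi> x \<beta>) y)) has_vector_derivative
         fu f x (\<phi> x \<beta>) (vderiv a b (\<lambda>x. \<phi> x \<beta>) x)) (at x within {a..b})"
      by (rule has_vector_derivative_vec)
    moreover have "fP (y, Ph (y, \<beta>), Px (y, \<beta>)) = fp f y (\<phi> y \<beta>) (vderiv a b (\<lambda>x. \<phi> x \<beta>) y)" if "y \<in> {a..b}" for y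
      using that Ph[OF that \<beta>] Px[OF that \<beta>] by (simp add: fp_eq)
    ultimately have "((\<lambda>y. fP (y, Ph (y, \<beta>), Px (y, \<beta>))) has_vector_derivative fu f x (\<phi> x \<beta>) (vderiv a b (\<lambda>x. \<phi> x \<beta>) x)) (at x within {a..b})"
      by (intro has_vector_derivative_transform[OF x, of "\<lambda>y. fP (y, Ph (y, \<beta>), Px (y, \<beta>))" "\<lambda>y. fp f y (\<phi> y \<beta>) (vderiv a b (\<lambda>x. \<phi> x \<beta>) y)"]) auto
    then show "((\<lambda>y. fP (y, Ph (y, \<beta>), Px (y, \<beta>))) has_vector_derivative fU (x, Ph (x, \<beta>), Px (x, \<beta>))) (at x within {a..b})"
      using Ph[OF x \<beta>] Px[OF x \<beta>] x by (simp add: fu_eq)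
  qed (use 1 2 3 Ph C\<phi> in auto)
  then show thesis by (rule that)
qed

section \<open>The Legendre transform and the Jacobi equation\<close>

context C2_integrand begin

lemma second_partials:
  assumes x: "x \<in> {a..b}"
  shows "fpp f x u p i j = DfP (x, u, p) (0, 0, axis j 1) $ i" "fpu f x u p i j = DfP (x, u, p) (0, axis j 1, 0) $ i"
    "fup f x u p i j = DfU (x, u, p) (0, 0, axis j 1) $ i" "fuu f x u p i j = DfU (x, u, p) (0, axis j 1, 0) $ i"
  unfolding fpp_def fpu_def fup_def fuu_def
  using C1_on_pdir(2)[OF C1_on_nth[OF fP_C1] in_U[OF x, of u p], of i "(0, 0, axis j 1)"]
    C1_on_pdir(2)[OF C1_on_nth[OF fP_C1] in_U[OF x, of u p], of i "(0, axis j 1, 0)"]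
    C1_on_pdir(2)[OF C1_on_nth[OF fU_C1] in_U[OF x, of u p], of i "(0, 0, axis j 1)"]
    C1_on_pdir(2)[OF C1_on_nth[OF fU_C1] in_U[OF x, of u p], of i "(0, axis j 1, 0)"]
  by (simp_all add: pdir_def fp_eq[OF x] fu_eq[OF x])

lemma nth_slots:
  fixes l :: "real \<times> (real^'n) \<times> (real^'n) \<Rightarrow> real^'n"
  assumes "bounded_linear l"
  shows "l (0, w, q) $ i = (\<Sum>j\<in>UNIV. l (0, 0, axis j 1) $ i * q $ j + l (0, axis j 1, 0) $ i * w $ j)"
proof -
  have "linear (\<lambda>k. l k $ i)"
    by (rule linearI) (simp_all add: linear_simps[OF assms])
  from linear_slots(1)[OF this, of q] linear_slots(2)[OF this, of w] linear_slots(3)[OF this, of w q]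
  show ?thesis by (simp add: sum.distrib mult.commute)
qed

lemma DfP_linear: "z \<in> U \<Longrightarrow> bounded_linear (DfP z)" and DfU_linear: "z \<in> U \<Longrightarrow> bounded_linear (DfU z)"
  using C1_on_linear_deriv[OF fP_C1] C1_on_linear_deriv[OF fU_C1] by auto

lemma jacB_eq: "x \<in> {a..b} \<Longrightarrow> jacB f a b u0 h x = DfP (x, u0 x, vderiv a b u0 x) (0, h x, vderiv a b h x)"
  using nth_slots[OF DfP_linear[OF in_U], of x "u0 x" "vderiv a b u0 x" "h x" "vderiv a b h x"]
  by (simp add: jacB_def vec_eq_iff second_partials)

lemma jacC_eq: "x \<in> {a..b} \<Longrightarrow> jacC f a b u0 h x = DfU (x, u0 x, vderiv a b u0 x) (0, h x, vderiv a b h x)"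
  using nth_slots[OF DfU_linear[OF in_U], of x "u0 x" "vderiv a b u0 x" "h x" "vderiv a b h x"]
  by (simp add: jacC_def vec_eq_iff second_partials)

lemma fpp_form:
  assumes "x \<in> {a..b}"
  shows "(\<Sum>i\<in>UNIV. \<Sum>j\<in>UNIV. fpp f x u p i j * \<xi> $ i * \<xi> $ j) = DfP (x, u, p) (0, 0, \<xi>) \<bullet> \<xi>"
proof -
  have "DfP (x, u, p) (0, 0, \<xi>) $ i = (\<Sum>j\<in>UNIV. fpp f x u p i j * \<xi> $ j)" for i
    using nth_slots[OF DfP_linear[OF in_U[OF assms]], of u p 0 \<xi> i] by (simp add: second_partials[OF assms])
  then show ?thesis by (simp add: inner_vec_def sum_distrib_left mult_ac)
qed

end

section \<open>First-order form of the extremals near a given one, and its linearisation\<close>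

locale legendre_extremal = C2_integrand f a b U F DF D2F
  for f :: "real \<Rightarrow> real^'n \<Rightarrow> real^'n \<Rightarrow> real" and a b U F DF D2F +
  fixes u0 p0 :: "real \<Rightarrow> real^'n" and c0 :: real
  assumes u0: "\<And>x. x \<in> {a..b} \<Longrightarrow> (u0 has_vector_derivative p0 x) (at x within {a..b})"
    and p0: "continuous_on {a..b} p0"
    and EL: "\<And>x. x \<in> {a..b} \<Longrightarrow> ((\<lambda>x. fP (x, u0 x, p0 x)) has_vector_derivative fU (x, u0 x, p0 x)) (at x within {a..b})"
    and c0: "c0 > 0" and coercive: "\<And>x \<xi>. x \<in> {a..b} \<Longrightarrow> c0 * (norm \<xi>)\<^sup>2 \<le> DfP (x, u0 x, p0 x) (0, 0, \<xi>) \<bullet> \<xi>"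
begin

definition z0 where "z0 x = (x, u0 x, p0 x)"
definition y0 where "y0 x = (u0 x, fP (z0 x))"

lemma z0_U: "x \<in> {a..b} \<Longrightarrow> z0 x \<in> U" by (simp add: z0_def in_U)

lemma u0_cont: "continuous_on {a..b} u0"
  by (rule has_vector_derivative_imp_continuous_on[OF u0])

lemma z0_cont: "continuous_on {a..b} z0"
  unfolding z0_def by (intro continuous_intros u0_cont p0)

lemma fpp_inj:
  assumes x: "x \<in> {a..b}" and eq: "DfP (z0 x) (0, w, q) = DfP (z0 x) (0, w, q')" shows "q = q'"
proof -
  note bl = DfP_linear[OF z0_U[OF x]]
  have "DfP (z0 x) (0, 0, q - q') = 0" using linear_simps(2)[OF bl, of "(0, w, q)" "(0, w, q')"] eq by simp
  then have "c0 * (norm (q - q'))\<^sup>2 \<le> 0" using coercive[OF x, of "q - q'"] by (simp add: z0_def)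
  then show ?thesis using c0 by (simp add: mult_le_0_iff)
qed

text \<open>\<open>Lg\<close> is the Legendre map, \<open>gi\<close> its local inverse near the 1-jet of \<open>u0\<close>, and \<open>G\<close> the
  Hamiltonian vector field, written without the Hamiltonian: \<open>u' = Q\<close>, \<open>\<pi>' = f\<^sub>u(x, u, Q)\<close>.\<close>
definition Lg where "Lg z = (fst z, fst (snd z), fP z)"
definition Lg' where "Lg' z h = (fst h, fst (snd h), DfP z h)"

lemma Lg_C1: "C1_on U Lg Lg'"
proof -
  have "C1_on U (\<lambda>z. fst (snd z)) (\<lambda>z h. fst (snd h))"
    by (rule C1_on_bounded_linear) (auto intro!: bounded_linear_intros U_open)
  moreover have "C1_on U fst (\<lambda>z. fst)" by (rule C1_on_bounded_linear[OF bounded_linear_fst U_open])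
  ultimately show ?thesis unfolding Lg_def[abs_def] Lg'_def[abs_def]
    by (intro C1_on_Pair fP_C1)
qed

text \<open>On the 1-jet of \<open>u0\<close> injectivity of \<open>Lg\<close> is immediate, since
  its first component is \<open>x\<close>; injectivity of the derivative there is nondegeneracy of
  \<open>f_pp\<close>. The inverse therefore exists near the whole jet.\<close>

lemma legendre_inverse:
  obtains V gi gi' where "open V" "V \<subseteq> U" "\<And>x. x \<in> {a..b} \<Longrightarrow> z0 x \<in> V" "C1_on (Lg ` V) gi gi'"
    "\<And>z. z \<in> V \<Longrightarrow> gi (Lg z) = z" "\<And>z k. z \<in> V \<Longrightarrow> Lg' z (gi' (Lg z) k) = k"
proof -
  have K: "compact (z0 ` {a..b})" "z0 ` {a..b} \<subseteq> U"
    using z0_cont z0_U by (auto intro!: compact_continuous_image)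
  have inj: "inj_on Lg (z0 ` {a..b})" by (auto simp: inj_on_def Lg_def z0_def)
  have inj': "inj (Lg' z)" if zK: "z \<in> z0 ` {a..b}" for z
  proof -
    obtain x where x: "x \<in> {a..b}" "z = z0 x" using zK by blast
    have l: "linear (Lg' z)"
      using C1_on_linear_deriv[OF Lg_C1 z0_U[OF x(1)]] x by (simp add: linear_conv_bounded_linear)
    have "h = 0" if "Lg' z h = 0" for h
    proof -
      obtain s w q where h: "h = (s, w, q)" by (cases h)
      have sw: "s = 0" "w = 0" "DfP z h = 0" using that by (auto simp: Lg'_def h zero_prod_def)
      have "DfP (z0 x) (0, 0, q) = DfP (z0 x) (0, 0, 0)"
        using sw x linear_simps(3)[OF DfP_linear[OF z0_U[OF x(1)]]] by (simp add: h zero_prod_def)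
      from fpp_inj[OF x(1) this] sw show ?thesis by (simp add: h zero_prod_def)
    qed
    then show ?thesis using linear_injective_0[OF l] by blast
  qed
  from C1_inverse_near_compact[OF Lg_C1 K inj inj']
  obtain V g g' where V: "open V" "z0 ` {a..b} \<subseteq> V" "V \<subseteq> U" "inj_on Lg V" "C1_on (Lg ` V) g g'"
    "\<And>z. z \<in> V \<Longrightarrow> g (Lg z) = z" "\<And>z k. z \<in> V \<Longrightarrow> Lg' z (g' (Lg z) k) = k" by blast
  show thesis by (rule that[OF V(1,3) _ V(5,6,7)]) (use V(2) in auto)
qed

text \<open>Chooses the inverse and its domain once and for all, so that the vector field built from
  them can be defined inside the locale.\<close>

definition ham where "ham = (SOME (V, gi, gi'). open V \<and> V \<subseteq> U \<and> (\<forall>x\<in>{a..b}. z0 x \<in> V) \<and> C1_on (Lg ` V) gi gi' \<and>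
    (\<forall>z\<in>V. gi (Lg z) = z) \<and> (\<forall>z\<in>V. \<forall>k. Lg' z (gi' (Lg z) k) = k))"

definition V where "V = fst ham"
definition gi where "gi = fst (snd ham)"
definition gi' where "gi' = snd (snd ham)"

lemma V: "open V" "V \<subseteq> U" "\<And>x. x \<in> {a..b} \<Longrightarrow> z0 x \<in> V" "C1_on (Lg ` V) gi gi'"
    "\<And>z. z \<in> V \<Longrightarrow> gi (Lg z) = z" "\<And>z k. z \<in> V \<Longrightarrow> Lg' z (gi' (Lg z) k) = k"
proof -
  let ?P = "\<lambda>(V, gi, gi'). open V \<and> V \<subseteq> U \<and> (\<forall>x\<in>{a..b}. z0 x \<in> V) \<and> C1_on (Lg ` V) gi gi' \<and>
    (\<forall>z\<in>V. gi (Lg z) = z) \<and> (\<forall>z\<in>V. \<forall>k. Lg' z (gi' (Lg z) k) = k)"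
  obtain V1 g1 g1' where V1: "open V1" "V1 \<subseteq> U" "\<And>x. x \<in> {a..b} \<Longrightarrow> z0 x \<in> V1" "C1_on (Lg ` V1) g1 g1'"
    "\<And>z. z \<in> V1 \<Longrightarrow> g1 (Lg z) = z" "\<And>z k. z \<in> V1 \<Longrightarrow> Lg' z (g1' (Lg z) k) = k"
    using legendre_inverse by blast
  have "?P (V1, g1, g1')" using V1 by auto
  then have "?P ham" unfolding ham_def by (rule someI)
  then have P: "open V \<and> V \<subseteq> U \<and> (\<forall>x\<in>{a..b}. z0 x \<in> V) \<and> C1_on (Lg ` V) gi gi' \<and>
    (\<forall>z\<in>V. gi (Lg z) = z) \<and> (\<forall>z\<in>V. \<forall>k. Lg' z (gi' (Lg z) k) = k)"
    by (simp add: V_def gi_def gi'_def case_prod_unfold)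
  then show "open V" "V \<subseteq> U" "\<And>x. x \<in> {a..b} \<Longrightarrow> z0 x \<in> V" "C1_on (Lg ` V) gi gi'"
    "\<And>z. z \<in> V \<Longrightarrow> gi (Lg z) = z" "\<And>z k. z \<in> V \<Longrightarrow> Lg' z (gi' (Lg z) k) = k" by blast+
qed

definition \<Omega> where "\<Omega> = Lg ` V"
definition Q where "Q y = snd (snd (gi y))"
definition Q' where "Q' y h = snd (snd (gi' y h))"
definition G where "G y = (Q y, fU (gi y))"
definition G' where "G' y h = (Q' y h, DfU (gi y) (gi' y h))"

lemma gi_\<Omega>:
  assumes "(x, u, \<pi>) \<in> \<Omega>"
  shows "gi (x, u, \<pi>) = (x, u, Q (x, u, \<pi>))" "(x, u, Q (x, u, \<pi>)) \<in> U" "fP (x, u, Q (x, u, \<pi>)) = \<pi>"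
proof -
  obtain p where p: "(x, u, p) \<in> V" "fP (x, u, p) = \<pi>" using assms by (auto simp: \<Omega>_def Lg_def)
  have "gi (x, u, \<pi>) = (x, u, p)" using V(5)[OF p(1)] p(2) by (simp add: Lg_def)
  then show "gi (x, u, \<pi>) = (x, u, Q (x, u, \<pi>))" "(x, u, Q (x, u, \<pi>)) \<in> U" "fP (x, u, Q (x, u, \<pi>)) = \<pi>"
    using p V(2) by (auto simp: Q_def)
qed

lemma Q_C1: "C1_on \<Omega> Q Q'"
  unfolding \<Omega>_def Q_def[abs_def] Q'_def[abs_def]
  by (rule C1_on_compose[OF V(4) C1_on_bounded_linear[of "\<lambda>z. snd (snd z)" UNIV]]) (auto intro!: bounded_linear_intros)

lemma G_C1: "C1_on \<Omega> G G'"
  unfolding G_def[abs_def] G'_def[abs_def]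
proof (intro C1_on_Pair Q_C1)
  show "C1_on \<Omega> (\<lambda>y. fU (gi y)) (\<lambda>y h. DfU (gi y) (gi' y h))"
    unfolding \<Omega>_def by (rule C1_on_compose[OF V(4) fU_C1]) (use V in auto)
qed

lemma y0_\<Omega>: "x \<in> {a..b} \<Longrightarrow> (x, y0 x) \<in> \<Omega>"
  using V(3) by (force simp: \<Omega>_def Lg_def y0_def z0_def)

lemma gi_y0: "x \<in> {a..b} \<Longrightarrow> gi (x, y0 x) = z0 x"
  using V(5)[OF V(3)] by (simp add: Lg_def y0_def z0_def)

text \<open>The linearised system along \<open>u0\<close>: \<open>q\<close> is the velocity
  determined by \<open>f_pp q + f_pu w = k\<close>. For \<open>w = h\<close> and
  \<open>k = B h\<close> this is the Jacobi equation.\<close>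

lemma G'_y0:
  assumes x: "x \<in> {a..b}"
  obtains q where "G' (x, y0 x) (0, w, k) = (q, DfU (z0 x) (0, w, q))" "DfP (z0 x) (0, w, q) = k"
proof -
  have "Lg' (z0 x) (gi' (x, y0 x) (0, w, k)) = (0, w, k)"
    using V(6)[OF V(3)[OF x], of "(0, w, k)"] by (simp add: Lg_def y0_def z0_def)
  then obtain q where q: "gi' (x, y0 x) (0, w, k) = (0, w, q)" "DfP (z0 x) (0, w, q) = k"
    by (cases "gi' (x, y0 x) (0, w, k)") (auto simp: Lg'_def)
  then show thesis by (intro that[of q]) (simp_all add: G'_def Q'_def gi_y0[OF x])
qed

lemma y0_der: "x \<in> {a..b} \<Longrightarrow> (y0 has_vector_derivative G (x, y0 x)) (at x within {a..b})"
  unfolding G_def Q_def gi_y0 y0_def[abs_def]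
  using u0 EL by (auto intro!: has_vector_derivative_Pair simp: z0_def gi_y0[unfolded y0_def z0_def])

lemma y0_cont: "continuous_on {a..b} y0"
  by (rule has_vector_derivative_imp_continuous_on[OF y0_der])

lemma ode_tube_ex: obtains r where "ode_tube a b \<Omega> G G' y0 r"
proof -
  obtain r where "r > 0" "\<And>x y. x \<in> {a..b} \<Longrightarrow> dist y (y0 x) \<le> r \<Longrightarrow> (x, y) \<in> \<Omega>"
    using tube_in_open[OF C1_on_open[OF G_C1] y0_cont y0_\<Omega>] by blast
  then have "ode_tube a b \<Omega> G G' y0 r" by unfold_locales (use ab G_C1 y0_der in auto)
  then show thesis by (rule that)
qed

definition lin_ode where "lin_ode z \<longleftrightarrow> (\<forall>x\<in>{a..b}. (z has_vector_derivative G' (x, y0 x) (0, z x)) (at x within {a..b}))"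

definition Lc where "Lc = (SOME L. L > 0 \<and> (\<forall>x\<in>{a..b}. \<forall>h. norm (G' (x, y0 x) h) \<le> L * norm h))"

lemma Lc: "Lc > 0" "\<And>x h. x \<in> {a..b} \<Longrightarrow> norm (G' (x, y0 x) h) \<le> Lc * norm h"
proof -
  have "compact ((\<lambda>x. (x, y0 x)) ` {a..b})" "(\<lambda>x. (x, y0 x)) ` {a..b} \<subseteq> \<Omega>"
    using y0_\<Omega> by (auto intro!: compact_continuous_image continuous_intros y0_cont)
  from C1_on_bounded_deriv[OF G_C1 this] obtain L where
    "L > 0" "\<And>z h. z \<in> (\<lambda>x. (x, y0 x)) ` {a..b} \<Longrightarrow> norm (G' z h) \<le> L * norm h" by blast
  then have "\<exists>L. L > 0 \<and> (\<forall>x\<in>{a..b}. \<forall>h. norm (G' (x, y0 x) h) \<le> L * norm h)" by (intro exI[of _ L]) auto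
  then have "Lc > 0 \<and> (\<forall>x\<in>{a..b}. \<forall>h. norm (G' (x, y0 x) h) \<le> Lc * norm h)"
    unfolding Lc_def by (rule someI_ex)
  then show "Lc > 0" "\<And>x h. x \<in> {a..b} \<Longrightarrow> norm (G' (x, y0 x) h) \<le> Lc * norm h" by auto
qed

lemma G'_bl: "x \<in> {a..b} \<Longrightarrow> bounded_linear (\<lambda>h. G' (x, y0 x) (0, h))"
  by (rule bounded_linear_compose[OF C1_on_linear_deriv[OF G_C1 y0_\<Omega>]]) (auto intro!: bounded_linear_intros)

lemma lin_ode_ex: "\<exists>z. z a = \<eta> \<and> lin_ode z"
proof -
  have c: "continuous_on ({a..b} \<times> UNIV) (\<lambda>(x, h). G' (x, y0 x) (0, h))"
    unfolding case_prod_unfold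
    by (intro C1_on_continuous_deriv_compose[OF G_C1] continuous_intros continuous_on_compose2[OF y0_cont]) (use y0_\<Omega> in auto)
  have lip: "norm (G' (x, y0 x) (0, y) - G' (x, y0 x) (0, z)) \<le> Lc * norm (y - z)" if "x \<in> {a..b}" for x y z
    using Lc(2)[OF that, of "(0, y - z)"] linear_simps(2)[OF G'_bl[OF that], of y z] by (simp add: norm_Pair)
  obtain Z where "Z a = \<eta>" "\<And>x. x \<in> {a..b} \<Longrightarrow> (Z has_vector_derivative G' (x, y0 x) (0, Z x)) (at x within {a..b})"
    using picard_lindelof[OF less_imp_le[OF ab] Lc(1) c lip] by blast
  then show ?thesis by (auto simp: lin_ode_def)
qed

text \<open>The propagator of the linearised system from \<open>a\<close> to \<open>x\<close>;
  uniqueness makes it linear in \<open>\<eta>\<close>.\<close>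

definition Sol where "Sol x \<eta> = (SOME z. z a = \<eta> \<and> lin_ode z) x"

lemma Sol: "Sol a \<eta> = \<eta>" "\<And>x. x \<in> {a..b} \<Longrightarrow> ((\<lambda>x. Sol x \<eta>) has_vector_derivative G' (x, y0 x) (0, Sol x \<eta>)) (at x within {a..b})"
  using someI_ex[OF lin_ode_ex[of \<eta>]] unfolding Sol_def[abs_def] lin_ode_def by auto

definition Kc where "Kc = growth a b Lc"

lemma Kc: "Kc > 0" using ab by (simp add: Kc_def growth_pos)

lemma lin_ode_bound:
  assumes "lin_ode z" "x \<in> {a..b}" shows "norm (z x) \<le> Kc * norm (z a)"
proof -
  have "norm (z x) \<le> growth a b Lc * (norm (z a) + 0)"
  proof (rule norm_le_growth[OF assms(2), where w' = "\<lambda>x. G' (x, y0 x) (0, z x)"])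
    show "norm (G' (x, y0 x) (0, z x)) \<le> Lc * norm (z x) + 0" if "x \<in> {a..b}" for x
      using Lc(2)[OF that, of "(0, z x)"] by (simp add: norm_Pair)
  qed (use assms(1) Lc in \<open>auto simp: lin_ode_def\<close>)
  then show ?thesis by (simp add: Kc_def)
qed

lemma lin_ode_Sol: "lin_ode (\<lambda>x. Sol x \<eta>)" using Sol by (simp add: lin_ode_def)

lemma lin_ode_diff: "lin_ode z \<Longrightarrow> lin_ode w \<Longrightarrow> lin_ode (\<lambda>x. z x - w x)"
  unfolding lin_ode_def using linear_simps(2)[OF G'_bl] by (auto intro!: has_vector_derivative_diff)

lemma lin_ode_add: "lin_ode z \<Longrightarrow> lin_ode w \<Longrightarrow> lin_ode (\<lambda>x. z x + w x)"
  unfolding lin_ode_def using linear_simps(1)[OF G'_bl] by (auto intro!: has_vector_derivative_add)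

lemma lin_ode_scaleR: "lin_ode z \<Longrightarrow> lin_ode (\<lambda>x. t *\<^sub>R z x)"
  unfolding lin_ode_def using linear_simps(5)[OF G'_bl]
  by (auto intro!: bounded_linear.has_vector_derivative[OF bounded_linear_scaleR_right])

lemma lin_ode_eq_Sol:
  assumes "lin_ode z" "x \<in> {a..b}" shows "z x = Sol x (z a)"
  using lin_ode_bound[OF lin_ode_diff[OF assms(1) lin_ode_Sol[of "z a"]] assms(2)] by (simp add: Sol)

lemma Sol_linear: "x \<in> {a..b} \<Longrightarrow> linear (Sol x)"
proof (rule linearI)
  assume x: "x \<in> {a..b}"
  show "Sol x (\<eta> + \<theta>) = Sol x \<eta> + Sol x \<theta>" for \<eta> \<theta>
    using lin_ode_eq_Sol[OF lin_ode_add[OF lin_ode_Sol[of \<eta>] lin_ode_Sol[of \<theta>]] x] by (simp add: Sol)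
  show "Sol x (t *\<^sub>R \<eta>) = t *\<^sub>R Sol x \<eta>" for t \<eta>
    using lin_ode_eq_Sol[OF lin_ode_scaleR[OF lin_ode_Sol[of \<eta>], of t] x] by (simp add: Sol)
qed

lemma Sol_bound: "x \<in> {a..b} \<Longrightarrow> norm (Sol x \<eta>) \<le> Kc * norm \<eta>"
  using lin_ode_bound[OF lin_ode_Sol[of \<eta>]] by (simp add: Sol)

lemma Sol_cont_x: "continuous_on {a..b} (\<lambda>x. Sol x \<eta>)"
  by (rule has_vector_derivative_imp_continuous_on[OF Sol(2)])

lemma Sol_cont: "continuous_on ({a..b} \<times> UNIV) (\<lambda>(x, \<eta>). Sol x \<eta>)"
proof (rule continuous_on_eq)
  show "continuous_on ({a..b} \<times> UNIV) (\<lambda>t. \<Sum>e\<in>Basis. (snd t \<bullet> e) *\<^sub>R Sol (fst t) e)"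
    by (intro continuous_intros continuous_on_compose2[OF Sol_cont_x]) auto
  show "(\<Sum>e\<in>Basis. (snd t \<bullet> e) *\<^sub>R Sol (fst t) e) = (\<lambda>(x, \<eta>). Sol x \<eta>) t" if t: "t \<in> {a..b} \<times> UNIV" for t
  proof -
    have l: "linear (Sol (fst t))" using t by (intro Sol_linear) auto
    have "Sol (fst t) (snd t) = Sol (fst t) (\<Sum>e\<in>Basis. (snd t \<bullet> e) *\<^sub>R e)" by (simp add: euclidean_representation)
    then show ?thesis by (simp add: linear_sum[OF l] linear_scale[OF l] case_prod_unfold)
  qed
qed

section \<open>Zeros of Jacobi fields near the left end point\<close>

text \<open>First-order Taylor expansion at \<open>a\<close>, uniform in the initial value. The mean
  value inequality is used twice: for the change of \<open>Sol _ \<eta>\<close>, and then for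
  \<open>Sol _ \<eta>\<close> minus its tangent.\<close>

lemma Sol_expansion:
  assumes "\<epsilon> > 0"
  obtains \<kappa> where "\<kappa> > 0" "\<kappa> \<le> b - a" "\<And>x \<eta>. a \<le> x \<Longrightarrow> x \<le> a + \<kappa> \<Longrightarrow>
    norm (Sol x \<eta> - \<eta> - (x - a) *\<^sub>R G' (a, y0 a) (0, \<eta>)) \<le> \<epsilon> * (x - a) * norm \<eta>"
proof -
  have a: "a \<in> {a..b}" using ab by simp
  have cp: "compact ((\<lambda>x. (x, y0 x)) ` {a..b})" "(\<lambda>x. (x, y0 x)) ` {a..b} \<subseteq> \<Omega>"
    using y0_\<Omega> by (auto intro!: compact_continuous_image continuous_intros y0_cont)
  have "\<epsilon> / 2 > 0" using assms by simp
  from C1_on_uniform_deriv[OF G_C1 cp this] obtain d where d: "d > 0"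
    "\<And>z w h. z \<in> (\<lambda>x. (x, y0 x)) ` {a..b} \<Longrightarrow> w \<in> (\<lambda>x. (x, y0 x)) ` {a..b} \<Longrightarrow> dist z w < d \<Longrightarrow> norm (G' z h - G' w h) \<le> \<epsilon> / 2 * norm h"
    by blast
  have "continuous_on {a..b} (\<lambda>x. (x, y0 x))" by (intro continuous_intros y0_cont)
  then obtain d2 where d2: "d2 > 0" "\<And>x. x \<in> {a..b} \<Longrightarrow> dist x a < d2 \<Longrightarrow> dist (x, y0 x) (a, y0 a) < d"
    unfolding continuous_on_iff using a d(1) by blast
  \<comment> \<open>\<open>d2\<close> controls the change of the coefficients, the last bound that
    of the solution; each contributes \<open>\<epsilon> / 2\<close>. Halving \<open>d2\<close> makes
    \<open>dist s a < d2\<close> strict.\<close>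
  define \<kappa> where "\<kappa> = min (min (d2 / 2) (b - a)) (\<epsilon> / (2 * (Lc * (Lc * Kc))))"
  have k: "\<kappa> > 0" using d2 ab assms Lc(1) Kc by (simp add: \<kappa>_def)
  show thesis
  proof (rule that[OF k])
    show "\<kappa> \<le> b - a" by (simp add: \<kappa>_def)
    fix x \<eta> assume x: "a \<le> x" "x \<le> a + \<kappa>"
    have sub: "{a..x} \<subseteq> {a..b}" using x by (auto simp: \<kappa>_def)
    have S1: "norm (Sol t \<eta> - \<eta>) \<le> Lc * Kc * norm \<eta> * (t - a)" if t: "t \<in> {a..x}" for t
    proof -
      have "norm (Sol t \<eta> - Sol a \<eta>) \<le> Lc * Kc * norm \<eta> * norm (t - a)"
      proof (rule differentiable_bound[of "{a..x}" "\<lambda>t. Sol t \<eta>" "\<lambda>t h. h *\<^sub>R G' (t, y0 t) (0, Sol t \<eta>)"])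
        fix s assume s: "s \<in> {a..x}"
        then have sab: "s \<in> {a..b}" using sub by blast
        show "((\<lambda>t. Sol t \<eta>) has_derivative (\<lambda>h. h *\<^sub>R G' (s, y0 s) (0, Sol s \<eta>))) (at s within {a..x})"
          using has_vector_derivative_within_subset[OF Sol(2)[OF sab] sub] by (simp add: has_vector_derivative_def)
        have "norm (G' (s, y0 s) (0, Sol s \<eta>)) \<le> Lc * norm (Sol s \<eta>)"
          using Lc(2)[OF sab, of "(0, Sol s \<eta>)"] by (simp add: norm_Pair)
        also have "\<dots> \<le> Lc * (Kc * norm \<eta>)" using Lc(1) Sol_bound[OF sab] by (intro mult_left_mono) auto
        finally have n: "norm (G' (s, y0 s) (0, Sol s \<eta>)) \<le> Lc * Kc * norm \<eta>" by simp
        show "onorm (\<lambda>h. h *\<^sub>R G' (s, y0 s) (0, Sol s \<eta>)) \<le> Lc * Kc * norm \<eta>"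
        proof (rule onorm_bound)
          show "norm (h *\<^sub>R G' (s, y0 s) (0, Sol s \<eta>)) \<le> Lc * Kc * norm \<eta> * norm h" for h
            using mult_left_mono[OF n, of "\<bar>h\<bar>"] by (simp add: mult.commute)
        qed (use Lc(1) Kc in auto)
      qed (use t x in auto)
      then show ?thesis using t by (simp add: Sol)
    qed
    define A where "A = G' (a, y0 a) (0, \<eta>)"
    have "norm ((Sol x \<eta> - (x - a) *\<^sub>R A) - (Sol a \<eta> - (a - a) *\<^sub>R A)) \<le> \<epsilon> * norm \<eta> * norm (x - a)"
    proof (rule differentiable_bound[of "{a..x}" "\<lambda>t. Sol t \<eta> - (t - a) *\<^sub>R A" "\<lambda>t h. h *\<^sub>R (G' (t, y0 t) (0, Sol t \<eta>) - A)"])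
      fix s assume s: "s \<in> {a..x}"
      then have sab: "s \<in> {a..b}" using sub by blast
      have "((\<lambda>t. Sol t \<eta> - (t - a) *\<^sub>R A) has_vector_derivative G' (s, y0 s) (0, Sol s \<eta>) - A) (at s within {a..x})"
        by (intro has_vector_derivative_diff has_vector_derivative_within_subset[OF Sol(2)[OF sab] sub])
          (auto intro!: derivative_eq_intros)
      then show "((\<lambda>t. Sol t \<eta> - (t - a) *\<^sub>R A) has_derivative (\<lambda>h. h *\<^sub>R (G' (s, y0 s) (0, Sol s \<eta>) - A))) (at s within {a..x})"
        by (simp add: has_vector_derivative_def)
      have "norm (G' (s, y0 s) (0, Sol s \<eta>) - G' (s, y0 s) (0, \<eta>)) \<le> Lc * norm (Sol s \<eta> - \<eta>)"
        using Lc(2)[OF sab, of "(0, Sol s \<eta> - \<eta>)"] linear_simps(2)[OF G'_bl[OF sab], of "Sol s \<eta>" \<eta>] by (simp add: norm_Pair)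
      also have "\<dots> \<le> Lc * (Lc * Kc * norm \<eta> * (s - a))" using S1[OF s] Lc(1) by (intro mult_left_mono) auto
      also have "\<dots> = (Lc * (Lc * Kc)) * (s - a) * norm \<eta>" by simp
      also have "\<dots> \<le> \<epsilon> / 2 * norm \<eta>"
      proof (intro mult_right_mono)
        have "s - a \<le> \<epsilon> / (2 * (Lc * (Lc * Kc)))" using s x by (auto simp: \<kappa>_def)
        then show "(Lc * (Lc * Kc)) * (s - a) \<le> \<epsilon> / 2" using Lc(1) Kc by (simp add: field_simps)
      qed simp
      finally have 1: "norm (G' (s, y0 s) (0, Sol s \<eta>) - G' (s, y0 s) (0, \<eta>)) \<le> \<epsilon> / 2 * norm \<eta>" .
      have "dist s a < d2" using s x d2(1) by (auto simp: \<kappa>_def dist_real_def)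
      then have "norm (G' (s, y0 s) (0, \<eta>) - G' (a, y0 a) (0, \<eta>)) \<le> \<epsilon> / 2 * norm (0::real, \<eta>)"
        using sab a by (intro d(2) d2(2)) auto
      then have 2: "norm (G' (s, y0 s) (0, \<eta>) - A) \<le> \<epsilon> / 2 * norm \<eta>" by (simp add: A_def norm_Pair)
      have n: "norm (G' (s, y0 s) (0, Sol s \<eta>) - A) \<le> \<epsilon> * norm \<eta>"
        using norm_diff_triangle_le[OF 1 2] by (simp add: field_simps)
      show "onorm (\<lambda>h. h *\<^sub>R (G' (s, y0 s) (0, Sol s \<eta>) - A)) \<le> \<epsilon> * norm \<eta>"
      proof (rule onorm_bound)
        show "norm (h *\<^sub>R (G' (s, y0 s) (0, Sol s \<eta>) - A)) \<le> \<epsilon> * norm \<eta> * norm h" for h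
          using mult_left_mono[OF n, of "\<bar>h\<bar>"] by (simp add: mult.commute)
      qed (use assms in auto)
    qed (use x in auto)
    then show "norm (Sol x \<eta> - \<eta> - (x - a) *\<^sub>R G' (a, y0 a) (0, \<eta>)) \<le> \<epsilon> * (x - a) * norm \<eta>"
      using x by (simp add: Sol A_def algebra_simps)
  qed
qed

text \<open>With \<open>q = h' a\<close>, a zero of \<open>h\<close> at \<open>x = a + y\<close> means \<open>h a \<approx> - y *\<^sub>R q\<close>, so that \<open>h a\<close> is small
  compared with \<open>q\<close>; pairing with \<open>k a = f\<^sub>p\<^sub>p q + f\<^sub>p\<^sub>u (h a)\<close> then contradicts the Legendre condition.\<close>
lemma no_zero_near_a:
  obtains \<kappa> where "\<kappa> > 0" "\<kappa> \<le> b - a"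
    "\<And>x h k. a < x \<Longrightarrow> x \<le> a + \<kappa> \<Longrightarrow> h \<bullet> k \<ge> 0 \<Longrightarrow> fst (Sol x (h, k)) = 0 \<Longrightarrow> h = 0 \<and> k = 0"
proof -
  have a: "a \<in> {a..b}" using ab by simp
  obtain \<Lambda> where \<Lambda>: "\<Lambda> \<ge> 1" "\<And>h. norm (DfP (z0 a) h) \<le> \<Lambda> * norm h"
  proof -
    obtain B where "\<And>h. norm (DfP (z0 a) h) \<le> norm h * B"
      using bounded_linear.bounded[OF DfP_linear[OF z0_U[OF a]]] by blast
    then have "norm (DfP (z0 a) h) \<le> max 1 B * norm h" for h
      using mult_left_mono[of B "max 1 B" "norm h"] by (metis (no_types) max.cobounded2 mult.commute norm_ge_zero order_trans)
    then show thesis by (intro that[of "max 1 B"]) auto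
  qed
  \<comment> \<open>\<open>C\<close> is the constant in \<open>norm h \<le> C * y * norm q\<close>.
    The 16 in \<open>\<epsilon>\<close> keeps the Taylor error paired with \<open>k\<close> below
    \<open>y * (c0 / 2)\<close>, the last bound in \<open>\<kappa>\<close> keeps the cross term
    below \<open>c0 / 4\<close>, both relative to \<open>(norm q)\<^sup>2\<close>; a positive
    \<open>c0 / 4\<close> remains.\<close>
  define C where "C = 2 * (1 + \<Lambda>)"
  define \<epsilon> where "\<epsilon> = min 1 (c0 / (16 * \<Lambda> * \<Lambda>))"
  have e: "\<epsilon> > 0" "\<epsilon> \<le> 1" "\<epsilon> * (16 * \<Lambda> * \<Lambda>) \<le> c0"
  proof -
    have "\<epsilon> \<le> c0 / (16 * \<Lambda> * \<Lambda>)" by (simp add: \<epsilon>_def)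
    then show "\<epsilon> * (16 * \<Lambda> * \<Lambda>) \<le> c0" using \<Lambda>(1) by (simp add: pos_le_divide_eq)
  qed (use c0 \<Lambda>(1) in \<open>auto simp: \<epsilon>_def\<close>)
  obtain \<kappa>1 where k1: "\<kappa>1 > 0" "\<kappa>1 \<le> b - a" "\<And>x \<eta>. a \<le> x \<Longrightarrow> x \<le> a + \<kappa>1 \<Longrightarrow>
    norm (Sol x \<eta> - \<eta> - (x - a) *\<^sub>R G' (a, y0 a) (0, \<eta>)) \<le> \<epsilon> * (x - a) * norm \<eta>"
    using Sol_expansion[OF e(1)] by blast
  define \<kappa> where "\<kappa> = min \<kappa>1 (min (1 / C) (c0 / (4 * \<Lambda> * C)))"
  have C: "C > 0" using \<Lambda>(1) by (simp add: C_def)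
  have k: "\<kappa> > 0" "\<kappa> \<le> \<kappa>1" "\<kappa> * C \<le> 1" "\<kappa> * (4 * \<Lambda> * C) \<le> c0"
  proof -
    have "\<kappa> \<le> 1 / C" "\<kappa> \<le> c0 / (4 * \<Lambda> * C)" by (auto simp: \<kappa>_def)
    then show "\<kappa> * C \<le> 1" "\<kappa> * (4 * \<Lambda> * C) \<le> c0" using C \<Lambda>(1) by (simp_all add: pos_le_divide_eq)
  qed (use k1 c0 C \<Lambda>(1) in \<open>auto simp: \<kappa>_def\<close>)
  show thesis
  proof (rule that[of \<kappa>])
    show "\<kappa> > 0" by fact
    show "\<kappa> \<le> b - a" using k k1 by simp
    fix x h k assume x: "a < x" "x \<le> a + \<kappa>" and hk: "h \<bullet> k \<ge> 0" and zero: "fst (Sol x (h, k)) = 0"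
    define y where "y = x - a"
    have y: "y > 0" "y \<le> \<kappa>" using x by (auto simp: y_def)
    obtain q where q: "G' (a, y0 a) (0, h, k) = (q, DfU (z0 a) (0, h, q))" "DfP (z0 a) (0, h, q) = k"
      using G'_y0[OF a] by blast
    define E where "E = Sol x (h, k) - (h, k) - y *\<^sub>R G' (a, y0 a) (0, h, k)"
    have nE: "norm E \<le> \<epsilon> * y * norm (h, k)" unfolding E_def y_def using x k(2) by (intro k1(3)) auto
    have fE: "fst E = - h - y *\<^sub>R q" using zero by (simp add: E_def q)
    have nhk: "norm (h, k) \<le> norm h + norm k" by (rule norm_Pair_le)
    have fE2: "norm (h + y *\<^sub>R q) \<le> \<epsilon> * y * (norm h + norm k)"
    proof -
      have "norm (h + y *\<^sub>R q) = norm (fst E)" using norm_minus_cancel[of "h + y *\<^sub>R q"] by (simp add: fE)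
      also have "\<dots> \<le> norm E" by (metis norm_fst_le prod.collapse)
      also have "\<dots> \<le> \<epsilon> * y * (norm h + norm k)"
        using nE nhk e y by (meson mult_left_mono mult_nonneg_nonneg less_imp_le order_trans)
      finally show ?thesis .
    qed
    have nk: "norm k \<le> \<Lambda> * (norm h + norm q)"
    proof -
      have "norm (0::real, h, q) \<le> norm h + norm q" using norm_Pair_le[of h q] by (simp add: norm_Pair)
      then show ?thesis using \<Lambda>(2)[of "(0, h, q)"] \<Lambda>(1) q(2) by (smt (verit) mult_left_mono)
    qed
    have nh: "norm h \<le> C * y * norm q"
    proof -
      have "norm h \<le> y * norm q + \<epsilon> * y * (norm h + norm k)"
        using fE2 norm_triangle_ineq4[of "h + y *\<^sub>R q" "y *\<^sub>R q"] y by simp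
      also have "\<dots> \<le> y * norm q + 1 * y * (norm h + \<Lambda> * (norm h + norm q))"
        using e y nk by (intro add_mono mult_mono order_refl) auto
      finally have "norm h * (1 - y * (1 + \<Lambda>)) \<le> y * (1 + \<Lambda>) * norm q" by (simp add: algebra_simps)
      moreover have "y * (1 + \<Lambda>) \<le> 1 / 2"
      proof -
        have "y * C \<le> \<kappa> * C" using y C by (intro mult_right_mono) auto
        then show ?thesis using k(3) by (simp add: C_def algebra_simps)
      qed
      then have "norm h * (1 / 2) \<le> norm h * (1 - y * (1 + \<Lambda>))" by (intro mult_left_mono) auto
      ultimately show ?thesis by (simp add: C_def algebra_simps)
    qed
    have "C * y \<le> C * \<kappa>" using y(2) C by simp
    then have Cy: "C * y \<le> 1" using k(3) unfolding mult.commute[of \<kappa>] by linarith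
    have nh1: "norm h \<le> norm q" using nh mult_right_mono[OF Cy, of "norm q"] by simp
    have "\<Lambda> * norm h \<le> \<Lambda> * norm q" using nh1 \<Lambda>(1) by (intro mult_left_mono) auto
    then have nk1: "norm k \<le> 2 * \<Lambda> * norm q" using nk unfolding distrib_left by linarith
    have qk: "c0 * (norm q)\<^sup>2 - \<Lambda> * norm h * norm q \<le> q \<bullet> k"
    proof -
      have "k = DfP (z0 a) (0, h, 0) + DfP (z0 a) (0, 0, q)"
        using linear_simps(1)[OF DfP_linear[OF z0_U[OF a]], of "(0, h, 0)" "(0, 0, q)"] q(2) by simp
      then have "q \<bullet> k = DfP (z0 a) (0, h, 0) \<bullet> q + DfP (z0 a) (0, 0, q) \<bullet> q" by (simp add: inner_add_right inner_commute)
      moreover have "\<bar>DfP (z0 a) (0, h, 0) \<bullet> q\<bar> \<le> \<Lambda> * norm h * norm q"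
        using Cauchy_Schwarz_ineq2[of "DfP (z0 a) (0, h, 0)" q] mult_right_mono[OF \<Lambda>(2)[of "(0, h, 0)"], of "norm q"]
        by (simp add: norm_Pair)
      ultimately show ?thesis using coercive[OF a, of q] by (simp add: z0_def)
    qed
    \<comment> \<open>At the zero this sum is only the Taylor error. The hypothesis
      \<open>h \<bullet> k \<ge> 0\<close> allows its first part to be dropped, which bounds
      \<open>q \<bullet> k\<close> from above.\<close>
    have "(h + y *\<^sub>R q) \<bullet> k \<le> norm (h + y *\<^sub>R q) * norm k" by (rule norm_cauchy_schwarz)
    also have "\<dots> \<le> \<epsilon> * y * (norm h + norm k) * norm k" by (intro mult_right_mono fE2) auto
    also have "\<dots> \<le> \<epsilon> * y * (4 * \<Lambda> * norm q) * (2 * \<Lambda> * norm q)"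
    proof (intro mult_mono mult_left_mono)
      have "norm q \<le> \<Lambda> * norm q" using mult_right_mono[OF \<Lambda>(1), of "norm q"] by simp
      then show "norm h + norm k \<le> 4 * \<Lambda> * norm q" using nh1 nk1 norm_ge_zero[of q] by linarith
    qed (use nk1 e y \<Lambda>(1) in auto)
    also have "\<dots> = y * (\<epsilon> * (16 * \<Lambda> * \<Lambda>) / 2 * (norm q)\<^sup>2)" by (simp add: power2_eq_square)
    also have "\<dots> \<le> y * (c0 / 2 * (norm q)\<^sup>2)" using e y by (intro mult_left_mono mult_right_mono divide_right_mono) auto
    finally have "h \<bullet> k + y * (q \<bullet> k) \<le> y * (c0 / 2 * (norm q)\<^sup>2)" by (simp add: inner_add_left)
    then have "y * (q \<bullet> k) \<le> y * (c0 / 2 * (norm q)\<^sup>2)" using hk by linarith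
    then have "q \<bullet> k \<le> c0 / 2 * (norm q)\<^sup>2" using y by simp
    moreover have "\<Lambda> * norm h * norm q \<le> c0 / 4 * (norm q)\<^sup>2"
    proof -
      have "\<Lambda> * norm h * norm q \<le> \<Lambda> * (C * y * norm q) * norm q" using nh \<Lambda>(1) by (intro mult_right_mono mult_left_mono) auto
      also have "\<dots> = (y * (4 * \<Lambda> * C)) / 4 * (norm q)\<^sup>2" by (simp add: power2_eq_square)
      also have "\<dots> \<le> c0 / 4 * (norm q)\<^sup>2"
      proof (intro mult_right_mono divide_right_mono)
        have "y * (4 * \<Lambda> * C) \<le> \<kappa> * (4 * \<Lambda> * C)" using y(2) C \<Lambda>(1) by (intro mult_right_mono) auto
        then show "y * (4 * \<Lambda> * C) \<le> c0" using k(4) by linarith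
      qed auto
      finally show ?thesis .
    qed
    ultimately have "c0 / 4 * (norm q)\<^sup>2 \<le> 0" using qk by (simp add: algebra_simps)
    then have "q = 0" using c0 by (simp add: mult_le_0_iff)
    then show "h = 0 \<and> k = 0" using nh1 nk1 by simp
  qed
qed

end

section \<open>Construction of a field\<close>

lemma closed_RD: "closed (RD ID :: (real^'n) set)"
proof -
  have "RD ID = (\<Inter>i\<in>ID. {\<xi>::real^'n. \<xi> $ i = 0})" by (auto simp: RD_def)
  moreover have "closed {\<xi>::real^'n. \<xi> $ i = 0}" for i by (intro closed_Collect_eq continuous_intros)
  ultimately show ?thesis by auto
qed

lemma RD_scaleR: "\<xi> \<in> RD ID \<Longrightarrow> t *\<^sub>R \<xi> \<in> RD ID" by (simp add: RD_def)

section \<open>Persistence of nondegeneracy and positivity under small perturbations\<close>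

text \<open>Turns a statement at \<open>t = 0\<close> into one for all small \<open>t\<close>: the
  bad set is compact with empty fibre over 0, so its projection is closed and misses 0.\<close>

lemma compact_avoid_fst:
  fixes D :: "(real \<times> 'a::metric_space) set"
  assumes "compact D" "\<And>y. (0, y) \<notin> D"
  obtains d where "d > 0" "\<And>t y. \<bar>t\<bar> < d \<Longrightarrow> (t, y) \<notin> D"
proof -
  have "compact (fst ` D)" by (intro compact_continuous_image assms continuous_intros)
  then have "open (- fst ` D)" by (simp add: compact_imp_closed open_Compl)
  moreover have "0 \<in> - fst ` D" using assms(2) by force
  ultimately obtain d where "d > 0" "ball 0 d \<subseteq> - fst ` D" using openE by blast
  then show thesis by (intro that[of d]) force+
qed

text \<open>Positivity is known where \<open>T\<close> meets the linear condition, whereas the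
  condition is imposed on \<open>h\<close>. For a sequence of counterexamples the normalised
  parameters subconverge to some \<open>l\<close>, and \<open>h\<close> divided by the norm of the
  parameter converges to \<open>T l\<close>. As \<open>RD ID\<close> is closed and invariant under
  scaling, it contains \<open>fst (T l)\<close>, and the limiting form would be both positive and
  nonpositive.\<close>

lemma positive_form_near_0:
  fixes h T :: "real^'n \<Rightarrow> (real^'n) \<times> (real^'n)"
  assumes h: "(h has_derivative T) (at 0)" "h 0 = 0"
    and pos: "\<And>c. c \<noteq> 0 \<Longrightarrow> fst (T c) \<in> RD ID \<Longrightarrow> snd (T c) \<bullet> fst (T c) > 0"
  obtains r where "r > 0" "\<And>\<alpha>. norm \<alpha> < r \<Longrightarrow> fst (h \<alpha>) \<in> RD ID \<Longrightarrow> snd (h \<alpha>) \<bullet> fst (h \<alpha>) \<ge> 0"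
proof -
  have "\<exists>n. \<forall>\<alpha>. norm \<alpha> < inverse (real (Suc n)) \<longrightarrow> fst (h \<alpha>) \<in> RD ID \<longrightarrow> snd (h \<alpha>) \<bullet> fst (h \<alpha>) \<ge> 0"
  proof (rule ccontr)
    assume "\<not> ?thesis"
    then obtain \<alpha> where \<alpha>: "\<And>n. norm (\<alpha> n) < inverse (real (Suc n))" "\<And>n. fst (h (\<alpha> n)) \<in> RD ID"
      "\<And>n. snd (h (\<alpha> n)) \<bullet> fst (h (\<alpha> n)) < 0" by (metis not_le)
    have nz: "\<alpha> n \<noteq> 0" for n using \<alpha>(3)[of n] h(2) by auto
    define u where "u = (\<lambda>n. \<alpha> n /\<^sub>R norm (\<alpha> n))"
    have "\<And>n. u n \<in> sphere 0 1" using nz by (simp add: u_def)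
    then obtain l \<sigma> where l: "l \<in> sphere 0 1" "strict_mono (\<sigma> :: nat \<Rightarrow> nat)" "(u \<circ> \<sigma>) \<longlonglongrightarrow> l"
      using compact_sphere[of "0::real^'n" 1] unfolding compact_def by (metis (no_types, lifting))
    have bl: "bounded_linear T" using h(1) by (rule has_derivative_bounded_linear)
    have "(\<lambda>n. \<alpha> n) \<longlonglongrightarrow> 0"
      by (rule Lim_null_comparison[OF _ LIMSEQ_inverse_real_of_nat]) (use \<alpha>(1) in \<open>auto intro!: always_eventually less_imp_le\<close>)
    then have fl: "filterlim \<alpha> (at 0) sequentially" using nz by (auto simp: filterlim_at)
    have "((\<lambda>y. norm (h y - h 0 - T (y - 0)) / norm (y - 0)) \<longlongrightarrow> 0) (at 0)"
      using h(1) unfolding has_derivative_iff_norm by blast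
    from filterlim_compose[OF this fl]
    have "(\<lambda>n. norm (h (\<alpha> n) - T (\<alpha> n)) / norm (\<alpha> n)) \<longlonglongrightarrow> 0" by (simp add: h(2))
    moreover have "norm (h (\<alpha> n) - T (\<alpha> n)) / norm (\<alpha> n) = norm (h (\<alpha> n) /\<^sub>R norm (\<alpha> n) - T (u n))" for n
    proof -
      have "h (\<alpha> n) /\<^sub>R norm (\<alpha> n) - T (u n) = (h (\<alpha> n) - T (\<alpha> n)) /\<^sub>R norm (\<alpha> n)"
        by (simp add: u_def linear_simps[OF bl] scaleR_diff_right)
      then show ?thesis by (simp add: divide_inverse mult.commute)
    qed
    ultimately have "(\<lambda>n. h (\<alpha> n) /\<^sub>R norm (\<alpha> n) - T (u n)) \<longlonglongrightarrow> 0"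
      by (simp add: tendsto_norm_zero_iff)
    from LIMSEQ_subseq_LIMSEQ[OF this l(2)]
    have 1: "(\<lambda>n. h (\<alpha> (\<sigma> n)) /\<^sub>R norm (\<alpha> (\<sigma> n)) - T (u (\<sigma> n))) \<longlonglongrightarrow> 0" by (simp add: o_def)
    have "(\<lambda>n. T (u (\<sigma> n))) \<longlonglongrightarrow> T l" using bounded_linear.tendsto[OF bl l(3)] by (simp add: o_def)
    from tendsto_add[OF 1 this] have g: "(\<lambda>n. h (\<alpha> (\<sigma> n)) /\<^sub>R norm (\<alpha> (\<sigma> n))) \<longlonglongrightarrow> T l" by simp
    have "fst (T l) \<in> RD ID"
      by (rule closed_sequentially[OF closed_RD _ tendsto_fst[OF g]]) (simp add: RD_scaleR \<alpha>(2))
    moreover have "l \<noteq> 0" using l(1) by auto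
    ultimately have "snd (T l) \<bullet> fst (T l) > 0" using pos by blast
    moreover have "snd (T l) \<bullet> fst (T l) \<le> 0"
    proof (rule LIMSEQ_le_const2[OF tendsto_inner[OF tendsto_snd[OF g] tendsto_fst[OF g]]], intro exI allI impI)
      fix n show "snd (h (\<alpha> (\<sigma> n)) /\<^sub>R norm (\<alpha> (\<sigma> n))) \<bullet> fst (h (\<alpha> (\<sigma> n)) /\<^sub>R norm (\<alpha> (\<sigma> n))) \<le> 0"
        using \<alpha>(3)[of "\<sigma> n"] by (simp add: mult_nonneg_nonpos less_imp_le)
    qed
    ultimately show False by simp
  qed
  then obtain n where "\<And>\<alpha>. norm \<alpha> < inverse (real (Suc n)) \<Longrightarrow> fst (h \<alpha>) \<in> RD ID \<Longrightarrow> snd (h \<alpha>) \<bullet> fst (h \<alpha>) \<ge> 0" by blast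
  then show thesis by (intro that[of "inverse (real (Suc n))"]) auto
qed

text \<open>Initial data of the field: \<open>h a\<close> and \<open>k a\<close>. The momentum depends affinely and diagonally on
  the initial position, which makes the conditions at \<open>a\<close> trivial; \<open>\<delta> = 0\<close> gives the initial
  data of the Jacobi fields in the hypothesis, \<open>\<delta> > 0\<close> removes their degeneracy at \<open>a\<close>.\<close>
definition init :: "'n set \<Rightarrow> real \<Rightarrow> real^'n \<Rightarrow> (real^'n) \<times> (real^'n)" where
  "init ID \<delta> c = ((\<chi> i. if i \<in> ID then \<delta> * c $ i else c $ i), (\<chi> i. if i \<in> ID then c $ i else 0))"

lemma init_bounded_linear: "bounded_linear (init ID \<delta>)"
  unfolding linear_conv_bounded_linear[symmetric]
  by (rule linearI) (auto simp: init_def vec_eq_iff algebra_simps)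

lemma init_inner: "\<delta> \<ge> 0 \<Longrightarrow> fst (init ID \<delta> c) \<bullet> snd (init ID \<delta> c) \<ge> 0"
  unfolding init_def inner_vec_def
  using mult_nonneg_nonneg[of \<delta> "c $ i * c $ i" for i] by (auto simp: mult.assoc intro!: sum_nonneg)

lemma init_eq_0: "fst (init ID \<delta> c) = 0 \<Longrightarrow> snd (init ID \<delta> c) = 0 \<Longrightarrow> c = 0"
  by (auto simp: init_def vec_eq_iff) metis

lemma init_fst_eq_0: "\<delta> > 0 \<Longrightarrow> fst (init ID \<delta> c) = 0 \<Longrightarrow> c = 0"
  by (auto simp: init_def vec_eq_iff) (metis mult_eq_0_iff less_irrefl)

lemma init_continuous: "continuous_on S (\<lambda>t. init ID (fst t) (snd t))"
proof -
  have "continuous_on S (\<lambda>t. if i \<in> ID then fst t * snd t $ i else snd t $ i)" for i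
    by (cases "i \<in> ID") (auto intro!: continuous_intros)
  moreover have "continuous_on S (\<lambda>t. if i \<in> ID then snd t $ i else 0)" for i
    by (cases "i \<in> ID") (auto intro!: continuous_intros)
  ultimately show ?thesis unfolding init_def by (intro continuous_on_Pair continuous_on_vec_lambda)
qed

context legendre_extremal begin

lemma a_in: "a \<in> {a..b}" and b_in: "b \<in> {a..b}" using ab by auto

lemma Sol_init_scaleR: "x \<in> {a..b} \<Longrightarrow> Sol x (init ID \<delta> (t *\<^sub>R c)) = t *\<^sub>R Sol x (init ID \<delta> c)"
  by (simp add: linear_simps[OF init_bounded_linear] linear_scale[OF Sol_linear])

lemma nondegenerate_perturbation:
  assumes H0: "\<And>x c. a < x \<Longrightarrow> x \<le> b \<Longrightarrow> fst (Sol x (init IDa 0 c)) = 0 \<Longrightarrow> c = 0"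
    and Hb: "\<And>c. c \<noteq> 0 \<Longrightarrow> fst (Sol b (init IDa 0 c)) \<in> RD IDb \<Longrightarrow>
      snd (Sol b (init IDa 0 c)) \<bullet> fst (Sol b (init IDa 0 c)) > 0"
  obtains \<delta> where "\<delta> > 0" "\<And>x c. x \<in> {a..b} \<Longrightarrow> fst (Sol x (init IDa \<delta> c)) = 0 \<Longrightarrow> c = 0"
    "\<And>c. c \<noteq> 0 \<Longrightarrow> fst (Sol b (init IDa \<delta> c)) \<in> RD IDb \<Longrightarrow>
      snd (Sol b (init IDa \<delta> c)) \<bullet> fst (Sol b (init IDa \<delta> c)) > 0"
proof -
  obtain \<kappa> where k: "\<kappa> > 0" "\<kappa> \<le> b - a"
    "\<And>x h k. a < x \<Longrightarrow> x \<le> a + \<kappa> \<Longrightarrow> h \<bullet> k \<ge> 0 \<Longrightarrow> fst (Sol x (h, k)) = 0 \<Longrightarrow> h = 0 \<and> k = 0"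
    using no_zero_near_a by blast
  have cS: "continuous_on S (\<lambda>t. Sol (p t) (init IDa (q t) (r t)))"
    if "continuous_on S p" "continuous_on S q" "continuous_on S r" "\<And>t. t \<in> S \<Longrightarrow> p t \<in> {a..b}"
    for S :: "'z::topological_space set" and p q r
  proof -
    have "continuous_on S (\<lambda>t. init IDa (fst (q t, r t)) (snd (q t, r t)))"
      by (rule continuous_on_compose2[OF init_continuous[of UNIV]]) (use that in \<open>auto intro!: continuous_intros\<close>)
    then have "continuous_on S (\<lambda>t. (\<lambda>(x, \<eta>). Sol x \<eta>) (p t, init IDa (q t) (r t)))"
      by (intro continuous_on_compose2[OF Sol_cont] continuous_on_Pair that) (use that in auto)
    then show ?thesis by simp
  qed
  let ?S1 = "{0..1::real} \<times> ({a + \<kappa>..b} \<times> sphere (0::real^'n) 1)"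
  \<comment> \<open>Bad triples: a perturbation, a point away from \<open>a\<close> and a unit
    vector whose solution vanishes there. Homogeneity in \<open>c\<close> allows the restriction to
    the sphere.\<close>
  define D1 where "D1 = ?S1 \<inter> (\<lambda>t. fst (Sol (fst (snd t)) (init IDa (fst t) (snd (snd t))))) -` {0}"
  have comp1: "compact ?S1" by (intro compact_Times) auto
  have "closed D1" unfolding D1_def
    by (intro continuous_closed_preimage compact_imp_closed[OF comp1] continuous_on_fst cS continuous_intros) (use k in auto)
  then have "compact D1" using compact_Int_closed[OF comp1, of D1] by (simp add: D1_def Int_absorb1 inf_assoc[symmetric])
  moreover have "(0, y) \<notin> D1" for y
    using H0[of "fst y" "snd y"] k(1) by (auto simp: D1_def)
  ultimately obtain d1 where d1: "d1 > 0" "\<And>t y. \<bar>t\<bar> < d1 \<Longrightarrow> (t, y) \<notin> D1" using compact_avoid_fst by blast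
  let ?S2 = "{0..1::real} \<times> sphere (0::real^'n) 1"
  let ?g = "\<lambda>t. Sol b (init IDa (fst t) (snd t))"
  \<comment> \<open>Bad pairs at \<open>b\<close>: unit vectors that meet the boundary condition
    with a nonpositive form. The set is closed because \<open>RD IDb\<close> and {..0} are.\<close>
  define D2 where "D2 = ?S2 \<inter> (\<lambda>t. (fst (?g t), snd (?g t) \<bullet> fst (?g t))) -` (RD IDb \<times> {..0})"
  have comp2: "compact ?S2" by (intro compact_Times) auto
  have "closed D2" unfolding D2_def
    by (intro continuous_closed_preimage compact_imp_closed[OF comp2] continuous_on_Pair continuous_on_inner
        continuous_on_fst continuous_on_snd cS closed_Times closed_RD continuous_intros) (use ab in auto)
  then have "compact D2" using compact_Int_closed[OF comp2, of D2] by (simp add: D2_def Int_absorb1 inf_assoc[symmetric])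
  moreover have "(0, c) \<notin> D2" for c
    using Hb[of c] by (cases "c = 0") (auto simp: D2_def)
  ultimately obtain d2 where d2: "d2 > 0" "\<And>t y. \<bar>t\<bar> < d2 \<Longrightarrow> (t, y) \<notin> D2" using compact_avoid_fst by blast
  define \<delta> where "\<delta> = min (1/2) (min (d1/2) (d2/2))"
  have \<delta>: "\<delta> > 0" "\<delta> \<le> 1" "\<bar>\<delta>\<bar> < d1" "\<bar>\<delta>\<bar> < d2" using d1(1) d2(1) by (auto simp: \<delta>_def)
  have unit: "c /\<^sub>R norm c \<in> sphere 0 1" if "c \<noteq> 0" for c :: "real^'n" using that by simp
  show thesis
  proof (rule that[OF \<delta>(1)])
    fix x c assume x: "x \<in> {a..b}" and z: "fst (Sol x (init IDa \<delta> c)) = 0"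
    consider "x = a" | "a < x" "x \<le> a + \<kappa>" | "x > a + \<kappa>" using x by force
    then show "c = 0"
    proof cases
      case 1
      then show ?thesis using z init_fst_eq_0[OF \<delta>(1)] by (auto simp: Sol)
    next
      case 2
      have "fst (init IDa \<delta> c) = 0 \<and> snd (init IDa \<delta> c) = 0"
        by (rule k(3)[OF 2 init_inner]) (use z \<delta> in auto)
      then show ?thesis using init_eq_0 by blast
    next
      case 3
      show ?thesis
      proof (rule ccontr)
        assume c: "c \<noteq> 0"
        have "fst (Sol x (init IDa \<delta> (c /\<^sub>R norm c))) = 0" using z by (simp add: Sol_init_scaleR[OF x])
        then have "(\<delta>, x, c /\<^sub>R norm c) \<in> D1" using unit[OF c] 3 x \<delta> by (simp add: D1_def)
        then show False using d1(2) \<delta> by blast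
      qed
    qed
  next
    fix c :: "real^'n" assume c: "c \<noteq> 0" and R: "fst (Sol b (init IDa \<delta> c)) \<in> RD IDb"
    define u where "u = c /\<^sub>R norm c"
    have cu: "c = norm c *\<^sub>R u" using c by (simp add: u_def)
    have "fst (Sol b (init IDa \<delta> u)) \<in> RD IDb"
      unfolding u_def Sol_init_scaleR[OF b_in] using R by (simp add: RD_scaleR)
    moreover have "(\<delta>, u) \<notin> D2" using d2(2) \<delta> by blast
    ultimately have "snd (Sol b (init IDa \<delta> u)) \<bullet> fst (Sol b (init IDa \<delta> u)) > 0"
      using unit[OF c] \<delta> by (auto simp: D2_def u_def)
    then show "snd (Sol b (init IDa \<delta> c)) \<bullet> fst (Sol b (init IDa \<delta> c)) > 0"
      by (subst (1 2) cu) (simp add: Sol_init_scaleR[OF b_in] c)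
  qed
qed

text \<open>The flow is projected to positions; at parameter 0 this projection has an injective
  derivative by \<open>inj\<close>, so it is inverted near the compact segment {a..b} x {0}, hence
  on a common parameter ball. Momenta of the flow are the values of \<open>f_p\<close> at the slope,
  which turns the three conditions into statements about the flow.\<close>

lemma field_exists:
  assumes natA: "\<And>j. j \<notin> IDa \<Longrightarrow> fP (z0 a) $ j = 0" and natB: "\<And>j. j \<notin> IDb \<Longrightarrow> fP (z0 b) $ j = 0"
    and \<delta>: "\<delta> > 0" and inj: "\<And>x c. x \<in> {a..b} \<Longrightarrow> fst (Sol x (init IDa \<delta> c)) = 0 \<Longrightarrow> c = 0"
    and pos: "\<And>c. c \<noteq> 0 \<Longrightarrow> fst (Sol b (init IDa \<delta> c)) \<in> RD IDb \<Longrightarrow>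
      snd (Sol b (init IDa \<delta> c)) \<bullet> fst (Sol b (init IDa \<delta> c)) > 0"
  shows "\<exists>et \<phi>. is_field f a b u0 et \<phi> \<and> cond_S f a b u0 et \<phi> W \<and> cond_Fa f a b IDa u0 et \<phi> W \<and> cond_Fb f a b IDb u0 et \<phi> W"
proof -
  obtain r where "ode_tube a b \<Omega> G G' y0 r" using ode_tube_ex by blast
  then interpret ode: ode_tube a b \<Omega> G G' y0 r .
  let ?J = "init IDa \<delta>"
  show ?thesis
  proof (rule ode.flow[OF init_bounded_linear[of IDa \<delta>]])
    fix \<rho> Y Y' assume \<rho>: "\<rho> > 0" and YC: "C1_on (UNIV \<times> ball 0 \<rho>) Y Y'"
      and Y\<Omega>: "\<And>x \<alpha>. x \<in> {a..b} \<Longrightarrow> \<alpha> \<in> ball 0 \<rho> \<Longrightarrow> (x, Y (x, \<alpha>)) \<in> \<Omega>"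
      and Yx: "\<And>x \<alpha>. x \<in> {a..b} \<Longrightarrow> \<alpha> \<in> ball 0 \<rho> \<Longrightarrow> ((\<lambda>x. Y (x, \<alpha>)) has_vector_derivative G (x, Y (x, \<alpha>))) (at x within {a..b})"
      and Ya: "\<And>\<alpha>. Y (a, \<alpha>) = y0 a + ?J \<alpha>"
      and Y0: "\<And>x. x \<in> {a..b} \<Longrightarrow> Y (x, 0) = y0 x"
      and Y'x: "\<And>x \<beta>. x \<in> {a..b} \<Longrightarrow> ((\<lambda>x. Y' (x, 0) (0, \<beta>)) has_vector_derivative G' (x, y0 x) (0, Y' (x, 0) (0, \<beta>))) (at x within {a..b})"
      and Y'a: "\<And>\<beta>. Y' (a, 0) (0, \<beta>) = ?J \<beta>"
    have Y'Sol: "Y' (x, 0) (0, \<beta>) = Sol x (?J \<beta>)" if "x \<in> {a..b}" for x \<beta>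
      using lin_ode_eq_Sol[of "\<lambda>x. Y' (x, 0) (0, \<beta>)", OF _ that] Y'x Y'a by (simp add: lin_ode_def)
    let ?B = "UNIV \<times> ball 0 \<rho> :: (real \<times> (real^'n)) set"
    have oB: "open ?B" by (simp add: open_Times)
    have fY: "C1_on ?B (\<lambda>z. fst (Y z)) (\<lambda>z h. fst (Y' z h))"
      by (rule C1_on_compose[OF YC C1_on_bounded_linear[OF bounded_linear_fst open_UNIV]]) auto
    define P where "P = (\<lambda>z. (fst z, fst (Y z)))"
    define P' where "P' = (\<lambda>z h. (fst h, fst (Y' z h)))"
    have PC: "C1_on ?B P P'" unfolding P_def P'_def
      by (intro C1_on_Pair fY C1_on_bounded_linear[OF bounded_linear_fst oB])
    have K: "compact ({a..b} \<times> {0::real^'n})" "{a..b} \<times> {0} \<subseteq> ?B" using \<rho> by (auto intro!: compact_Times)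
    have injK: "inj_on P ({a..b} \<times> {0})" by (auto simp: inj_on_def P_def)
    have injP': "inj (P' z)" if zK: "z \<in> {a..b} \<times> {0}" for z
    proof -
      obtain x where x: "x \<in> {a..b}" "z = (x, 0)" using zK by blast
      have l: "linear (P' z)" using C1_on_linear_deriv[OF PC] K(2) zK by (auto simp: linear_conv_bounded_linear)
      have "h = 0" if "P' z h = 0" for h
      proof -
        obtain s c where h: "h = (s, c)" by (cases h)
        have "s = 0" "fst (Y' (x, 0) (0, c)) = 0" using that by (auto simp: P'_def h x zero_prod_def)
        then show ?thesis using inj[OF x(1), of c] Y'Sol[OF x(1)] by (simp add: h zero_prod_def)
      qed
      then show ?thesis using linear_injective_0[OF l] by blast
    qed
    from C1_inverse_near_compact[OF PC K injK injP']
    obtain V1 g g' where V1: "open V1" "{a..b} \<times> {0} \<subseteq> V1" "V1 \<subseteq> ?B" "inj_on P V1" "C1_on (P ` V1) g g'"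
      "\<And>z. z \<in> V1 \<Longrightarrow> g (P z) = z" "\<And>z k. z \<in> V1 \<Longrightarrow> P' z (g' (P z) k) = k" by blast
    obtain r1 where r1: "r1 > 0" "\<And>x \<alpha>. x \<in> {a..b} \<Longrightarrow> dist \<alpha> 0 \<le> r1 \<Longrightarrow> (x, \<alpha>) \<in> V1"
      by (rule tube_in_open[OF V1(1) continuous_on_const[of "{a..b}" "0::real^'n"]]) (use V1(2) in blast)+
    \<comment> \<open>At \<open>b\<close> the increment of the flow has the derivative
      \<open>Sol b\<close> after \<open>init\<close>; by \<open>pos\<close> its form is positive,
      and this persists for small parameters.\<close>
    obtain r2 where r2: "r2 > 0" "\<And>\<alpha>. norm \<alpha> < r2 \<Longrightarrow> fst (Y (b, \<alpha>) - y0 b) \<in> RD IDb \<Longrightarrow>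
       snd (Y (b, \<alpha>) - y0 b) \<bullet> fst (Y (b, \<alpha>) - y0 b) \<ge> 0"
    proof -
      have "((\<lambda>\<alpha>. (b, \<alpha>)) has_derivative (\<lambda>h. (0, h))) (at 0)" by (auto intro!: derivative_eq_intros)
      from diff_chain_at[OF this C1_on_deriv[OF YC]] \<rho>
      have "((\<lambda>\<alpha>. Y (b, \<alpha>)) has_derivative (\<lambda>h. Sol b (?J h))) (at 0)" by (simp add: o_def Y'Sol[OF b_in])
      then have d: "((\<lambda>\<alpha>. Y (b, \<alpha>) - y0 b) has_derivative (\<lambda>h. Sol b (?J h))) (at 0)" by (auto intro!: derivative_eq_intros)
      have z: "Y (b, 0) - y0 b = 0" using Y0[OF b_in] by simp
      from positive_form_near_0[where h = "\<lambda>\<alpha>. Y (b, \<alpha>) - y0 b" and T = "\<lambda>h. Sol b (?J h)" and ID = IDb, OF d z pos] that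
      show thesis by blast
    qed
    define et where "et = min r1 r2"
    define \<phi> where "\<phi> = (\<lambda>x \<alpha>. fst (Y (x, \<alpha>)))"
    have et: "et > 0" using r1 r2 by (simp add: et_def)
    have inV: "(x, \<alpha>) \<in> V1" if "x \<in> {a..b}" "\<alpha> \<in> ball 0 et" for x \<alpha> using that by (intro r1(2)) (auto simp: et_def)
    have in\<rho>: "\<alpha> \<in> ball 0 \<rho>" if "\<alpha> \<in> ball 0 et" for \<alpha> :: "real^'n" using inV[OF a_in that] V1(3) by auto
    have \<phi>x: "((\<lambda>y. \<phi> y \<alpha>) has_vector_derivative Q (x, Y (x, \<alpha>))) (at x within {a..b})"
      and \<pi>x: "((\<lambda>y. snd (Y (y, \<alpha>))) has_vector_derivative fU (x, \<phi> x \<alpha>, Q (x, Y (x, \<alpha>)))) (at x within {a..b})"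
      and fPQ: "fP (x, \<phi> x \<alpha>, Q (x, Y (x, \<alpha>))) = snd (Y (x, \<alpha>))"
      if x: "x \<in> {a..b}" and \<alpha>: "\<alpha> \<in> ball 0 et" for x \<alpha>
    proof -
      have O: "(x, fst (Y (x, \<alpha>)), snd (Y (x, \<alpha>))) \<in> \<Omega>" using Y\<Omega>[OF x in\<rho>[OF \<alpha>]] by simp
      note D = Yx[OF x in\<rho>[OF \<alpha>]]
      show "((\<lambda>y. \<phi> y \<alpha>) has_vector_derivative Q (x, Y (x, \<alpha>))) (at x within {a..b})"
        using bounded_linear.has_vector_derivative[OF bounded_linear_fst D] by (simp add: \<phi>_def G_def)
      show "((\<lambda>y. snd (Y (y, \<alpha>))) has_vector_derivative fU (x, \<phi> x \<alpha>, Q (x, Y (x, \<alpha>)))) (at x within {a..b})"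
        using bounded_linear.has_vector_derivative[OF bounded_linear_snd D] gi_\<Omega>(1)[OF O] by (simp add: \<phi>_def G_def)
      show "fP (x, \<phi> x \<alpha>, Q (x, Y (x, \<alpha>))) = snd (Y (x, \<alpha>))" using gi_\<Omega>(3)[OF O] by (simp add: \<phi>_def)
    qed
    have vd: "vderiv a b (\<lambda>y. \<phi> y \<alpha>) x = Q (x, Y (x, \<alpha>))" if "x \<in> {a..b}" "\<alpha> \<in> ball 0 et" for x \<alpha>
      by (rule vderiv_eq[OF ab that(1) \<phi>x[OF that]])
    have injx: "\<alpha> = \<beta>" if "x \<in> {a..b}" "\<alpha> \<in> ball 0 et" "\<beta> \<in> ball 0 et" "\<phi> x \<alpha> = \<phi> x \<beta>" for x \<alpha> \<beta>
      using inj_onD[OF V1(4), of "(x, \<alpha>)" "(x, \<beta>)"] inV that by (auto simp: P_def \<phi>_def)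
    have fps: "fp f x (\<phi> x \<alpha>) (field_slope a b et \<phi> x (\<phi> x \<alpha>)) = snd (Y (x, \<alpha>))"
      if x: "x \<in> {a..b}" and \<alpha>: "\<alpha> \<in> ball 0 et" for x \<alpha>
    proof -
      have "(THE \<beta>. \<beta> \<in> ball 0 et \<and> \<phi> x \<beta> = \<phi> x \<alpha>) = \<alpha>"
        using \<alpha> injx[OF x] by (intro the_equality) blast+
      then show ?thesis using vd[OF that] fPQ[OF that] by (simp add: field_slope_def fp_eq[OF x])
    qed
    have \<phi>a: "\<phi> a \<alpha> = u0 a + fst (?J \<alpha>)" "snd (Y (a, \<alpha>)) = fP (z0 a) + snd (?J \<alpha>)" for \<alpha>
      by (simp_all add: \<phi>_def Ya y0_def)
    have "is_field f a b u0 et \<phi>"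
      unfolding is_field_def
    proof (intro conjI ballI et)
      have sub: "{a..b} \<times> ball 0 et \<subseteq> ?B" using in\<rho> by auto
      show "Ck_vec 1 ({a..b} \<times> ball 0 et) (\<lambda>(x, \<alpha>). \<phi> x \<alpha>)"
        by (rule Ck_vec_1I[OF sub fY]) (auto simp: \<phi>_def)
      show "inj_on (\<lambda>(x, \<alpha>). (x, \<phi> x \<alpha>)) ({a..b} \<times> ball 0 et)"
        using injx by (auto simp: inj_on_def)
      show "\<exists>\<alpha>inv. (\<forall>x\<in>{a..b}. \<forall>\<beta>\<in>ball 0 et. \<alpha>inv x (\<phi> x \<beta>) = \<beta>) \<and> Ck_vec 1 (field_set a b et \<phi>) (\<lambda>(x, v). \<alpha>inv x v)"
      proof (intro exI[of _ "\<lambda>x v. snd (g (x, v))"] conjI ballI)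
        show "snd (g (x, \<phi> x \<beta>)) = \<beta>" if "x \<in> {a..b}" "\<beta> \<in> ball 0 et" for x \<beta>
          using V1(6)[OF inV[OF that]] by (simp add: P_def \<phi>_def)
        have sub: "field_set a b et \<phi> \<subseteq> P ` V1" using inV by (force simp: field_set_def P_def \<phi>_def)
        have gC: "C1_on (P ` V1) (\<lambda>z. snd (g z)) (\<lambda>z h. snd (g' z h))"
          by (rule C1_on_compose[OF V1(5) C1_on_bounded_linear[OF bounded_linear_snd open_UNIV]]) auto
        show "Ck_vec 1 (field_set a b et \<phi>) (\<lambda>(x, v). snd (g (x, v)))"
          by (rule Ck_vec_1I[OF sub gC]) auto
      qed
      have YC2: "C1_on ?B (\<lambda>z. (fst z, Y z)) (\<lambda>z h. (fst h, Y' z h))"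
        by (intro C1_on_Pair YC C1_on_bounded_linear[OF bounded_linear_fst oB])
      show "Ck_vec 1 ({a..b} \<times> ball 0 et) (\<lambda>(x, \<alpha>). vderiv a b (\<lambda>y. \<phi> y \<alpha>) x)"
        by (rule Ck_vec_1I[OF _ C1_on_compose_vimage[OF YC2 Q_C1]]) (use in\<rho> Y\<Omega> vd in auto)
      fix \<beta> assume \<beta>: "\<beta> \<in> ball (0::real^'n) et"
      show "extremal f a b (\<lambda>x. \<phi> x \<beta>)"
        unfolding extremal_def
      proof (intro conjI ballI allI)
        have "C1_on UNIV (\<lambda>x::real. (x, \<beta>)) (\<lambda>x h. (h, 0))"
          by (intro C1_on_Pair C1_on_const C1_on_bounded_linear[OF bounded_linear_ident]) auto
        from C1_on_compose[OF this fY]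
        have "C1_on UNIV (\<lambda>x. fst (Y (x, \<beta>))) (\<lambda>x h. fst (Y' (x, \<beta>) (h, 0)))" using in\<rho>[OF \<beta>] by simp
        from Ck_vec_1I[OF subset_UNIV this] show "Ck_vec 1 {a..b} (\<lambda>x. \<phi> x \<beta>)" by (simp add: \<phi>_def)
        fix x i assume x: "x \<in> {a..b}"
        have "((\<lambda>y. fp f y (\<phi> y \<beta>) (vderiv a b (\<lambda>x. \<phi> x \<beta>) y)) has_vector_derivative
            fu f x (\<phi> x \<beta>) (vderiv a b (\<lambda>x. \<phi> x \<beta>) x)) (at x within {a..b})"
        proof (rule has_vector_derivative_transform[OF x])
          show "fp f y (\<phi> y \<beta>) (vderiv a b (\<lambda>x. \<phi> x \<beta>) y) = snd (Y (y, \<beta>))" if "y \<in> {a..b}" for y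
            using vd[OF that \<beta>] fPQ[OF that \<beta>] by (simp add: fp_eq[OF that])
          show "((\<lambda>y. snd (Y (y, \<beta>))) has_vector_derivative fu f x (\<phi> x \<beta>) (vderiv a b (\<lambda>x. \<phi> x \<beta>) x)) (at x within {a..b})"
            using \<pi>x[OF x \<beta>] vd[OF x \<beta>] by (simp add: fu_eq[OF x])
        qed
        from bounded_linear.has_vector_derivative[OF bounded_linear_vec_nth this]
        show "((\<lambda>y. fp f y (\<phi> y \<beta>) (vderiv a b (\<lambda>x. \<phi> x \<beta>) y) $ i) has_real_derivative
            fu f x (\<phi> x \<beta>) (vderiv a b (\<lambda>x. \<phi> x \<beta>) x) $ i) (at x within {a..b})"
          by (simp add: has_real_derivative_iff_has_vector_derivative)
      qed
    next
      show "\<phi> x 0 = u0 x" if "x \<in> {a..b}" for x using Y0[OF that] by (simp add: \<phi>_def y0_def)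
    qed
    moreover have "cond_S f a b u0 et \<phi> W"
      unfolding cond_S_def
    proof (intro allI impI)
      fix v i j assume v: "v - u0 a \<in> W \<and> (a, v) \<in> field_set a b et \<phi>"
      then obtain \<alpha> where \<alpha>: "\<alpha> \<in> ball 0 et" "v = \<phi> a \<alpha>" by (auto simp: field_set_def)
      have pd: "pdir (\<lambda>w. fp f a w (field_slope a b et \<phi> a w) $ i) (axis j 1) v = (if i \<in> IDa \<and> i = j then 1 / \<delta> else 0)" for i j
      proof -
        \<comment> \<open>The parameter direction that moves the starting point along the
          \<open>j\<close>-th axis: \<open>init\<close> scales coordinates in \<open>IDa\<close> by
          \<open>\<delta>\<close>, hence \<open>1 / \<delta>\<close>. The matrix of momentum
          derivatives becomes constant and diagonal.\<close>
        define \<beta> :: "real^'n" where "\<beta> = (if j \<in> IDa then 1 / \<delta> else 1) *\<^sub>R axis j 1"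
        have J\<beta>: "fst (?J \<beta>) = axis j 1" "snd (?J \<beta>) $ i = (if i \<in> IDa \<and> i = j then 1 / \<delta> else 0)"
          using \<delta> by (auto simp: init_def \<beta>_def vec_eq_iff axis_def)
        note Jl = linear_simps[OF init_bounded_linear[of IDa \<delta>]]
        have "open ((\<lambda>t. \<alpha> + t *\<^sub>R \<beta>) -` ball 0 et)" by (intro open_vimage continuous_intros) auto
        moreover have "0 \<in> (\<lambda>t. \<alpha> + t *\<^sub>R \<beta>) -` ball 0 et" using \<alpha> by simp
        ultimately have "\<forall>\<^sub>F t in nhds 0. t \<in> (\<lambda>t. \<alpha> + t *\<^sub>R \<beta>) -` ball 0 et" by (rule eventually_nhds_in_open)
        then have ev: "\<forall>\<^sub>F t in nhds 0. fp f a (v + t *\<^sub>R axis j 1) (field_slope a b et \<phi> a (v + t *\<^sub>R axis j 1)) $ i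
            = snd (Y (a, \<alpha>)) $ i + t * snd (?J \<beta>) $ i"
        proof eventually_elim
          case (elim t)
          have "v + t *\<^sub>R axis j 1 = \<phi> a (\<alpha> + t *\<^sub>R \<beta>)" by (simp add: \<alpha> \<phi>a Jl J\<beta>)
          then show ?case using fps[OF a_in, of "\<alpha> + t *\<^sub>R \<beta>"] elim by (simp add: \<phi>a Jl)
        qed
        have "((\<lambda>t. snd (Y (a, \<alpha>)) $ i + t * snd (?J \<beta>) $ i) has_real_derivative snd (?J \<beta>) $ i) (at 0)"
          by (auto intro!: derivative_eq_intros)
        from DERIV_imp_deriv[OF this] deriv_cong_ev[OF ev refl] show ?thesis
          by (simp only: pdir_def J\<beta>(2))
      qed
      show "pdir (\<lambda>w. fp f a w (field_slope a b et \<phi> a w) $ i) (axis j 1) v = pdir (\<lambda>w. fp f a w (field_slope a b et \<phi> a w) $ j) (axis i 1) v"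
        unfolding pd by auto
    qed
    moreover have "cond_Fa f a b IDa u0 et \<phi> W"
      unfolding cond_Fa_def
    proof (intro allI impI)
      fix v assume v: "v - u0 a \<in> RD IDa \<inter> W \<and> (a, v) \<in> field_set a b et \<phi>"
      then obtain \<alpha> where \<alpha>: "\<alpha> \<in> ball 0 et" "v = \<phi> a \<alpha>" by (auto simp: field_set_def)
      \<comment> \<open>Every product vanishes by itself: for \<open>i\<close> in \<open>IDa\<close>
        the displacement is zero, otherwise the momentum is, by the natural condition and the choice
        of \<open>init\<close>.\<close>
      have "(fP (z0 a) + snd (?J \<alpha>)) $ i * (v - u0 a) $ i = 0" for i
        using v natA[of i] by (cases "i \<in> IDa") (auto simp: RD_def init_def)
      then have "(fP (z0 a) + snd (?J \<alpha>)) \<bullet> (v - u0 a) = 0" unfolding inner_vec_def by (intro sum.neutral ballI) simp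
      then show "fp f a v (field_slope a b et \<phi> a v) \<bullet> (v - u0 a) \<le> 0"
        using fps[OF a_in \<alpha>(1)] \<alpha>(2) by (simp add: \<phi>a(2))
    qed
    moreover have "cond_Fb f a b IDb u0 et \<phi> W"
      unfolding cond_Fb_def
    proof (intro allI impI)
      fix v assume v: "v - u0 b \<in> RD IDb \<inter> W \<and> (b, v) \<in> field_set a b et \<phi>"
      then obtain \<alpha> where \<alpha>: "\<alpha> \<in> ball 0 et" "v = \<phi> b \<alpha>" by (auto simp: field_set_def)
      have vf: "v - u0 b = fst (Y (b, \<alpha>) - y0 b)" by (simp add: \<alpha> \<phi>_def y0_def)
      have 1: "snd (Y (b, \<alpha>) - y0 b) \<bullet> (v - u0 b) \<ge> 0"
        unfolding vf by (rule r2(2)) (use \<alpha> v vf in \<open>auto simp: et_def\<close>)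
      \<comment> \<open>The prescribed coordinates and the natural conditions annihilate the
        contribution of the momentum of \<open>u0\<close>; only its increment is left.\<close>
      have "fP (z0 b) $ i * (v - u0 b) $ i = 0" for i using v natB[of i] by (cases "i \<in> IDb") (auto simp: RD_def)
      then have "fP (z0 b) \<bullet> (v - u0 b) = 0" unfolding inner_vec_def by (intro sum.neutral ballI) simp
      with 1 have "snd (Y (b, \<alpha>)) \<bullet> (v - u0 b) \<ge> 0" by (simp add: y0_def inner_diff_left)
      then show "fp f b v (field_slope a b et \<phi> b v) \<bullet> (v - u0 b) \<ge> 0" using fps[OF b_in \<alpha>(1)] \<alpha>(2) by simp
    qed
    ultimately show ?thesis by blast
  qed
qed

end

section \<open>From the given Jacobi fields to the linearised flow\<close>

lemma jacobi_sol_derivs: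
  fixes h :: "real \<Rightarrow> real^'n"
  assumes "a < b" "jacobi_sol f a b u0 h"
  shows "\<And>x. x \<in> {a..b} \<Longrightarrow> (h has_vector_derivative vderiv a b h x) (at x within {a..b})"
    "\<And>x. x \<in> {a..b} \<Longrightarrow> (jacB f a b u0 h has_vector_derivative jacC f a b u0 h x) (at x within {a..b})"
  using assms Ck_vec_has_vderiv(1)[OF assms(1), of 2 h] unfolding jacobi_sol_def
  by (auto intro!: has_vector_derivative_vec)

lemma has_vector_derivative_sum_scaleR:
  fixes h :: "'i::finite \<Rightarrow> real \<Rightarrow> 'a::real_normed_vector"
  assumes "\<And>k. (h k has_vector_derivative h' k) F"
  shows "((\<lambda>x. \<Sum>k\<in>UNIV. c k *\<^sub>R h k x) has_vector_derivative (\<Sum>k\<in>UNIV. c k *\<^sub>R h' k)) F"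
  by (intro has_vector_derivative_sum bounded_linear.has_vector_derivative[OF bounded_linear_scaleR_right] assms)

context legendre_extremal begin

text \<open>The velocity \<open>h'\<close> is recovered from \<open>(h, B h)\<close> because
  \<open>f_pp\<close> is injective, so the Jacobi equation for \<open>h\<close> is the linearised
  system for the pair.\<close>

lemma jacobi_lin_ode:
  assumes p0: "\<And>x. x \<in> {a..b} \<Longrightarrow> vderiv a b u0 x = p0 x" and h: "jacobi_sol f a b u0 h"
  shows "lin_ode (\<lambda>x. (h x, jacB f a b u0 h x))"
  unfolding lin_ode_def
proof
  fix x assume x: "x \<in> {a..b}"
  obtain q where q: "G' (x, y0 x) (0, h x, jacB f a b u0 h x) = (q, DfU (z0 x) (0, h x, q))" "DfP (z0 x) (0, h x, q) = jacB f a b u0 h x"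
    using G'_y0[OF x] by blast
  have "DfP (z0 x) (0, h x, q) = DfP (z0 x) (0, h x, vderiv a b h x)"
    using q(2) jacB_eq[OF x, of u0 h] p0[OF x] by (simp add: z0_def)
  from fpp_inj[OF x this] have qe: "q = vderiv a b h x" .
  have "G' (x, y0 x) (0, h x, jacB f a b u0 h x) = (vderiv a b h x, jacC f a b u0 h x)"
    using q(1) jacC_eq[OF x, of u0 h] p0[OF x] qe by (simp add: z0_def)
  then show "((\<lambda>x. (h x, jacB f a b u0 h x)) has_vector_derivative G' (x, y0 x) (0, h x, jacB f a b u0 h x)) (at x within {a..b})"
    using jacobi_sol_derivs[OF ab h] x by (auto intro!: has_vector_derivative_Pair)
qed

lemma jacB_sum:
  assumes x: "x \<in> {a..b}" and h: "\<And>k. jacobi_sol f a b u0 (hs k)"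
  shows "jacB f a b u0 (\<lambda>x. \<Sum>k\<in>UNIV. c k *\<^sub>R hs k x) x = (\<Sum>k\<in>UNIV. c k *\<^sub>R jacB f a b u0 (hs (k::'n)) x)"
proof -
  have v: "vderiv a b (\<lambda>x. \<Sum>k\<in>UNIV. c k *\<^sub>R hs k x) x = (\<Sum>k\<in>UNIV. c k *\<^sub>R vderiv a b (hs k) x)"
    by (intro vderiv_eq[OF ab x] has_vector_derivative_sum_scaleR jacobi_sol_derivs(1)[OF ab h x])
  have l: "linear (DfP (x, u0 x, vderiv a b u0 x))" using DfP_linear[OF in_U[OF x]] by (simp add: linear_conv_bounded_linear)
  have "(0, \<Sum>k\<in>UNIV. c k *\<^sub>R hs k x, \<Sum>k\<in>UNIV. c k *\<^sub>R vderiv a b (hs k) x) = (\<Sum>k\<in>UNIV. c k *\<^sub>R (0::real, hs k x, vderiv a b (hs k) x))"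
    by (simp add: prod_eq_iff fst_sum snd_sum)
  then show ?thesis
    unfolding jacB_eq[OF x] v by (simp only: linear_sum[OF l] linear_scale[OF l])
qed

text \<open>For \<open>\<delta> = 0\<close> the map \<open>init\<close> parametrises exactly the
  initial data allowed at \<open>a\<close>, and the independent fields \<open>hs\<close> exhaust
  them by counting dimensions. Hence the first component of \<open>Sol _ (init IDa 0 c)\<close> runs
  through the span of the \<open>hs\<close>, and the hypotheses on determinant and form become
  statements about all \<open>c\<close>.\<close>

lemma jacobi_data:
  fixes hs :: "'n \<Rightarrow> real \<Rightarrow> real^'n"
  assumes p0: "\<And>x. x \<in> {a..b} \<Longrightarrow> vderiv a b u0 x = p0 x"
    and hs: "\<And>k. jacobi_sol f a b u0 (hs k)" "\<And>k. hs k a \<in> RD IDa" "\<And>k. jacB f a b u0 (hs k) a \<in> RN IDa"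
    and indep: "\<forall>c :: 'n \<Rightarrow> real. (\<forall>x\<in>{a..b}. (\<Sum>k\<in>UNIV. c k *\<^sub>R hs k x) = 0) \<longrightarrow> (\<forall>k. c k = 0)"
    and det: "\<forall>x. a < x \<and> x \<le> b \<longrightarrow> det (\<chi> i k. hs k x $ i) \<noteq> 0"
    and pos: "IDb = UNIV \<or> (\<forall>c :: 'n \<Rightarrow> real. let h = (\<lambda>x. \<Sum>k\<in>UNIV. c k *\<^sub>R hs k x) in
                 (\<exists>x\<in>{a..b}. h x \<noteq> 0) \<and> h b \<in> RD IDb \<longrightarrow> jacB f a b u0 h b \<bullet> h b > 0)"
  shows "\<And>x c. a < x \<Longrightarrow> x \<le> b \<Longrightarrow> fst (Sol x (init IDa 0 c)) = 0 \<Longrightarrow> c = 0"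
    "\<And>c. c \<noteq> 0 \<Longrightarrow> fst (Sol b (init IDa 0 c)) \<in> RD IDb \<Longrightarrow>
      snd (Sol b (init IDa 0 c)) \<bullet> fst (Sol b (init IDa 0 c)) > 0"
proof -
  \<comment> \<open>The preimage under \<open>init IDa 0\<close>: coordinates in \<open>IDa\<close>
    are read off the momentum, the others off the position.\<close>
  define e where "e = (\<lambda>k. \<chi> i. if i \<in> IDa then jacB f a b u0 (hs k) a $ i else hs k a $ i)"
  have ea: "init IDa 0 (e k) = (hs k a, jacB f a b u0 (hs k) a)" for k
    using hs(2,3)[of k] by (auto simp: init_def e_def vec_eq_iff RD_def RN_def)
  have Se: "Sol x (init IDa 0 (e k)) = (hs k x, jacB f a b u0 (hs k) x)" if "x \<in> {a..b}" for x k
    using lin_ode_eq_Sol[OF jacobi_lin_ode[OF p0 hs(1)] that, of k] by (simp add: ea)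
  define T where "T = (\<lambda>d::real^'n. \<Sum>k\<in>UNIV. d $ k *\<^sub>R e k)"
  have lT: "linear T"
    by (rule linearI) (simp_all add: T_def sum.distrib scaleR_add_left scaleR_sum_right)
  have ST: "Sol x (init IDa 0 (T d)) = (\<Sum>k\<in>UNIV. d $ k *\<^sub>R hs k x, \<Sum>k\<in>UNIV. d $ k *\<^sub>R jacB f a b u0 (hs k) x)" if x: "x \<in> {a..b}" for x d
  proof -
    have l: "linear (\<lambda>c. Sol x (init IDa 0 c))"
      using linear_compose[OF bounded_linear.linear[OF init_bounded_linear] Sol_linear[OF x]] by (simp add: o_def)
    have "Sol x (init IDa 0 (T d)) = (\<Sum>k\<in>UNIV. d $ k *\<^sub>R (hs k x, jacB f a b u0 (hs k) x))"
      unfolding T_def linear_sum[OF l] linear_scale[OF l] Se[OF x] ..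
    then show ?thesis by (simp add: prod_eq_iff fst_sum snd_sum)
  qed
  have kerT: "d = 0" if "\<And>x. x \<in> {a..b} \<Longrightarrow> (\<Sum>k\<in>UNIV. d $ k *\<^sub>R hs k x) = 0" for d
    using indep[rule_format, of "\<lambda>k. d $ k"] that by (simp add: vec_eq_iff)
  have "d = 0" if "T d = 0" for d
  proof (rule kerT)
    fix x assume x: "x \<in> {a..b}"
    have "Sol x (init IDa 0 (T d)) = 0"
      using that linear_0[OF Sol_linear[OF x]] by (simp add: linear_simps[OF init_bounded_linear])
    then show "(\<Sum>k\<in>UNIV. d $ k *\<^sub>R hs k x) = 0" using ST[OF x, of d] by (simp add: zero_prod_def)
  qed
  then have "inj T" using linear_injective_0[OF lT] by blast
  then have surj: "\<exists>d. c = T d" for c using linear_inj_imp_surj[OF lT] by (metis surjD)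
  show H0: "c = 0" if x: "a < x" "x \<le> b" and z: "fst (Sol x (init IDa 0 c)) = 0" for x c
  proof -
    obtain d where d: "c = T d" using surj by blast
    have "(\<chi> i k. hs k x $ i) *v d = 0"
      using z ST[of x d] x by (simp add: d matrix_vector_mult_def vec_eq_iff mult.commute)
    moreover have "\<exists>B. B ** (\<chi> i k. hs k x $ i) = mat 1"
      using det x unfolding invertible_det_nz[symmetric] invertible_def by blast
    ultimately have "d = 0" unfolding matrix_left_invertible_ker by blast
    then show ?thesis by (simp add: d linear_0[OF lT])
  qed
  show "snd (Sol b (init IDa 0 c)) \<bullet> fst (Sol b (init IDa 0 c)) > 0"
    if c: "c \<noteq> 0" and R: "fst (Sol b (init IDa 0 c)) \<in> RD IDb" for c
  proof -
    obtain d where d: "c = T d" using surj by blast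
    define h where "h = (\<lambda>x. \<Sum>k\<in>UNIV. d $ k *\<^sub>R hs k x)"
    have eq: "Sol b (init IDa 0 c) = (h b, jacB f a b u0 h b)"
      using ST[OF b_in, of d] jacB_sum[OF b_in hs(1), of "\<lambda>k. d $ k"] by (simp add: d h_def)
    \<comment> \<open>If every coordinate were prescribed at \<open>b\<close>, the boundary
      condition would force a zero there, which \<open>H0\<close> excludes; so the second
      alternative of \<open>pos\<close> applies.\<close>
    have IDb: "IDb \<noteq> UNIV"
    proof
      assume "IDb = UNIV"
      then have "fst (Sol b (init IDa 0 c)) = 0" using R by (simp add: RD_def vec_eq_iff)
      then show False using H0[of b c] ab c by simp
    qed
    have "\<exists>x\<in>{a..b}. h x \<noteq> 0"
    proof (rule ccontr)
      assume n: "\<not> ?thesis"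
      have "d = 0" by (rule kerT) (use n in \<open>auto simp: h_def\<close>)
      then show False using c by (simp add: d linear_0[OF lT])
    qed
    moreover have "h b \<in> RD IDb" using R by (simp add: eq)
    ultimately have "jacB f a b u0 h b \<bullet> h b > 0"
      using pos IDb unfolding Let_def h_def by blast
    then show ?thesis by (simp add: eq)
  qed
qed

end

text \<open>\<open>W\<close> is arbitrary: the parameter ball is taken so small that the conditions
  hold at all points of the field, and no radius has to be matched.\<close>

lemma jacobi_field_exists:
  fixes f :: "real \<Rightarrow> real^'n \<Rightarrow> real^'n \<Rightarrow> real" and hs :: "'n \<Rightarrow> real \<Rightarrow> real^'n"
  assumes ab: "a < b" and fC2: "integrand_Ck 2 a b f" and u0: "extremal f a b u0"
    and natA: "\<forall>j. j \<notin> IDa \<longrightarrow> fp f a (u0 a) (vderiv a b u0 a) $ j = 0"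
    and natB: "\<forall>j. j \<notin> IDb \<longrightarrow> fp f b (u0 b) (vderiv a b u0 b) $ j = 0"
    and c0: "c0 > 0" "\<And>x \<xi>. x \<in> {a..b} \<Longrightarrow>
      (\<Sum>i\<in>UNIV. \<Sum>j\<in>UNIV. fpp f x (u0 x) (vderiv a b u0 x) i j * \<xi> $ i * \<xi> $ j) \<ge> c0 * (norm \<xi>)\<^sup>2"
    and hs: "\<And>k. jacobi_sol f a b u0 (hs k)" "\<And>k. hs k a \<in> RD IDa" "\<And>k. jacB f a b u0 (hs k) a \<in> RN IDa"
    and indep: "\<forall>c :: 'n \<Rightarrow> real. (\<forall>x\<in>{a..b}. (\<Sum>k\<in>UNIV. c k *\<^sub>R hs k x) = 0) \<longrightarrow> (\<forall>k. c k = 0)"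
    and det: "\<forall>x. a < x \<and> x \<le> b \<longrightarrow> det (\<chi> i k. hs k x $ i) \<noteq> 0"
    and pos: "IDb = UNIV \<or> (\<forall>c :: 'n \<Rightarrow> real. let h = (\<lambda>x. \<Sum>k\<in>UNIV. c k *\<^sub>R hs k x) in
                 (\<exists>x\<in>{a..b}. h x \<noteq> 0) \<and> h b \<in> RD IDb \<longrightarrow> jacB f a b u0 h b \<bullet> h b > 0)"
  shows "\<exists>et \<phi>. is_field f a b u0 et \<phi> \<and> cond_S f a b u0 et \<phi> W \<and> cond_Fa f a b IDa u0 et \<phi> W \<and> cond_Fb f a b IDb u0 et \<phi> W"
proof -
  obtain U F DF D2F where "C2_integrand f a b U F DF D2F" using integrand_C2_extension[OF ab fC2] by metis
  then interpret C2_integrand f a b U F DF D2F .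
  have uC: "Ck_vec 1 {a..b} u0" using u0 by (simp add: extremal_def)
  note u0' = Ck_vec_has_vderiv[OF ab uC order_refl]
  interpret legendre_extremal f a b U F DF D2F u0 "vderiv a b u0" c0
  proof
    fix x assume x: "x \<in> {a..b}"
    show "(u0 has_vector_derivative vderiv a b u0 x) (at x within {a..b})" by (rule u0'(1)[OF x])
    have "((\<lambda>y. fp f y (u0 y) (vderiv a b u0 y)) has_vector_derivative fu f x (u0 x) (vderiv a b u0 x)) (at x within {a..b})"
      using u0 x unfolding extremal_def by (intro has_vector_derivative_vec) blast
    then have "((\<lambda>y. fp f y (u0 y) (vderiv a b u0 y)) has_vector_derivative fU (x, u0 x, vderiv a b u0 x)) (at x within {a..b})"
      by (simp add: fu_eq[OF x])
    from has_vector_derivative_transform[OF x, where g = "\<lambda>x. fP (x, u0 x, vderiv a b u0 x)", OF _ this]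
    show "((\<lambda>x. fP (x, u0 x, vderiv a b u0 x)) has_vector_derivative fU (x, u0 x, vderiv a b u0 x)) (at x within {a..b})"
      by (simp add: fp_eq)
    show "c0 * (norm \<xi>)\<^sup>2 \<le> DfP (x, u0 x, vderiv a b u0 x) (0, 0, \<xi>) \<bullet> \<xi>" for \<xi>
      using c0(2)[OF x, of \<xi>] fpp_form[OF x] by simp
  qed (use u0'(2) c0(1) in auto)
  note data = jacobi_data[OF refl hs indep det pos]
  have nat: "\<And>j. j \<notin> IDa \<Longrightarrow> fP (z0 a) $ j = 0" "\<And>j. j \<notin> IDb \<Longrightarrow> fP (z0 b) $ j = 0"
    using natA natB by (auto simp: z0_def fp_eq[OF a_in] fp_eq[OF b_in])
  show ?thesis
  proof (rule nondegenerate_perturbation[of IDa IDb])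
    show "c = 0" if "a < x" "x \<le> b" "fst (Sol x (init IDa 0 c)) = 0" for x c by (rule data(1)[OF that])
    show "snd (Sol b (init IDa 0 c)) \<bullet> fst (Sol b (init IDa 0 c)) > 0"
      if "c \<noteq> 0" "fst (Sol b (init IDa 0 c)) \<in> RD IDb" for c by (rule data(2)[OF that])
  next
    fix \<delta>
    assume \<delta>: "\<delta> > 0" and inj: "\<And>x c. x \<in> {a..b} \<Longrightarrow> fst (Sol x (init IDa \<delta> c)) = 0 \<Longrightarrow> c = 0"
      and pos: "\<And>c. c \<noteq> 0 \<Longrightarrow> fst (Sol b (init IDa \<delta> c)) \<in> RD IDb \<Longrightarrow>
        snd (Sol b (init IDa \<delta> c)) \<bullet> fst (Sol b (init IDa \<delta> c)) > 0"
    show ?thesis by (rule field_exists[OF nat \<delta> inj pos])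
  qed
qed

theorem theorem5p2:
  fixes f :: "real \<Rightarrow> real^'n \<Rightarrow> real^'n \<Rightarrow> real"
    and a b \<epsilon> :: real
    and u0 :: "real \<Rightarrow> real^'n"
    and IDa IDb :: "'n set"
  assumes ab: "a < b"
    and fC2: "integrand_Ck 2 a b f"
    and eps: "\<epsilon> > 0"
    and u0C2: "Ck_vec 2 {a..b} u0"
    and u0ext: "extremal f a b u0"
    and natA: "\<forall>j. j \<notin> IDa \<longrightarrow> fp f a (u0 a) (vderiv a b u0 a) $ j = 0"
    and natB: "\<forall>j. j \<notin> IDb \<longrightarrow> fp f b (u0 b) (vderiv a b u0 b) $ j = 0"
  shows
   \<comment> \<open>(i) strong minimizer\<close>
   "(\<forall>et \<phi>. is_field f a b u0 et \<phi>
        \<and> cond_S f a b u0 et \<phi> (ball 0 \<epsilon>)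
        \<and> cond_Fa f a b IDa u0 et \<phi> (ball 0 \<epsilon>)
        \<and> cond_Fb f a b IDb u0 et \<phi> (ball 0 \<epsilon>)
        \<and> (\<forall>(x, v)\<in>field_set a b et \<phi>. \<forall>q. excess f x v (field_slope a b et \<phi> x v) q \<ge> 0)
      \<longrightarrow> strong_min f a b IDa IDb u0)
  \<and> \<comment> \<open>(i) weak minimizer\<close>
    (\<forall>et \<phi> \<eta>. is_field f a b u0 et \<phi>
        \<and> cond_S f a b u0 et \<phi> (ball 0 \<epsilon>)
        \<and> cond_Fa f a b IDa u0 et \<phi> (ball 0 \<epsilon>)
        \<and> cond_Fb f a b IDb u0 et \<phi> (ball 0 \<epsilon>)
        \<and> \<eta> > 0
        \<and> (\<forall>(x, v)\<in>field_set a b et \<phi>. \<forall>q. norm (q - field_slope a b et \<phi> x v) \<le> \<eta> \<longrightarrow>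
              excess f x v (field_slope a b et \<phi> x v) q \<ge> 0)
      \<longrightarrow> weak_min f a b IDa IDb u0)
  \<and> \<comment> \<open>(i) global minimizer\<close>
    (\<forall>et \<phi>. is_field f a b u0 et \<phi>
        \<and> field_set a b et \<phi> = {a..b} \<times> UNIV
        \<and> cond_S f a b u0 et \<phi> UNIV
        \<and> cond_Fa f a b IDa u0 et \<phi> UNIV
        \<and> cond_Fb f a b IDb u0 et \<phi> UNIV
        \<and> (\<forall>(x, v)\<in>field_set a b et \<phi>. \<forall>q. excess f x v (field_slope a b et \<phi> x v) q \<ge> 0)
      \<longrightarrow> global_min f a b IDa IDb u0)
  \<and> \<comment> \<open>(ii) not a weak minimizer\<close>
    (IDa = {} \<longrightarrow>
      (\<forall>et \<phi> w0. is_field f a b u0 et \<phi>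
        \<and> cond_S f a b u0 et \<phi> (ball 0 \<epsilon>)
        \<and> (\<forall>v. v - u0 a \<in> RD IDa \<inter> ball 0 \<epsilon> \<and> (a, v) \<in> field_set a b et \<phi> \<longrightarrow>
              fp f a v (field_slope a b et \<phi> a v) \<bullet> (v - u0 a) \<ge> 0)
        \<and> w0 \<in> RD IDb
        \<and> (\<forall>t v. 0 < t \<and> t < 1 \<and> v = u0 b + t *\<^sub>R w0 \<and> (b, v) \<in> field_set a b et \<phi> \<longrightarrow>
              fp f b v (field_slope a b et \<phi> b v) \<bullet> (v - u0 b) < 0)
      \<longrightarrow> \<not> weak_min f a b IDa IDb u0))
  \<and> \<comment> \<open>(iii) existence of a suitable field\<close>
    ((integrand_Ck 3 a b f
      \<and> (\<exists>c0>0. \<forall>x\<in>{a..b}. \<forall>\<xi>::real^'n.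
            (\<Sum>i\<in>UNIV. \<Sum>j\<in>UNIV. fpp f x (u0 x) (vderiv a b u0 x) i j * \<xi> $ i * \<xi> $ j) \<ge> c0 * (norm \<xi>)\<^sup>2)
      \<and> (\<exists>hs :: 'n \<Rightarrow> real \<Rightarrow> real^'n.
            (\<forall>k. jacobi_sol f a b u0 (hs k) \<and> hs k a \<in> RD IDa \<and> jacB f a b u0 (hs k) a \<in> RN IDa)
          \<and> (\<forall>c :: 'n \<Rightarrow> real. (\<forall>x\<in>{a..b}. (\<Sum>k\<in>UNIV. c k *\<^sub>R hs k x) = 0) \<longrightarrow> (\<forall>k. c k = 0))
          \<and> (\<forall>x. a < x \<and> x \<le> b \<longrightarrow> det (\<chi> i k. hs k x $ i) \<noteq> 0)
          \<and> (IDb = UNIV \<or>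
              (\<forall>c :: 'n \<Rightarrow> real. let h = (\<lambda>x. \<Sum>k\<in>UNIV. c k *\<^sub>R hs k x) in
                 (\<exists>x\<in>{a..b}. h x \<noteq> 0) \<and> h b \<in> RD IDb \<longrightarrow> jacB f a b u0 h b \<bullet> h b > 0)))
      \<and> (IDa = {} \<or> IDa = UNIV \<or>
          ((\<forall>i\<in>IDa. \<forall>u p u' p'. (\<forall>j\<in>IDa. u $ j = u' $ j \<and> p $ j = p' $ j) \<longrightarrow>
                fp f a u p $ i = fp f a u' p' $ i)
           \<and> (\<forall>i\<in>IDa. \<forall>j\<in>IDa. \<forall>u p. fpu f a u p i j = fpu f a u p j i))))
     \<longrightarrow> (\<exists>et \<phi>. is_field f a b u0 et \<phi>
            \<and> cond_S f a b u0 et \<phi> (ball 0 \<epsilon>)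
            \<and> cond_Fa f a b IDa u0 et \<phi> (ball 0 \<epsilon>)
            \<and> cond_Fb f a b IDb u0 et \<phi> (ball 0 \<epsilon>)))"
proof (intro conjI allI impI; (elim conjE exE)?)
  fix et \<phi>
  assume fld: "is_field f a b u0 et \<phi>"
  obtain U F DF D2F U1 Ph Ph' U2 Al Al' U3 Px Px' where
    "extremal_field_for f a b U F DF D2F et U1 Ph Ph' U2 Al Al' U3 Px Px' u0 \<phi>"
    by (rule is_field_extremal_field_for[OF ab fC2 fld])
  then interpret extremal_field_for f a b U F DF D2F et U1 Ph Ph' U2 Al Al' U3 Px Px' u0 \<phi> .
  {
    assume "cond_S f a b u0 et \<phi> (ball 0 \<epsilon>)" "cond_Fa f a b IDa u0 et \<phi> (ball 0 \<epsilon>)" "cond_Fb f a b IDb u0 et \<phi> (ball 0 \<epsilon>)"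
      "\<forall>(x, v)\<in>field_set a b et \<phi>. \<forall>q. excess f x v (field_slope a b et \<phi> x v) q \<ge> 0"
    then show "strong_min f a b IDa IDb u0" by (rule field_strong_min[OF eps])
  next
    fix \<eta> :: real
    assume "cond_S f a b u0 et \<phi> (ball 0 \<epsilon>)" "cond_Fa f a b IDa u0 et \<phi> (ball 0 \<epsilon>)" "cond_Fb f a b IDb u0 et \<phi> (ball 0 \<epsilon>)" "\<eta> > 0"
      "\<forall>(x, v)\<in>field_set a b et \<phi>. \<forall>q. norm (q - field_slope a b et \<phi> x v) \<le> \<eta> \<longrightarrow> excess f x v (field_slope a b et \<phi> x v) q \<ge> 0"
    then show "weak_min f a b IDa IDb u0" by (rule field_weak_min[OF eps])
  next
    assume "field_set a b et \<phi> = {a..b} \<times> UNIV"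
      "cond_S f a b u0 et \<phi> UNIV" "cond_Fa f a b IDa u0 et \<phi> UNIV" "cond_Fb f a b IDb u0 et \<phi> UNIV"
      "\<forall>(x, v)\<in>field_set a b et \<phi>. \<forall>q. excess f x v (field_slope a b et \<phi> x v) q \<ge> 0"
    then show "global_min f a b IDa IDb u0" by (rule field_global_min)
  next
    fix w0
    assume "IDa = {}" "cond_S f a b u0 et \<phi> (ball 0 \<epsilon>)"
      "\<forall>v. v - u0 a \<in> RD IDa \<inter> ball 0 \<epsilon> \<and> (a, v) \<in> field_set a b et \<phi> \<longrightarrow> fp f a v (field_slope a b et \<phi> a v) \<bullet> (v - u0 a) \<ge> 0"
      "w0 \<in> RD IDb"
      "\<forall>t v. 0 < t \<and> t < 1 \<and> v = u0 b + t *\<^sub>R w0 \<and> (b, v) \<in> field_set a b et \<phi> \<longrightarrow> fp f b v (field_slope a b et \<phi> b v) \<bullet> (v - u0 b) < 0"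
    then show "\<not> weak_min f a b IDa IDb u0" by (rule field_not_weak_min[OF eps])
  }
next
  fix c0 :: real and hs :: "'n \<Rightarrow> real \<Rightarrow> real^'n"
  assume c0: "c0 > 0" "\<forall>x\<in>{a..b}. \<forall>\<xi>::real^'n.
      (\<Sum>i\<in>UNIV. \<Sum>j\<in>UNIV. fpp f x (u0 x) (vderiv a b u0 x) i j * \<xi> $ i * \<xi> $ j) \<ge> c0 * (norm \<xi>)\<^sup>2"
    and hs: "\<forall>k. jacobi_sol f a b u0 (hs k) \<and> hs k a \<in> RD IDa \<and> jacB f a b u0 (hs k) a \<in> RN IDa"
    and indep: "\<forall>c :: 'n \<Rightarrow> real. (\<forall>x\<in>{a..b}. (\<Sum>k\<in>UNIV. c k *\<^sub>R hs k x) = 0) \<longrightarrow> (\<forall>k. c k = 0)"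
    and det: "\<forall>x. a < x \<and> x \<le> b \<longrightarrow> det (\<chi> i k. hs k x $ i) \<noteq> 0"
    and pos: "IDb = UNIV \<or> (\<forall>c :: 'n \<Rightarrow> real. let h = (\<lambda>x. \<Sum>k\<in>UNIV. c k *\<^sub>R hs k x) in
                 (\<exists>x\<in>{a..b}. h x \<noteq> 0) \<and> h b \<in> RD IDb \<longrightarrow> jacB f a b u0 h b \<bullet> h b > 0)"
  show "\<exists>et \<phi>. is_field f a b u0 et \<phi> \<and> cond_S f a b u0 et \<phi> (ball 0 \<epsilon>)
      \<and> cond_Fa f a b IDa u0 et \<phi> (ball 0 \<epsilon>) \<and> cond_Fb f a b IDb u0 et \<phi> (ball 0 \<epsilon>)"
    by (rule jacobi_field_exists[OF ab fC2 u0ext natA natB c0(1) _ _ _ _ indep det pos]) (use c0(2) hs in blast)+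
qed

end
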